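(* The planar pseudo bracket polynomial is invariant under regular isotopy of oriented planar pseudo links: if two oriented planar pseudo link diagrams $K,K'$ are regularly isotopic, then $\langle K\rangle=\langle K'\rangle$ in $\mathbb{Z}[A^{\pm1},V,H]$.
   Context: **Pseudo link diagrams.** A planar pseudo link diagram is a (nonempty) generic immersion of finitely many circles in the plane whose finitely many transverse double points are each either a classical crossing (with over/under information) or a precrossing (no over/under information). It is oriented if every component is oriented. **Regular isotopy** is the equivalence relation on pseudo link diagrams generated by the moves R0, R2, R3, PR2, PR3, where: R0 is planar isotopy; R2, R3 are the classical Reidemeister moves; PR2: in a two-strand tangle consisting of a precrossing followed by a classical crossing (bounding a bigon), the order of the two is exchanged, the type of the classical crossing being kept (in 2-braid-like notation, $p\,\sigma^{\pm1}\leftrightarrow\sigma^{\pm1}p$); PR3: an arc passing entirely over, or entirely under, the two strands of a precrossing is moved across the precrossing. Moves are local, in all variants, and respect orientations. **Planar pseudo bracket.** Put $d=-A^2-A^{-2}$. For an oriented diagram $K$ and a double point $c$, let $K_o$ be the result of smoothing $c$ according to the orientation and $K_u$ the result of the other smoothing; which smoothing is which, and the signs of crossings, are determined once and for all by the orientation of the initial diagram. The polynomial $\langle K\rangle\in\mathbb{Z}[A^{\pm1},V,H]$ is defined by: 1. $\langle K\rangle=A\langle K_o\rangle+A^{-1}\langle K_u\rangle$ at a positive classical crossing; 2. $\langle K\rangle=A^{-1}\langle K_o\rangle+A\langle K_u\rangle$ at a negative classical crossing; 3. $\langle K\rangle=V\langle K_o\rangle+H\langle K_u\rangle$ at a precrossing;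 4. $\langle L\cup {\rm O}\rangle=d\,\langle L\rangle$ for $L$ nonempty and ${\rm O}$ a simple closed curve disjoint from $L$ bounding a disc disjoint from $L$ (equivalently, a split unknotted circle); 5. $\langle {\rm O}\rangle=1$ for a single simple closed curve. *)

theory Defs
  imports "HOL-Analysis.Analysis" "HOL-Library.Poly_Mapping"
begin

section \<open>Oriented planar pseudo link diagrams\<close>

text \<open>
  The plane is the type of complex numbers, a circle is \<open>\<real>/\<int>\<close>, and a map out of a circle is given by
  its 1-periodic lift to the reals.  A \<^emph>\<open>parameter\<close> \<open>(i, t)\<close> names the point \<open>t mod 1\<close> of the \<open>i\<close>-th
  circle.  The circles are numbered by \<open>i < ncomp K\<close>, and each is oriented by increasing \<open>t\<close>.

  The set \<open>over K\<close> holds the parameters that run over at a classical crossing.  A double point with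
  exactly one of its two parameters in \<open>over K\<close> is a classical crossing; a double point with none
  of them in \<open>over K\<close> is a precrossing.
\<close>

type_synonym param = "nat \<times> real"

record diagram_data =
  ncomp :: nat
  curve :: "nat \<Rightarrow> real \<Rightarrow> complex"
  over :: "param set"

definition params :: "diagram_data \<Rightarrow> param set" where
  "params K = {..<ncomp K} \<times> UNIV"

definition pt :: "diagram_data \<Rightarrow> param \<Rightarrow> complex" where
  "pt K p = curve K (fst p) (snd p)"

definition velocity :: "diagram_data \<Rightarrow> param \<Rightarrow> complex" where
  "velocity K p = vector_derivative (curve K (fst p)) (at (snd p))"

definition same_param :: "param \<Rightarrow> param \<Rightarrow> bool" where
  "same_param p q \<longleftrightarrow> fst p = fst q \<and> snd p - snd q \<in> \<int>"

definition meet :: "diagram_data \<Rightarrow> param \<Rightarrow> param \<Rightarrow> bool" where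
  "meet K p q \<longleftrightarrow> p \<in> params K \<and> q \<in> params K \<and> \<not> same_param p q \<and> pt K p = pt K q"

definition dpts :: "diagram_data \<Rightarrow> complex set" where
  "dpts K = {pt K p | p q. meet K p q}"

text \<open>The determinant of two plane vectors.\<close>

definition cross :: "complex \<Rightarrow> complex \<Rightarrow> real" where
  "cross u v = Re u * Im v - Im u * Re v"

definition closed_immersion :: "(real \<Rightarrow> complex) \<Rightarrow> bool" where
  "closed_immersion \<gamma> \<longleftrightarrow> (\<forall>t. \<gamma> (t + 1) = \<gamma> t) \<and>
     (\<exists>\<gamma>'. (\<forall>t. (\<gamma> has_vector_derivative \<gamma>' t) (at t) \<and> \<gamma>' t \<noteq> 0) \<and> continuous_on UNIV \<gamma>')"

definition diagram :: "diagram_data \<Rightarrow> bool" where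
  "diagram K \<longleftrightarrow>
     ncomp K \<ge> 1 \<and>
     (\<forall>i < ncomp K. closed_immersion (curve K i)) \<and>
     finite (dpts K) \<and>
     (\<forall>p q r. meet K p q \<and> meet K p r \<longrightarrow> same_param q r) \<and>
     (\<forall>p q. meet K p q \<longrightarrow> cross (velocity K p) (velocity K q) \<noteq> 0) \<and>
     over K \<subseteq> params K \<and>
     (\<forall>p q. p \<in> over K \<and> same_param p q \<longrightarrow> q \<in> over K) \<and>
     (\<forall>p \<in> over K. \<exists>q. meet K p q \<and> q \<notin> over K)"

text \<open>
  A crossing is positive when the over strand has to be turned counterclockwise (by an angle less
  than \<open>\<pi>\<close>) to point in the direction of the under strand.
\<close>

definition positive_crossing :: "diagram_data \<Rightarrow> complex \<Rightarrow> bool" where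
  "positive_crossing K c \<longleftrightarrow>
     (\<exists>p q. meet K p q \<and> pt K p = c \<and> p \<in> over K \<and> cross (velocity K p) (velocity K q) > 0)"

definition negative_crossing :: "diagram_data \<Rightarrow> complex \<Rightarrow> bool" where
  "negative_crossing K c \<longleftrightarrow>
     (\<exists>p q. meet K p q \<and> pt K p = c \<and> p \<in> over K \<and> cross (velocity K p) (velocity K q) < 0)"

definition precrossing :: "diagram_data \<Rightarrow> complex \<Rightarrow> bool" where
  "precrossing K c \<longleftrightarrow> c \<in> dpts K \<and> (\<forall>p \<in> params K. pt K p = c \<longrightarrow> p \<notin> over K)"


section \<open>Regular isotopy\<close>

subsection \<open>R0: planar isotopy\<close>

text \<open>
  An ambient isotopy of the plane through diffeomorphisms, starting at the identity.  The inverse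
  of each stage is again differentiable because the derivatives are invertible.
\<close>

definition ambient_isotopy :: "(real \<Rightarrow> complex \<Rightarrow> complex) \<Rightarrow> bool" where
  "ambient_isotopy h \<longleftrightarrow>
     (\<forall>z. h 0 z = z) \<and>
     continuous_on ({0..1} \<times> UNIV) (\<lambda>(t, z). h t z) \<and>
     (\<forall>t \<in> {0..1}. bij (h t)) \<and>
     (\<exists>D. (\<forall>t \<in> {0..1}. \<forall>z. (h t has_derivative D t z) (at z) \<and> inj (D t z)) \<and>
          (\<forall>v. continuous_on ({0..1} \<times> UNIV) (\<lambda>(t, z). D t z v)))"

text \<open>An orientation preserving diffeomorphism of the circle, lifted to the reals.\<close>

definition circle_diffeo :: "(real \<Rightarrow> real) \<Rightarrow> bool" where
  "circle_diffeo \<phi> \<longleftrightarrow> (\<forall>t. \<phi> (t + 1) = \<phi> t + 1) \<and>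
     (\<exists>\<phi>'. (\<forall>t. (\<phi> has_real_derivative \<phi>' t) (at t) \<and> \<phi>' t > 0) \<and> continuous_on UNIV \<phi>')"

text \<open>
  The move also renumbers the components and reparametrizes each of them compatibly with its
  orientation, since a diagram does not depend on the choice of parametrization.
\<close>

definition R0 :: "diagram_data \<Rightarrow> diagram_data \<Rightarrow> bool" where
  "R0 K K' \<longleftrightarrow> (\<exists>h \<sigma> \<phi>. ambient_isotopy h \<and> bij_betw \<sigma> {..<ncomp K'} {..<ncomp K} \<and>
     (\<forall>i < ncomp K'. circle_diffeo (\<phi> i)) \<and>
     (\<forall>i < ncomp K'. \<forall>t. curve K' i t = h 1 (curve K (\<sigma> i) (\<phi> i t))) \<and>
     (\<forall>i < ncomp K'. \<forall>t. (i, t) \<in> over K' \<longleftrightarrow> (\<sigma> i, \<phi> i t) \<in> over K))"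

subsection \<open>Local tangles\<close>

text \<open>
  Up to planar isotopy the disc in which a local move takes place is a fixed square, and the part
  of the diagram in it is drawn like a braid running from left to right: every strand is the graph of a
  function over the horizontal axis, and may be oriented either way.  A strand \<open>(i, a, b)\<close> is the
  restriction of component \<open>i\<close> to the parameter interval \<open>[a, b]\<close>.
\<close>

definition square :: "complex set" where
  "square = {z. \<bar>Re z\<bar> \<le> 1 \<and> \<bar>Im z\<bar> \<le> 1}"

type_synonym strand = "nat \<times> real \<times> real"

fun strand_params :: "strand \<Rightarrow> param set" where
  "strand_params (i, a, b) = {(i, t + of_int k) | t k. a \<le> t \<and> t \<le> b}"

fun horizontal_strand :: "diagram_data \<Rightarrow> strand \<Rightarrow> bool" where
  "horizontal_strand K (i, a, b) \<longleftrightarrow> i < ncomp K \<and> a < b \<and>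
     (\<forall>t \<in> {a..b}. \<bar>Im (pt K (i, t))\<bar> < 1) \<and>
     (Re (pt K (i, a)) = -1 \<and> Re (pt K (i, b)) = 1 \<and> (\<forall>t \<in> {a..b}. Re (velocity K (i, t)) > 0) \<or>
      Re (pt K (i, a)) = 1 \<and> Re (pt K (i, b)) = -1 \<and> (\<forall>t \<in> {a..b}. Re (velocity K (i, t)) < 0))"

definition braid_in_square :: "diagram_data \<Rightarrow> strand list \<Rightarrow> bool" where
  "braid_in_square K ss \<longleftrightarrow>
     (\<forall>s \<in> set ss. horizontal_strand K s) \<and>
     (\<forall>j < length ss. \<forall>k < j. strand_params (ss ! j) \<inter> strand_params (ss ! k) = {}) \<and>
     {p \<in> params K. pt K p \<in> square} = (\<Union>s \<in> set ss. strand_params s) \<and>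
     (\<forall>c \<in> dpts K \<inter> square. \<bar>Re c\<bar> < 1)"

text \<open>
  The two diagrams are equal outside the square, and in the square both are braids whose corresponding strands
  share their end points and orientations (the end points agree by continuity).
\<close>

definition local_change :: "diagram_data \<Rightarrow> diagram_data \<Rightarrow> strand list \<Rightarrow> bool" where
  "local_change K K' ss \<longleftrightarrow>
     braid_in_square K ss \<and> braid_in_square K' ss \<and> ncomp K' = ncomp K \<and>
     (\<forall>p \<in> params K - (\<Union>s \<in> set ss. strand_params s).
        pt K' p = pt K p \<and> (p \<in> over K' \<longleftrightarrow> p \<in> over K))"

definition strand_through :: "diagram_data \<Rightarrow> strand \<Rightarrow> complex \<Rightarrow> bool" where
  "strand_through K s c \<longleftrightarrow> (\<exists>p \<in> strand_params s. pt K p = c)"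

definition strand_over :: "diagram_data \<Rightarrow> strand \<Rightarrow> complex \<Rightarrow> bool" where
  "strand_over K s c \<longleftrightarrow> (\<exists>p \<in> strand_params s. pt K p = c \<and> p \<in> over K)"

subsection \<open>The moves on two strands\<close>

definition R2 :: "diagram_data \<Rightarrow> diagram_data \<Rightarrow> bool" where
  "R2 K K' \<longleftrightarrow> (\<exists>s0 s1 c1 c2. local_change K K' [s0, s1] \<and>
     dpts K \<inter> square = {} \<and> dpts K' \<inter> square = {c1, c2} \<and> c1 \<noteq> c2 \<and>
     strand_over K' s0 c1 \<and> strand_over K' s0 c2)"

text \<open>
  Since the two strands exchange sides at each double point, it is the sign of the classical crossing
  (the exponent of \<open>\<sigma>\<close>) that is kept in PR2; the strand that runs over is not the same one on the
  two sides of the move.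
\<close>

definition PR2 :: "diagram_data \<Rightarrow> diagram_data \<Rightarrow> bool" where
  "PR2 K K' \<longleftrightarrow> (\<exists>s0 s1 c1 c2 c1' c2'. local_change K K' [s0, s1] \<and>
     dpts K \<inter> square = {c1, c2} \<and> Re c1 < Re c2 \<and>
     dpts K' \<inter> square = {c1', c2'} \<and> Re c1' < Re c2' \<and>
     precrossing K c1 \<and> precrossing K' c2' \<and>
     (positive_crossing K c2 \<and> positive_crossing K' c1' \<or>
      negative_crossing K c2 \<and> negative_crossing K' c1'))"

subsection \<open>The moves on three strands\<close>

text \<open>
  Any two of the three strands meet exactly once, strands \<open>j\<close> and \<open>k\<close> in the point \<open>c j k\<close>.  With
  the strands suitably numbered, the double points are met in the order 01, 02, 12 from left to
  right on one side of the move, and in the opposite order on the other.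
\<close>

definition triangle :: "diagram_data \<Rightarrow> strand list \<Rightarrow> (nat \<Rightarrow> nat \<Rightarrow> complex) \<Rightarrow> bool" where
  "triangle K ss c \<longleftrightarrow> dpts K \<inter> square = {c 0 1, c 0 2, c 1 2} \<and> (\<forall>j k. c j k = c k j) \<and>
     (\<forall>j < 3. \<forall>k < 3. j \<noteq> k \<longrightarrow> strand_through K (ss ! j) (c j k))"

definition triangle_move ::
  "diagram_data \<Rightarrow> diagram_data \<Rightarrow> strand list \<Rightarrow> (nat \<Rightarrow> nat \<Rightarrow> complex) \<Rightarrow> (nat \<Rightarrow> nat \<Rightarrow> complex) \<Rightarrow> bool"
  where
  "triangle_move K K' ss c c' \<longleftrightarrow> length ss = 3 \<and> local_change K K' ss \<and>
     triangle K ss c \<and> Re (c 0 1) < Re (c 0 2) \<and> Re (c 0 2) < Re (c 1 2) \<and>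
     triangle K' ss c' \<and> Re (c' 1 2) < Re (c' 0 2) \<and> Re (c' 0 2) < Re (c' 0 1)"

text \<open>The three strands lie at three different heights \<open>z\<close> above the plane.\<close>

definition R3 :: "diagram_data \<Rightarrow> diagram_data \<Rightarrow> bool" where
  "R3 K K' \<longleftrightarrow> (\<exists>ss c c' (z :: nat \<Rightarrow> nat). triangle_move K K' ss c c' \<and> inj_on z {..<3} \<and>
     (\<forall>j < 3. \<forall>k < 3. z k < z j \<longrightarrow>
        strand_over K (ss ! j) (c j k) \<and> strand_over K' (ss ! j) (c' j k)))"

text \<open>Strand \<open>l\<close> passes entirely over or entirely under the strands \<open>j\<close> and \<open>k\<close> of the precrossing.\<close>

definition PR3 :: "diagram_data \<Rightarrow> diagram_data \<Rightarrow> bool" where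
  "PR3 K K' \<longleftrightarrow> (\<exists>ss c c' j k l. triangle_move K K' ss c c' \<and> {j, k, l} = {..<3 :: nat} \<and>
     precrossing K (c j k) \<and> precrossing K' (c' j k) \<and>
     ((\<forall>m \<in> {j, k}. strand_over K (ss ! l) (c l m) \<and> strand_over K' (ss ! l) (c' l m)) \<or>
      (\<forall>m \<in> {j, k}. strand_over K (ss ! m) (c l m) \<and> strand_over K' (ss ! m) (c' l m))))"

subsection \<open>The equivalence relation\<close>

definition regular_isotopic :: "diagram_data \<Rightarrow> diagram_data \<Rightarrow> bool" where
  "regular_isotopic =
     equivclp (\<lambda>K K'. diagram K \<and> diagram K' \<and> (R0 K K' \<or> R2 K K' \<or> R3 K K' \<or> PR2 K K' \<or> PR3 K K'))"


section \<open>Smoothings\<close>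

text \<open>
  A diagram in which some double points have been smoothed is represented by the original diagram
  together with a partial map from its double points to the smoothings performed there; in this way
  the orientation of the initial diagram stays available.
\<close>

datatype smoothing = Oriented | Unoriented

type_synonym smoothings = "complex \<Rightarrow> smoothing option"

definition regular_params :: "diagram_data \<Rightarrow> param set" where
  "regular_params K = {p \<in> params K. pt K p \<notin> dpts K}"

text \<open>\<open>x\<close> lies on the edge of the diagram that ends, respectively starts, at the parameter \<open>p\<close>.\<close>

definition just_before :: "diagram_data \<Rightarrow> param \<Rightarrow> param \<Rightarrow> bool" where
  "just_before K x p \<longleftrightarrow> fst x = fst p \<and> snd x < snd p \<and>
     (\<forall>t \<in> {snd x..<snd p}. (fst p, t) \<in> regular_params K)"

definition just_after :: "diagram_data \<Rightarrow> param \<Rightarrow> param \<Rightarrow> bool" where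
  "just_after K x p \<longleftrightarrow> fst x = fst p \<and> snd p < snd x \<and>
     (\<forall>t \<in> {snd p<..snd x}. (fst p, t) \<in> regular_params K)"

text \<open>
  Two regular parameters are joined if they lie on one edge, or on two edges that a smoothing
  connects: the oriented smoothing connects each incoming edge with the outgoing edge of the other strand,
  the other one connects the two incoming edges, and the two outgoing edges.
\<close>

inductive joined :: "diagram_data \<Rightarrow> smoothings \<Rightarrow> param \<Rightarrow> param \<Rightarrow> bool" for K s where
  same: "same_param x y \<Longrightarrow> joined K s x y"
| edge: "fst x = fst y \<Longrightarrow> (\<forall>t \<in> closed_segment (snd x) (snd y). (fst x, t) \<in> regular_params K)
         \<Longrightarrow> joined K s x y"
| oriented: "meet K p q \<Longrightarrow> s (pt K p) = Some Oriented \<Longrightarrow> just_before K x p \<Longrightarrow> just_after K y q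
         \<Longrightarrow> joined K s x y"
| unoriented_in: "meet K p q \<Longrightarrow> s (pt K p) = Some Unoriented \<Longrightarrow> just_before K x p \<Longrightarrow> just_before K y q
         \<Longrightarrow> joined K s x y"
| unoriented_out: "meet K p q \<Longrightarrow> s (pt K p) = Some Unoriented \<Longrightarrow> just_after K x p \<Longrightarrow> just_after K y q
         \<Longrightarrow> joined K s x y"

text \<open>
  The circles that remain when every double point of \<open>K\<close> has been smoothed according to \<open>s\<close>, each
  given by the regular parameters on it.
\<close>

definition circles :: "diagram_data \<Rightarrow> smoothings \<Rightarrow> param set set" where
  "circles K s = regular_params K //
     {(x, y). x \<in> regular_params K \<and> y \<in> regular_params K \<and>
        equivclp (\<lambda>u v. u \<in> regular_params K \<and> v \<in> regular_params K \<and> joined K s u v) x y}"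


section \<open>The planar pseudo bracket\<close>

text \<open>
  The ring of integer Laurent polynomials in \<open>A\<close> that are polynomial in \<open>V\<close> and \<open>H\<close>; the exponent
  \<open>(a, v, h)\<close> stands for \<open>A\<^sup>a V\<^sup>v H\<^sup>h\<close>.
\<close>

type_synonym bracket_poly = "(int \<times> nat \<times> nat) \<Rightarrow>\<^sub>0 int"

definition A_var :: bracket_poly where "A_var = Poly_Mapping.single (1, 0, 0) 1"
definition A_inv :: bracket_poly where "A_inv = Poly_Mapping.single (-1, 0, 0) 1"
definition V_var :: bracket_poly where "V_var = Poly_Mapping.single (0, 1, 0) 1"
definition H_var :: bracket_poly where "H_var = Poly_Mapping.single (0, 0, 1) 1"

definition d_val :: bracket_poly where "d_val = - (A_var ^ 2) - A_inv ^ 2"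

text \<open>
  The value of \<open>n\<close> disjoint simple closed curves.  An innermost one among them always bounds a disc
  disjoint from the others, so for \<open>n \<ge> 2\<close> it can be split off at the cost of a factor \<open>d\<close>.  The
  empty link does not occur; its value is a dummy.
\<close>

fun unlink_value :: "nat \<Rightarrow> bracket_poly" where
  "unlink_value 0 = 0"
| "unlink_value (Suc 0) = 1"
| "unlink_value (Suc (Suc n)) = d_val * unlink_value (Suc n)"

text \<open>\<open>bracket_eval K s p\<close>: the rules evaluate the diagram obtained from \<open>K\<close> by the smoothings \<open>s\<close> to \<open>p\<close>.\<close>

inductive bracket_eval :: "diagram_data \<Rightarrow> smoothings \<Rightarrow> bracket_poly \<Rightarrow> bool" for K where
  positive: "c \<notin> dom s \<Longrightarrow> positive_crossing K c
     \<Longrightarrow> bracket_eval K (s(c \<mapsto> Oriented)) p \<Longrightarrow> bracket_eval K (s(c \<mapsto> Unoriented)) q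
     \<Longrightarrow> bracket_eval K s (A_var * p + A_inv * q)"
| negative: "c \<notin> dom s \<Longrightarrow> negative_crossing K c
     \<Longrightarrow> bracket_eval K (s(c \<mapsto> Oriented)) p \<Longrightarrow> bracket_eval K (s(c \<mapsto> Unoriented)) q
     \<Longrightarrow> bracket_eval K s (A_inv * p + A_var * q)"
| pre: "c \<notin> dom s \<Longrightarrow> precrossing K c
     \<Longrightarrow> bracket_eval K (s(c \<mapsto> Oriented)) p \<Longrightarrow> bracket_eval K (s(c \<mapsto> Unoriented)) q
     \<Longrightarrow> bracket_eval K s (V_var * p + H_var * q)"
| unlink: "dom s = dpts K \<Longrightarrow> bracket_eval K s (unlink_value (card (circles K s)))"

definition bracket :: "diagram_data \<Rightarrow> bracket_poly" where
  "bracket K = (THE p. bracket_eval K Map.empty p)"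

text \<open>
  The rules determine exactly one value, whatever the order in which the double points are smoothed,
  so the definite description above is meaningful.
\<close>

inductive weights :: "diagram_data \<Rightarrow> complex \<Rightarrow> bracket_poly \<Rightarrow> bracket_poly \<Rightarrow> bool" for K where
  "positive_crossing K c \<Longrightarrow> weights K c A_var A_inv"
| "negative_crossing K c \<Longrightarrow> weights K c A_inv A_var"
| "precrossing K c \<Longrightarrow> weights K c V_var H_var"

lemma meet_sym: "meet K p q \<Longrightarrow> meet K q p"
  unfolding meet_def same_param_def by (metis Ints_minus minus_diff_eq)

lemma crossing_pair_unique:
  assumes D: "diagram K" and m: "meet K p q" and m': "meet K p' q'" and e: "pt K p = pt K p'"
  shows "same_param p p' \<or> same_param q p'"
proof (rule ccontr)
  assume n: "\<not> ?thesis"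
  then have "meet K p p'" using m m' e unfolding meet_def by auto
  then have "same_param q p'" using D m unfolding diagram_def by blast
  then show False using n by blast
qed

lemma same_param_sym: "same_param p q \<Longrightarrow> same_param q p"
  unfolding same_param_def by (metis Ints_minus minus_diff_eq)

lemma vector_derivative_periodic:
  fixes \<gamma> :: "real \<Rightarrow> complex"
  assumes "closed_immersion \<gamma>" and "u - t \<in> \<int>"
  shows "vector_derivative \<gamma> (at u) = vector_derivative \<gamma> (at t)"
proof -
  obtain k :: int where k: "u = t + of_int k"
    using assms(2) by (metis Ints_cases add.commute diff_add_cancel)
  have per1: "\<gamma> (s + 1) = \<gamma> s" for s using assms(1) unfolding closed_immersion_def by blast
  have pern: "\<gamma> (s + of_nat n) = \<gamma> s" for s n
  proof (induction n)
    case (Suc n)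
    then show ?case using per1[of "s + of_nat n"] by (simp add: algebra_simps)
  qed simp
  have per: "\<gamma> (s + of_int k) = \<gamma> s" for s
    using pern[of s "nat k"] pern[of "s + of_int k" "nat (- k)"] by (cases "k \<ge> 0") auto
  obtain \<gamma>' where g: "\<And>t. (\<gamma> has_vector_derivative \<gamma>' t) (at t)"
    using assms(1) unfolding closed_immersion_def by blast
  have "((\<gamma> \<circ> (\<lambda>s. s + of_int k)) has_vector_derivative 1 *\<^sub>R \<gamma>' u) (at t)"
    by (rule vector_diff_chain_at) (auto intro!: derivative_eq_intros simp: k[symmetric] g)
  then have "(\<gamma> has_vector_derivative \<gamma>' u) (at t)" by (simp add: comp_def per)
  then show ?thesis using g vector_derivative_at by metis
qed

lemma velocity_same_param:
  assumes "diagram K" "same_param p q" "p \<in> params K"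
  shows "velocity K p = velocity K q"
proof -
  have "closed_immersion (curve K (fst p))" using assms unfolding diagram_def params_def by auto
  then show ?thesis using assms(2) vector_derivative_periodic unfolding velocity_def same_param_def by metis
qed

lemma over_not_both:
  assumes "diagram K" "meet K p q" "p \<in> over K"
  shows "q \<notin> over K"
proof -
  obtain r where r: "meet K p r" "r \<notin> over K" using assms unfolding diagram_def by blast
  then have "same_param q r" using assms unfolding diagram_def by blast
  then show ?thesis using r assms(1) unfolding diagram_def by blast
qed

lemma not_positive_negative:
  assumes D: "diagram K" and P: "positive_crossing K c" and N: "negative_crossing K c"
  shows False
proof -
  obtain p q where 1: "meet K p q" "pt K p = c" "p \<in> over K" "cross (velocity K p) (velocity K q) > 0"
    using P unfolding positive_crossing_def by blast
  obtain p' q' where 2: "meet K p' q'" "pt K p' = c" "p' \<in> over K" "cross (velocity K p') (velocity K q') < 0"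
    using N unfolding negative_crossing_def by blast
  have "\<not> same_param q p'"
    using over_not_both[OF D 1(1) 1(3)] 2(3) D same_param_sym unfolding diagram_def by blast
  then have s: "same_param p p'" using crossing_pair_unique[OF D 1(1) 2(1)] 1 2 by auto
  have "\<not> same_param q' p"
    using over_not_both[OF D 2(1) 2(3)] 1(3) D same_param_sym unfolding diagram_def by blast
  then have "meet K p q'"
    using 1 2 same_param_sym unfolding meet_def by metis
  then have s': "same_param q q'" using D 1(1) unfolding diagram_def by blast
  have "velocity K p = velocity K p'" "velocity K q = velocity K q'"
    using velocity_same_param[OF D s] velocity_same_param[OF D s'] 1(1) unfolding meet_def by auto
  then show False using 1(4) 2(4) by simp
qed

lemma not_pre_classical:
  assumes "precrossing K c" "positive_crossing K c \<or> negative_crossing K c"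
  shows False
  using assms unfolding precrossing_def positive_crossing_def negative_crossing_def meet_def by blast

lemma weights_unique:
  assumes "diagram K" "weights K c x y" "weights K c x' y'"
  shows "x = x' \<and> y = y'"
  using assms(2,3) not_positive_negative[OF assms(1)] not_pre_classical
  by (auto elim!: weights.cases)

lemma weights_dpts: "weights K c x y \<Longrightarrow> c \<in> dpts K"
  by (erule weights.cases) (unfold positive_crossing_def negative_crossing_def precrossing_def dpts_def, blast+)

lemma weights_exist:
  assumes D: "diagram K" and c: "c \<in> dpts K"
  shows "\<exists>x y. weights K c x y"
proof (cases "precrossing K c")
  case True
  then show ?thesis using weights.intros(3) by blast
next
  case False
  then obtain p where p: "pt K p = c" "p \<in> over K" using c unfolding precrossing_def by blast
  then obtain q where q: "meet K p q" using D unfolding diagram_def by blast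
  then have "cross (velocity K p) (velocity K q) \<noteq> 0" using D unfolding diagram_def by blast
  then have "cross (velocity K p) (velocity K q) < 0 \<or> cross (velocity K p) (velocity K q) > 0" by linarith
  then have "positive_crossing K c \<or> negative_crossing K c"
    using p q unfolding positive_crossing_def negative_crossing_def by blast
  then show ?thesis using weights.intros by blast
qed

lemma bracket_eval_step:
  assumes "c \<notin> dom s" "weights K c x y" "bracket_eval K (s(c \<mapsto> Oriented)) p"
    "bracket_eval K (s(c \<mapsto> Unoriented)) q"
  shows "bracket_eval K s (x * p + y * q)"
  using assms(2) by cases (use assms bracket_eval.intros in auto)

lemma bracket_eval_cases:
  assumes "bracket_eval K s r"
  obtains c x y p q where "c \<notin> dom s" "weights K c x y" "bracket_eval K (s(c \<mapsto> Oriented)) p"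
      "bracket_eval K (s(c \<mapsto> Unoriented)) q" "r = x * p + y * q"
    | "dom s = dpts K" "r = unlink_value (card (circles K s))"
  using assms by cases (metis weights.intros)+

lemma bracket_eval_ex1:
  assumes D: "diagram K"
  shows "dom s \<subseteq> dpts K \<Longrightarrow> \<exists>!p. bracket_eval K s p"
proof (induction "card (dpts K - dom s)" arbitrary: s rule: less_induct)
  case less
  have fin: "finite (dpts K)" using D unfolding diagram_def by blast
  have IH: "\<exists>!p. bracket_eval K (s(c \<mapsto> o1)) p" if "c \<in> dpts K - dom s" for c o1
    using that fin less(2) by (intro less(1) psubset_card_mono) auto
  have IH2: "\<exists>!p. bracket_eval K (s(c \<mapsto> o1, c' \<mapsto> o2)) p"
    if "c \<in> dpts K - dom s" "c' \<in> dpts K - dom s" for c c' o1 o2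
    using that fin less(2) by (intro less(1) psubset_card_mono) auto
  define E where "E t = (THE p. bracket_eval K t p)" for t
  have E1: "bracket_eval K (s(c \<mapsto> o1)) p \<longleftrightarrow> p = E (s(c \<mapsto> o1))" if "c \<in> dpts K - dom s" for c o1 p
    unfolding E_def using IH[OF that] by (metis the_equality)
  have E2: "bracket_eval K (s(c \<mapsto> o1, c' \<mapsto> o2)) p \<longleftrightarrow> p = E (s(c \<mapsto> o1, c' \<mapsto> o2))"
    if "c \<in> dpts K - dom s" "c' \<in> dpts K - dom s" for c c' o1 o2 p
    unfolding E_def using IH2[OF that] by (metis the_equality)
  show ?case
  proof (cases "dom s = dpts K")
    case True
    show ?thesis
    proof (rule ex1I)
      show "bracket_eval K s (unlink_value (card (circles K s)))" by (rule bracket_eval.unlink[OF True])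
      show "p = unlink_value (card (circles K s))" if "bracket_eval K s p" for p
        using that by (rule bracket_eval_cases) (use True weights_dpts in auto)
    qed
  next
    case False
    then obtain c where c: "c \<in> dpts K - dom s" using less(2) by blast
    obtain x y where w: "weights K c x y" using weights_exist[OF D] c by blast
    define r where "r = x * E (s(c \<mapsto> Oriented)) + y * E (s(c \<mapsto> Unoriented))"
    show ?thesis
    proof (rule ex1I)
      show "bracket_eval K s r" unfolding r_def
        using c w E1[OF c] by (intro bracket_eval_step) auto
      fix r' assume "bracket_eval K s r'"
      then show "r' = r"
      proof (rule bracket_eval_cases)
        fix c' x' y' p q
        assume c'0: "c' \<notin> dom s" and w': "weights K c' x' y'"
          and p: "bracket_eval K (s(c' \<mapsto> Oriented)) p" and q: "bracket_eval K (s(c' \<mapsto> Unoriented)) q"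
          and r': "r' = x' * p + y' * q"
        have c': "c' \<in> dpts K - dom s" using c'0 weights_dpts[OF w'] by blast
        have pq: "p = E (s(c' \<mapsto> Oriented))" "q = E (s(c' \<mapsto> Unoriented))" using p q E1[OF c'] by auto
        show "r' = r"
        proof (cases "c' = c")
          case True
          then show ?thesis using weights_unique[OF D w] w' r' pq r_def by auto
        next
          case ne: False
          define F where "F u v = E (s(c \<mapsto> u, c' \<mapsto> v))" for u v
          have sw: "s(c' \<mapsto> v, c \<mapsto> u) = s(c \<mapsto> u, c' \<mapsto> v)" for u v
            using ne by (simp add: fun_upd_twist)
          have "bracket_eval K (s(c \<mapsto> u)) (x' * F u Oriented + y' * F u Unoriented)" for u
            unfolding F_def using c' ne w' E2[OF c c'] by (intro bracket_eval_step) auto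
          then have a: "E (s(c \<mapsto> u)) = x' * F u Oriented + y' * F u Unoriented" for u
            using E1[OF c] by simp
          have "bracket_eval K (s(c' \<mapsto> v)) (x * F Oriented v + y * F Unoriented v)" for v
          proof (rule bracket_eval_step[OF _ w])
            show "c \<notin> dom (s(c' \<mapsto> v))" using c ne by auto
            show "bracket_eval K (s(c' \<mapsto> v, c \<mapsto> Oriented)) (F Oriented v)"
              unfolding F_def sw using E2[OF c c'] by blast
            show "bracket_eval K (s(c' \<mapsto> v, c \<mapsto> Unoriented)) (F Unoriented v)"
              unfolding F_def sw using E2[OF c c'] by blast
          qed
          then have b: "E (s(c' \<mapsto> v)) = x * F Oriented v + y * F Unoriented v" for v
            using E1[OF c'] by simp
          show ?thesis unfolding r' r_def pq a b by (simp add: algebra_simps)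
        qed
      qed (use False in simp)
    qed
  qed
qed

lemma bracket_well_defined:
  assumes "diagram K"
  shows "\<exists>!p. bracket_eval K Map.empty p"
  using bracket_eval_ex1[OF assms, of Map.empty] by simp

end

theory Submission
  imports Defs
begin

text \<open>
  The bracket is a sum over the ways to smooth all double points, and a completely smoothed diagram
  enters it only through the weights of its double points and the number of its circles.  Circles are
  counted by means of \<^emph>\<open>labellings\<close>: functions on the parameters that are constant along edges and
  across smoothings.  Sending a point to its circle is the finest labelling
  (\<open>labelling_circle_of\<close>, \<open>labelling_factors\<close>), so two smoothed diagrams have the same number of circles
  as soon as the labellings of each can be carried over to the other one.

  For R0 a reparametrization carries labellings over, and crossings keep their signs since an ambient
  isotopy has a derivative of positive determinant (\<open>R0_bracket\<close>).

  In every other move the diagrams agree outside the square.  One first smooths the double points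
  outside, in the same way in both diagrams (\<open>value_at_eq_outside\<close>); the states of the few remaining
  double points are compared one by one.  Cut the square vertically into slabs between the
  double points.  A labelling then amounts, inside the square, to one label per strand and slab.  At a
  double point, one of the smoothings exchanges the labels of the two strands (it is the oriented one
  iff the strands are parallel); the other one makes the two labels to the left equal, and likewise the two
  labels to the right (\<open>labelling_from_chain\<close>, \<open>chain_from_labelling\<close>).  A smoothed braid thus
  becomes a relation between the labels at its left ends and those at its right ends, that is, a
  Temperley-Lieb diagram, and the number of circles that reach the outside depends on this relation
  only (\<open>same_outer_value\<close>).  Besides these circles there is at most one, inside the square, which
  contributes the factor \<open>d\<close>.

  What remains is a computation in the Temperley-Lieb algebra on two or three strands, where a
  classical crossing is \<open>A\<close> times the identity plus \<open>A\<^bsup>-1\<^esup>\<close> times the turn, or the same with \<open>A\<close> and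
  \<open>A\<^bsup>-1\<^esup>\<close> exchanged, and a precrossing is a combination of the two with weights \<open>V\<close> and \<open>H\<close>.  R2 holds
  because of \<open>A\<^sup>2 + A\<^bsup>-2\<^esup> + d = 0\<close>.  PR2 holds because both crossings lie in the
  commutative algebra generated by one turn.  R3 and PR3 reduce to one identity (\<open>triangle_identity\<close>), which is
  satisfied whenever two of the three crossings are classical and their signs fit together, whatever
  the third one is.  The signs are governed by slopes: planarity forces the three crossings of a
  triangle to have slope differences of the same sign, before and after the move (\<open>triangle_equal_signs\<close>).
\<close>

section \<open>Labellings of a smoothed diagram\<close>

lemma pt_same_param:
  assumes D: "diagram K" and p: "p \<in> params K" and s: "same_param p q"
  shows "pt K q = pt K p"
proof -
  define \<gamma> where "\<gamma> = curve K (fst p)"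
  have "closed_immersion \<gamma>" using D p unfolding diagram_def params_def \<gamma>_def by auto
  then have per1: "\<gamma> (t + 1) = \<gamma> t" for t unfolding closed_immersion_def by blast
  have pern: "\<gamma> (t + of_nat n) = \<gamma> t" for t n
  proof (induction n)
    case (Suc n)
    then show ?case using per1[of "t + of_nat n"] by (simp add: algebra_simps)
  qed simp
  have per: "\<gamma> (t + of_int k) = \<gamma> t" for t k
    using pern[of t "nat k"] pern[of "t + of_int k" "nat (- k)"] by (cases "k \<ge> 0") auto
  obtain k :: int where "snd p - snd q = of_int k" using s unfolding same_param_def by (auto elim: Ints_cases)
  then have "snd p = snd q + of_int k" by simp
  then show ?thesis using per[of "snd q" k] s unfolding pt_def \<gamma>_def same_param_def by simp
qed

lemma params_same_param: "same_param p q \<Longrightarrow> p \<in> params K \<longleftrightarrow> q \<in> params K"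
  unfolding same_param_def params_def by (cases p; cases q) auto

lemma same_param_refl [simp]: "same_param p p"
  unfolding same_param_def by simp

lemma same_param_trans: "same_param p q \<Longrightarrow> same_param q r \<Longrightarrow> same_param p r"
  using Ints_add[of "snd p - snd q" "snd q - snd r"] unfolding same_param_def by auto

lemma regular_same_param:
  assumes "diagram K" "same_param p q"
  shows "p \<in> regular_params K \<longleftrightarrow> q \<in> regular_params K"
proof -
  have "q \<in> params K \<longleftrightarrow> p \<in> params K" using params_same_param[OF assms(2)] by simp
  moreover have "pt K q = pt K p" if "p \<in> params K" using pt_same_param[OF assms(1) that assms(2)] .
  ultimately show ?thesis unfolding regular_params_def by auto
qed

lemma meet_same_param:
  assumes D: "diagram K" and "meet K p q" "same_param p p'" "same_param q q'"
  shows "meet K p' q'"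
  unfolding meet_def
proof (intro conjI)
  show "p' \<in> params K" "q' \<in> params K" using assms params_same_param unfolding meet_def by blast+
  show "\<not> same_param p' q'" using assms same_param_trans same_param_sym unfolding meet_def by blast
  show "pt K p' = pt K q'" using assms pt_same_param unfolding meet_def by metis
qed

lemma regular_or_meet:
  assumes "p \<in> params K" "p \<notin> regular_params K" "diagram K"
  obtains q where "meet K p q"
proof -
  obtain p' q' where m: "meet K p' q'" "pt K p = pt K p'"
    using assms unfolding regular_params_def dpts_def by auto
  show thesis
  proof (cases "same_param p p'")
    case True
    then show ?thesis using meet_same_param[OF assms(3) m(1) same_param_sym[OF True], of q'] that by simp
  next
    case False
    then show ?thesis using m assms that unfolding meet_def by blast
  qed
qed

lemma curve_props:
  assumes "diagram K" "i < ncomp K"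
  shows "(curve K i has_vector_derivative velocity K (i, t)) (at t)"
    and "velocity K (i, t) \<noteq> 0"
    and "continuous_on UNIV (curve K i)"
    and "continuous_on UNIV (\<lambda>t. velocity K (i, t))"
proof -
  obtain \<gamma>' where g: "\<And>t. (curve K i has_vector_derivative \<gamma>' t) (at t) \<and> \<gamma>' t \<noteq> 0" "continuous_on UNIV \<gamma>'"
    using assms unfolding diagram_def closed_immersion_def by metis
  have e: "velocity K (i, t) = \<gamma>' t" for t
    unfolding velocity_def using g vector_derivative_at by auto
  show "(curve K i has_vector_derivative velocity K (i, t)) (at t)" "velocity K (i, t) \<noteq> 0"
    "continuous_on UNIV (\<lambda>t. velocity K (i, t))"
    unfolding e using g by auto
  show "continuous_on UNIV (curve K i)"
    using g(1) has_vector_derivative_continuous continuous_at_imp_continuous_on by blast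
qed

text \<open>Double points are isolated along each strand: an immersed curve is locally injective.\<close>

lemma eventually_regular:
  assumes D: "diagram K" and i: "i < ncomp K"
  shows "\<forall>\<^sub>F t in at t0. (i, t) \<in> regular_params K"
proof -
  have "\<forall>\<^sub>F t in at t0. curve K i t \<noteq> c" for c
  proof (cases "curve K i t0 = c")
    case True
    define D where "D = velocity K (i, t0)"
    have "((\<lambda>t. norm (curve K i t - curve K i t0 - (t - t0) *\<^sub>R D) / norm (t - t0)) \<longlongrightarrow> 0) (at t0)"
      using curve_props(1)[OF assms, of t0] unfolding has_vector_derivative_def has_derivative_iff_norm D_def by blast
    moreover have "0 < norm D" using curve_props(2)[OF assms] unfolding D_def by simp
    ultimately have "\<forall>\<^sub>F t in at t0. norm (curve K i t - curve K i t0 - (t - t0) *\<^sub>R D) / norm (t - t0) < norm D"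
      by (rule order_tendstoD(2))
    then show ?thesis using eventually_neq_at_within[of t0 t0 UNIV]
    proof eventually_elim
      case (elim t)
      show ?case
      proof
        assume "curve K i t = c"
        then have "norm (curve K i t - curve K i t0 - (t - t0) *\<^sub>R D) / norm (t - t0) = norm D"
          using True elim(2) by (simp add: norm_minus_commute)
        then show False using elim(1) by simp
      qed
    qed
  next
    case False
    have "(curve K i \<longlongrightarrow> curve K i t0) (at t0)"
      using curve_props(3)[OF D i] by (simp add: continuous_on_def)
    then show ?thesis using False tendsto_imp_eventually_ne by blast
  qed
  then have "\<forall>\<^sub>F t in at t0. \<forall>c \<in> dpts K. curve K i t \<noteq> c"
    using D unfolding diagram_def by (simp add: eventually_ball_finite_distrib)
  then show ?thesis
    by eventually_elim (use i in \<open>auto simp: regular_params_def params_def pt_def\<close>)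
qed

definition germ_left :: "(param \<Rightarrow> 'a) \<Rightarrow> param \<Rightarrow> 'a \<Rightarrow> bool" where
  "germ_left g p u \<longleftrightarrow> (\<forall>\<^sub>F t in at_left (snd p). g (fst p, t) = u)"

definition germ_right :: "(param \<Rightarrow> 'a) \<Rightarrow> param \<Rightarrow> 'a \<Rightarrow> bool" where
  "germ_right g p u \<longleftrightarrow> (\<forall>\<^sub>F t in at_right (snd p). g (fst p, t) = u)"

text \<open>
  What a labelling has to satisfy near one parameter.  Only the labels on both sides of a double point
  are constrained, not the label of the double point itself.  The condition is local, so
  labels can be changed in one part of a diagram without looking at the others.
\<close>

definition compatible_at :: "diagram_data \<Rightarrow> smoothings \<Rightarrow> (param \<Rightarrow> 'a) \<Rightarrow> param \<Rightarrow> bool" where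
  "compatible_at K s g p \<longleftrightarrow>
     (p \<in> regular_params K \<longrightarrow> germ_left g p (g p) \<and> germ_right g p (g p)) \<and>
     (\<forall>q. meet K p q \<longrightarrow>
        (s (pt K p) = Some Oriented \<longrightarrow> (\<exists>u. germ_left g p u \<and> germ_right g q u)) \<and>
        (s (pt K p) = Some Unoriented \<longrightarrow>
           (\<exists>u. germ_left g p u \<and> germ_left g q u) \<and> (\<exists>u. germ_right g p u \<and> germ_right g q u)))"

definition periodic :: "diagram_data \<Rightarrow> (param \<Rightarrow> 'a) \<Rightarrow> bool" where
  "periodic K g \<longleftrightarrow> (\<forall>p q. p \<in> params K \<and> same_param p q \<longrightarrow> g p = g q)"

definition labelling :: "diagram_data \<Rightarrow> smoothings \<Rightarrow> (param \<Rightarrow> 'a) \<Rightarrow> bool" where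
  "labelling K s g \<longleftrightarrow> periodic K g \<and> (\<forall>p \<in> params K. compatible_at K s g p)"

text \<open>
  Compatibility is a condition on arbitrarily short pieces; connectedness extends it to whole edges.
\<close>

lemma labelling_const:
  assumes L: "labelling K s g" and r: "\<And>t. t \<in> {t1..t2} \<Longrightarrow> (i, t) \<in> regular_params K"
    and ab: "a \<in> {t1..t2}" "b \<in> {t1..t2}"
  shows "g (i, a) = g (i, b)"
proof (rule connected_local_const[of "{t1..t2}" a b "\<lambda>t. g (i, t)"])
  show "\<forall>a\<in>{t1..t2}. \<forall>\<^sub>F b in at a within {t1..t2}. g (i, a) = g (i, b)"
  proof
    fix a assume a: "a \<in> {t1..t2}"
    have "(i, a) \<in> params K" using r[OF a] unfolding regular_params_def by blast
    then have "compatible_at K s g (i, a)" using L unfolding labelling_def by blast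
    then have "germ_left g (i, a) (g (i, a))" "germ_right g (i, a) (g (i, a))"
      using r[OF a] unfolding compatible_at_def by blast+
    then have "\<forall>\<^sub>F b in at a. g (i, b) = g (i, a)"
      unfolding germ_left_def germ_right_def by (simp add: eventually_at_split)
    then have "\<forall>\<^sub>F b in at a. g (i, a) = g (i, b)" by eventually_elim simp
    then show "\<forall>\<^sub>F b in at a within {t1..t2}. g (i, a) = g (i, b)"
      using filter_leD[OF at_le[of "{t1..t2}" UNIV a]] by blast
  qed
qed (use ab in \<open>auto simp: connected_iff_interval\<close>)

lemma labelling_just_before:
  assumes L: "labelling K s g" and b: "just_before K x p" and u: "germ_left g p u"
  shows "g x = u"
proof -
  have "\<forall>\<^sub>F t in at_left (snd p). snd x < t \<and> t < snd p"
    using b unfolding just_before_def by (auto simp: eventually_at_left_field)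
  then have "\<forall>\<^sub>F t in at_left (snd p). snd x < t \<and> t < snd p \<and> g (fst p, t) = u"
    using u unfolding germ_left_def by eventually_elim simp
  then obtain t where t: "snd x < t" "t < snd p" "g (fst p, t) = u"
    using eventually_happens trivial_limit_at_left_real by blast
  have "g (fst p, snd x) = g (fst p, t)"
    by (rule labelling_const[OF L, of "snd x" t]) (use b t in \<open>auto simp: just_before_def\<close>)
  then show ?thesis using t b unfolding just_before_def by (metis prod.collapse)
qed

lemma labelling_just_after:
  assumes L: "labelling K s g" and b: "just_after K x p" and u: "germ_right g p u"
  shows "g x = u"
proof -
  have "\<forall>\<^sub>F t in at_right (snd p). t < snd x \<and> snd p < t"
    using b unfolding just_after_def by (auto simp: eventually_at_right_field)
  then have "\<forall>\<^sub>F t in at_right (snd p). t < snd x \<and> snd p < t \<and> g (fst p, t) = u"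
    using u unfolding germ_right_def by eventually_elim simp
  then obtain t where t: "t < snd x" "snd p < t" "g (fst p, t) = u"
    using eventually_happens trivial_limit_at_right_real by blast
  have "g (fst p, snd x) = g (fst p, t)"
    by (rule labelling_const[OF L, of t "snd x"]) (use b t in \<open>auto simp: just_after_def\<close>)
  then show ?thesis using t b unfolding just_after_def by (metis prod.collapse)
qed

lemma labelling_joined:
  assumes L: "labelling K s g" and j: "joined K s x y" and x: "x \<in> regular_params K"
  shows "g x = g y"
  using j
proof cases
  case same
  then show ?thesis using L x unfolding labelling_def periodic_def regular_params_def by blast
next
  case edge
  have "g (fst x, snd x) = g (fst x, snd y)"
    by (rule labelling_const[OF L, of "min (snd x) (snd y)" "max (snd x) (snd y)"])
       (use edge in \<open>auto simp: closed_segment_eq_real_ivl split: if_splits\<close>)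
  then show ?thesis using edge by (metis prod.collapse)
next
  case (oriented p q)
  then have "compatible_at K s g p" using L unfolding labelling_def meet_def by blast
  then obtain u where "germ_left g p u" "germ_right g q u" using oriented unfolding compatible_at_def by blast
  then show ?thesis using labelling_just_before[OF L] labelling_just_after[OF L] oriented by metis
next
  case (unoriented_in p q)
  then have "compatible_at K s g p" using L unfolding labelling_def meet_def by blast
  then obtain u where "germ_left g p u" "germ_left g q u" using unoriented_in unfolding compatible_at_def by blast
  then show ?thesis using labelling_just_before[OF L] unoriented_in by metis
next
  case (unoriented_out p q)
  then have "compatible_at K s g p" using L unfolding labelling_def meet_def by blast
  then obtain u where "germ_right g p u" "germ_right g q u" using unoriented_out unfolding compatible_at_def by blast
  then show ?thesis using labelling_just_after[OF L] unoriented_out by metis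
qed

definition circ_eq :: "diagram_data \<Rightarrow> smoothings \<Rightarrow> param \<Rightarrow> param \<Rightarrow> bool" where
  "circ_eq K s = equivclp (\<lambda>u v. u \<in> regular_params K \<and> v \<in> regular_params K \<and> joined K s u v)"

text \<open>Double points lie on no circle and get the empty set.\<close>

definition circle_of :: "diagram_data \<Rightarrow> smoothings \<Rightarrow> param \<Rightarrow> param set" where
  "circle_of K s x = {y. x \<in> regular_params K \<and> y \<in> regular_params K \<and> circ_eq K s x y}"

lemma circles_eq: "circles K s = circle_of K s ` regular_params K"
  unfolding circles_def circle_of_def circ_eq_def quotient_def by auto

lemma circ_eq_equiv: "circ_eq K s x x" "circ_eq K s x y \<Longrightarrow> circ_eq K s y x"
    "circ_eq K s x y \<Longrightarrow> circ_eq K s y z \<Longrightarrow> circ_eq K s x z"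
  unfolding circ_eq_def by (auto intro: equivclp_sym equivclp_trans)

lemma circle_of_eq_iff:
  assumes "x \<in> regular_params K" "y \<in> regular_params K"
  shows "circle_of K s x = circle_of K s y \<longleftrightarrow> circ_eq K s x y"
proof
  assume "circle_of K s x = circle_of K s y"
  moreover have "y \<in> circle_of K s y" using assms circ_eq_equiv(1) unfolding circle_of_def by blast
  ultimately show "circ_eq K s x y" unfolding circle_of_def by blast
next
  assume "circ_eq K s x y"
  then have "circ_eq K s x z \<longleftrightarrow> circ_eq K s y z" for z using circ_eq_equiv[of K s] by meson
  then show "circle_of K s x = circle_of K s y" using assms unfolding circle_of_def by blast
qed

lemma circle_of_joined:
  "joined K s x y \<Longrightarrow> x \<in> regular_params K \<Longrightarrow> y \<in> regular_params K \<Longrightarrow> circle_of K s x = circle_of K s y"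
  by (subst circle_of_eq_iff) (auto simp: circ_eq_def intro: r_into_equivclp)

text \<open>The circles are the finest labelling, so a labelling is the same as a function on the set of circles.\<close>

lemma labelling_factors:
  assumes L: "labelling K s g" and e: "circle_of K s x = circle_of K s y"
    and x: "x \<in> regular_params K" and y: "y \<in> regular_params K"
  shows "g x = g y"
proof -
  have "circ_eq K s x y" using e circle_of_eq_iff[OF x y] by simp
  then show ?thesis unfolding circ_eq_def
  proof (induction rule: equivclp_induct)
    case (step y z)
    then show ?case using labelling_joined[OF L] by metis
  qed simp
qed

lemma labelling_circle_of:
  assumes D: "diagram K"
  shows "labelling K s (circle_of K s)"
  unfolding labelling_def
proof (intro conjI ballI)
  show "periodic K (circle_of K s)" unfolding periodic_def
  proof (intro allI impI)
    fix p q assume a: "p \<in> params K \<and> same_param p q"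
    show "circle_of K s p = circle_of K s q"
    proof (cases "p \<in> regular_params K")
      case True
      then show ?thesis using a regular_same_param[OF D] joined.same circle_of_joined by blast
    next
      case False
      then show ?thesis using a regular_same_param[OF D] unfolding circle_of_def by blast
    qed
  qed
next
  fix p assume p: "p \<in> params K"
  have edge: "circle_of K s (i, a) = circle_of K s (i, b)"
    if "\<And>t. min a b \<le> t \<Longrightarrow> t \<le> max a b \<Longrightarrow> (i, t) \<in> regular_params K" for i a b
    by (rule circle_of_joined[OF joined.edge])
       (use that in \<open>auto simp: closed_segment_eq_real_ivl min_def max_def split: if_splits\<close>)
  have left: "\<exists>x. just_before K x q \<and> x \<in> regular_params K \<and> germ_left (circle_of K s) q (circle_of K s x)"
    if "q \<in> params K" for q
  proof -
    have "fst q < ncomp K" using that unfolding params_def by auto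
    then have "\<forall>\<^sub>F t in at_left (snd q). (fst q, t) \<in> regular_params K"
      using eventually_regular[OF D, of "fst q" "snd q"] by (simp add: eventually_at_split)
    then obtain b where b: "b < snd q" "\<And>t. b < t \<Longrightarrow> t < snd q \<Longrightarrow> (fst q, t) \<in> regular_params K"
      by (auto simp: eventually_at_left_field)
    define m where "m = (b + snd q) / 2"
    have m: "b < m" "m < snd q" using b(1) unfolding m_def by auto
    have "just_before K (fst q, m) q" unfolding just_before_def using m b by auto
    moreover have "germ_left (circle_of K s) q (circle_of K s (fst q, m))"
      unfolding germ_left_def eventually_at_left_field
      by (rule exI[of _ m]) (use m b in \<open>auto intro!: edge\<close>)
    ultimately show ?thesis using m b by blast
  qed
  have right: "\<exists>x. just_after K x q \<and> x \<in> regular_params K \<and> germ_right (circle_of K s) q (circle_of K s x)"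
    if "q \<in> params K" for q
  proof -
    have "fst q < ncomp K" using that unfolding params_def by auto
    then have "\<forall>\<^sub>F t in at_right (snd q). (fst q, t) \<in> regular_params K"
      using eventually_regular[OF D, of "fst q" "snd q"] by (simp add: eventually_at_split)
    then obtain b where b: "b > snd q" "\<And>t. b > t \<Longrightarrow> t > snd q \<Longrightarrow> (fst q, t) \<in> regular_params K"
      by (auto simp: eventually_at_right_field)
    define m where "m = (b + snd q) / 2"
    have m: "b > m" "m > snd q" using b(1) unfolding m_def by auto
    have "just_after K (fst q, m) q" unfolding just_after_def using m b by auto
    moreover have "germ_right (circle_of K s) q (circle_of K s (fst q, m))"
      unfolding germ_right_def eventually_at_right_field
      by (rule exI[of _ m]) (use m b in \<open>auto intro!: edge\<close>)
    ultimately show ?thesis using m b by blast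
  qed
  show "compatible_at K s (circle_of K s) p"
    unfolding compatible_at_def
  proof (intro conjI allI impI)
    assume r: "p \<in> regular_params K"
    obtain x where x: "just_before K x p" "germ_left (circle_of K s) p (circle_of K s x)" using left[OF p] by blast
    have "(fst p, t) \<in> regular_params K" if "min (snd x) (snd p) \<le> t" "t \<le> max (snd x) (snd p)" for t
      using that x(1) r unfolding just_before_def by (cases "t = snd p") auto
    then have "circle_of K s (fst p, snd x) = circle_of K s (fst p, snd p)" by (rule edge)
    then show "germ_left (circle_of K s) p (circle_of K s p)" using x unfolding just_before_def by (metis prod.collapse)
    obtain x where x: "just_after K x p" "germ_right (circle_of K s) p (circle_of K s x)" using right[OF p] by blast
    have "(fst p, t) \<in> regular_params K" if "min (snd x) (snd p) \<le> t" "t \<le> max (snd x) (snd p)" for t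
      using that x(1) r unfolding just_after_def by (cases "t = snd p") auto
    then have "circle_of K s (fst p, snd x) = circle_of K s (fst p, snd p)" by (rule edge)
    then show "germ_right (circle_of K s) p (circle_of K s p)" using x unfolding just_after_def by (metis prod.collapse)
  next
    fix q assume m: "meet K p q" and s: "s (pt K p) = Some Oriented"
    have q: "q \<in> params K" using m unfolding meet_def by blast
    show "\<exists>u. germ_left (circle_of K s) p u \<and> germ_right (circle_of K s) q u"
      using left[OF p] right[OF q] circle_of_joined[OF joined.oriented[OF m _]] s by metis
  next
    fix q assume m: "meet K p q" and s: "s (pt K p) = Some Unoriented"
    have q: "q \<in> params K" using m unfolding meet_def by blast
    show "\<exists>u. germ_left (circle_of K s) p u \<and> germ_left (circle_of K s) q u"
      using left[OF p] left[OF q] circle_of_joined[OF joined.unoriented_in[OF m _]] s by metis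
    show "\<exists>u. germ_right (circle_of K s) p u \<and> germ_right (circle_of K s) q u"
      using right[OF p] right[OF q] circle_of_joined[OF joined.unoriented_out[OF m _]] s by metis
  qed
qed

lemma labelling_germs:
  assumes D: "diagram K" and s: "dpts K \<subseteq> dom s" and L: "labelling K s g" and p: "p \<in> params K"
  shows "\<exists>u. germ_left g p u" "\<exists>u. germ_right g p u"
proof -
  have "(\<exists>u. germ_left g p u) \<and> (\<exists>u. germ_right g p u)"
  proof (cases "p \<in> regular_params K")
    case True
    then show ?thesis using L p unfolding labelling_def compatible_at_def by blast
  next
    case False
    then obtain q where m: "meet K p q" using regular_or_meet[OF p _ D] by blast
    have q: "q \<in> params K" "meet K q p" "pt K q = pt K p"
      using meet_sym[OF m] m by (simp_all add: meet_def)
    have c: "compatible_at K s g p" "compatible_at K s g q" using L p q unfolding labelling_def by blast+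
    have "pt K p \<in> dpts K" using m unfolding dpts_def by blast
    then obtain x where x: "s (pt K p) = Some x" using s by blast
    then show ?thesis
    proof (cases x)
      case Oriented
      then have "s (pt K p) = Some Oriented" "s (pt K q) = Some Oriented" using x q by auto
      then show ?thesis using c m q(2) unfolding compatible_at_def by blast
    next
      case Unoriented
      then have "s (pt K p) = Some Unoriented" using x by auto
      then show ?thesis using c(1) m unfolding compatible_at_def by blast
    qed
  qed
  then show "\<exists>u. germ_left g p u" "\<exists>u. germ_right g p u" by auto
qed

text \<open>
  Near each parameter at most three labels occur, and each component is compact.
\<close>

lemma finite_circles:
  assumes D: "diagram K" and s: "dpts K \<subseteq> dom s"
  shows "finite (circles K s)"
proof -
  let ?g = "circle_of K s"
  have L: "labelling K s ?g" by (rule labelling_circle_of[OF D])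
  have fin: "finite ((\<lambda>t. ?g (i, t)) ` {0..1})" if i: "i < ncomp K" for i
  proof -
    have "\<exists>U. open U \<and> t \<in> U \<and> finite ((\<lambda>t. ?g (i, t)) ` U)" for t
    proof -
      have p: "(i, t) \<in> params K" using i unfolding params_def by auto
      obtain u v where "germ_left ?g (i, t) u" "germ_right ?g (i, t) v"
        using labelling_germs[OF D s L p] by blast
      then have "\<forall>\<^sub>F x in at_left t. ?g (i, x) \<in> {u, v, ?g (i, t)}"
        "\<forall>\<^sub>F x in at_right t. ?g (i, x) \<in> {u, v, ?g (i, t)}"
        unfolding germ_left_def germ_right_def by (auto elim: eventually_mono)
      then have "\<forall>\<^sub>F x in nhds t. ?g (i, x) \<in> {u, v, ?g (i, t)}"
        unfolding eventually_nhds_conv_at by (auto simp: eventually_at_split)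
      then obtain U where U: "open U" "t \<in> U" "\<forall>x\<in>U. ?g (i, x) \<in> {u, v, ?g (i, t)}"
        unfolding eventually_nhds by blast
      have "(\<lambda>t. ?g (i, t)) ` U \<subseteq> {u, v, ?g (i, t)}" by (rule image_subsetI) (use U(3) in blast)
      then have "finite ((\<lambda>t. ?g (i, t)) ` U)" using finite_subset[of _ "{u, v, ?g (i, t)}"] by blast
      then show ?thesis using U by blast
    qed
    then obtain U where U: "\<And>t. open (U t) \<and> t \<in> U t \<and> finite ((\<lambda>t. ?g (i, t)) ` U t)" by metis
    have "compact {0..1::real}" by simp
    then obtain C where C: "C \<subseteq> {0..1}" "finite C" "{0..1} \<subseteq> (\<Union>t\<in>C. U t)"
    proof (rule compactE_image[of "{0..1}" "{0..1}" U])
      show "{0..1} \<subseteq> (\<Union>c\<in>{0..1}. U c)" using U by blast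
    qed (use U in blast)+
    have "finite (\<Union>t\<in>C. (\<lambda>t. ?g (i, t)) ` U t)" using C U by blast
    then show ?thesis by (rule finite_subset[rotated]) (use C in blast)
  qed
  have "circles K s \<subseteq> (\<Union>i<ncomp K. (\<lambda>t. ?g (i, t)) ` {0..1})"
  proof
    fix c assume "c \<in> circles K s"
    then obtain p where p: "p \<in> regular_params K" "c = ?g p" unfolding circles_eq by blast
    have "same_param p (fst p, frac (snd p))" unfolding same_param_def by (simp add: frac_def)
    moreover have "p \<in> params K" using p unfolding regular_params_def by blast
    ultimately have "?g p = ?g (fst p, frac (snd p))"
      using L unfolding labelling_def periodic_def by blast
    moreover have "fst p < ncomp K" using p unfolding regular_params_def params_def by auto
    ultimately show "c \<in> (\<Union>i<ncomp K. (\<lambda>t. ?g (i, t)) ` {0..1})"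
      using p frac_ge_0[of "snd p"] frac_lt_1[of "snd p"]
      by (intro UN_I[of "fst p"] image_eqI[of _ _ "frac (snd p)"]) simp_all
  qed
  then show ?thesis by (rule finite_subset) (use fin in auto)
qed

lemma circle_of_refines:
  assumes "labelling K' s' g'" and "\<And>x. x \<in> X \<Longrightarrow> g' x = circle_of K s x" and "X \<subseteq> regular_params K'"
    and "x \<in> X" "y \<in> X" "circle_of K' s' x = circle_of K' s' y"
  shows "circle_of K s x = circle_of K s y"
  using labelling_factors[OF assms(1,6)] assms by (metis subsetD)

section \<open>Expanding the bracket\<close>

lemma card_image_eqI:
  assumes "\<And>x y. x \<in> A \<Longrightarrow> y \<in> A \<Longrightarrow> f x = f y \<longleftrightarrow> g x = g y"
  shows "card (f ` A) = card (g ` A)"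
proof -
  define k where "k c = g (inv_into A f c)" for c
  have k: "k (f x) = g x" if "x \<in> A" for x
    unfolding k_def using assms[of "inv_into A f (f x)" x] that
    by (metis f_inv_into_f imageI inv_into_into)
  have "inj_on k (f ` A)"
    by (rule inj_onI) (use k assms in auto)
  moreover have "k ` (f ` A) = g ` A" using k by (auto simp: image_image)
  ultimately show ?thesis by (metis card_image)
qed

definition value_at :: "diagram_data \<Rightarrow> smoothings \<Rightarrow> bracket_poly" where
  "value_at K s = (THE p. bracket_eval K s p)"

lemma bracket_eval_iff:
  assumes "diagram K" "dom s \<subseteq> dpts K"
  shows "bracket_eval K s p \<longleftrightarrow> p = value_at K s"
  unfolding value_at_def using bracket_eval_ex1[OF assms] by (metis the_equality)

lemma bracket_value_at: "bracket K = value_at K Map.empty"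
  unfolding bracket_def value_at_def ..

lemma value_at_step:
  assumes D: "diagram K" and s: "dom s \<subseteq> dpts K" and c: "c \<notin> dom s" and w: "weights K c x y"
  shows "value_at K s = x * value_at K (s(c \<mapsto> Oriented)) + y * value_at K (s(c \<mapsto> Unoriented))"
proof -
  have "dom (s(c \<mapsto> o')) \<subseteq> dpts K" for o' using s weights_dpts[OF w] by auto
  then have "bracket_eval K (s(c \<mapsto> o')) (value_at K (s(c \<mapsto> o')))" for o'
    using bracket_eval_iff[OF D] by blast
  then have "bracket_eval K s (x * value_at K (s(c \<mapsto> Oriented)) + y * value_at K (s(c \<mapsto> Unoriented)))"
    using bracket_eval_step[OF c w] by blast
  then show ?thesis using bracket_eval_iff[OF D s] by simp
qed

lemma value_at_total:
  assumes "diagram K" "dom s = dpts K"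
  shows "value_at K s = unlink_value (card (circles K s))"
  using bracket_eval.unlink[OF assms(2)] bracket_eval_iff[OF assms(1)] assms(2) by (metis order_refl)

text \<open>
  The rules may be applied in any order, so the double points on which two diagrams agree can be
  smoothed first; it suffices to compare the diagrams when only the others are left.
\<close>

lemma value_at_eq_outside:
  assumes D: "diagram K" "diagram K'" and sub: "X \<subseteq> dpts K" "X \<subseteq> dpts K'"
    and w: "\<And>c x y. c \<in> X \<Longrightarrow> weights K c x y \<Longrightarrow> weights K' c x y"
    and e: "\<And>s. dom s = X \<Longrightarrow> value_at K s = value_at K' s"
  shows "dom s \<subseteq> X \<Longrightarrow> value_at K s = value_at K' s"
proof (induction "card (X - dom s)" arbitrary: s rule: less_induct)
  case less
  have "finite (dpts K)" using D(1) unfolding diagram_def by blast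
  then have fin: "finite X" using sub finite_subset by blast
  show ?case
  proof (cases "dom s = X")
    case False
    then obtain c where c: "c \<in> X" "c \<notin> dom s" using less(2) by blast
    obtain x y where xy: "weights K c x y" using weights_exist[OF D(1)] c sub by blast
    have "card (X - dom (s(c \<mapsto> o'))) < card (X - dom s)" for o'
      using c fin by (intro psubset_card_mono) auto
    then have IH: "value_at K (s(c \<mapsto> o')) = value_at K' (s(c \<mapsto> o'))" for o'
      using less c by simp
    show ?thesis
      using value_at_step[OF D(1) _ c(2) xy] value_at_step[OF D(2) _ c(2) w[OF c(1) xy]] less(2) sub IH
      by (metis order_trans)
  qed (use e in simp)
qed

text \<open>
  Seen in the square, the strands run from left to right regardless of their orientations, and a
  smoothing either lets them pass (it connects each left end to the other right end) or turns them
  back.  The oriented smoothing is the passing one iff the strands are parallel.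
\<close>

definition smoothing_of :: "bool \<Rightarrow> bool \<Rightarrow> smoothing" where
  "smoothing_of par through = (if through = par then Oriented else Unoriented)"

text \<open>
  The weight \<open>a\<close> of the passing smoothing and the weight \<open>b\<close> of the turning one.
\<close>

definition geo_weights :: "diagram_data \<Rightarrow> bool \<Rightarrow> complex \<Rightarrow> bracket_poly \<Rightarrow> bracket_poly \<Rightarrow> bool" where
  "geo_weights K par c a b \<longleftrightarrow> weights K c (if par then a else b) (if par then b else a)"

lemma value_at_expand:
  assumes "diagram K" "dom s \<subseteq> dpts K" "c \<notin> dom s" "geo_weights K par c a b"
  shows "value_at K s = a * value_at K (s(c \<mapsto> smoothing_of par True)) + b * value_at K (s(c \<mapsto> smoothing_of par False))"
  using value_at_step[OF assms(1-3), of "if par then a else b" "if par then b else a"] assms(4)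
  unfolding geo_weights_def smoothing_of_def by (cases par) (simp_all add: add.commute)

section \<open>Planar isotopy\<close>

lemma meet_dpts: "meet K p q \<Longrightarrow> pt K p \<in> dpts K"
  unfolding dpts_def by blast

text \<open>
  What R0 says about the underlying curves as mere continuous images.  Forgetting the isotopy and the derivatives
  makes the relation symmetric, and it is all that the count of circles needs.
\<close>

definition reparametrized ::
  "diagram_data \<Rightarrow> diagram_data \<Rightarrow> (complex \<Rightarrow> complex) \<Rightarrow> (nat \<Rightarrow> nat) \<Rightarrow> (nat \<Rightarrow> real \<Rightarrow> real) \<Rightarrow> bool" where
  "reparametrized K K' H \<sigma> \<phi> \<longleftrightarrow> bij H \<and> bij_betw \<sigma> {..<ncomp K'} {..<ncomp K} \<and>
     (\<forall>i < ncomp K'. strict_mono (\<phi> i) \<and> surj (\<phi> i) \<and> (\<forall>t. \<phi> i (t + 1) = \<phi> i t + 1)) \<and>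
     (\<forall>i < ncomp K'. \<forall>t. curve K' i t = H (curve K (\<sigma> i) (\<phi> i t)))"

lemma shift_of_int:
  fixes f :: "real \<Rightarrow> real"
  assumes "\<And>t. f (t + 1) = f t + 1"
  shows "f (t + of_int k) = f t + of_int k"
proof -
  have n: "f (t + of_nat n) = f t + of_nat n" for t n
  proof (induction n)
    case (Suc n)
    then show ?case using assms[of "t + of_nat n"] by (simp add: algebra_simps)
  qed simp
  show ?thesis using n[of t "nat k"] n[of "t + of_int k" "nat (- k)"] by (cases "k \<ge> 0") auto
qed

context
  fixes K K' H \<sigma> \<phi> \<Phi>
  assumes R: "reparametrized K K' H \<sigma> \<phi>"
  defines "\<Phi> \<equiv> \<lambda>p::param. (\<sigma> (fst p), \<phi> (fst p) (snd p))"
begin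

lemma reparam_props:
  assumes "i < ncomp K'"
  shows "\<sigma> i < ncomp K" "strict_mono (\<phi> i)" "surj (\<phi> i)" "\<phi> i (t + 1) = \<phi> i t + 1"
    "curve K' i t = H (curve K (\<sigma> i) (\<phi> i t))"
  using R assms unfolding reparametrized_def bij_betw_def by auto

lemma reparam_params: "p \<in> params K' \<Longrightarrow> \<Phi> p \<in> params K"
  using reparam_props(1) unfolding params_def \<Phi>_def by (cases p) auto

lemma reparam_onto:
  assumes "p \<in> params K"
  obtains p' where "p' \<in> params K'" "\<Phi> p' = p"
proof -
  have "fst p \<in> \<sigma> ` {..<ncomp K'}" using R assms unfolding reparametrized_def bij_betw_def params_def by auto
  then obtain i where i: "i < ncomp K'" "\<sigma> i = fst p" by auto
  obtain t where "\<phi> i t = snd p" using reparam_props(3)[OF i(1)] by (metis surjD)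
  then show thesis using that[of "(i, t)"] i unfolding params_def \<Phi>_def by auto
qed

lemma reparam_pt: "p \<in> params K' \<Longrightarrow> pt K' p = H (pt K (\<Phi> p))"
  using reparam_props(5) unfolding pt_def params_def \<Phi>_def by (cases p) auto

lemma reparam_same_param:
  assumes p: "p \<in> params K'" and q: "q \<in> params K'"
  shows "same_param (\<Phi> p) (\<Phi> q) \<longleftrightarrow> same_param p q"
proof -
  have fp: "fst p < ncomp K'" "fst q < ncomp K'" using p q unfolding params_def by auto
  have "inj_on \<sigma> {..<ncomp K'}" using R unfolding reparametrized_def bij_betw_def by blast
  then have 1: "\<sigma> (fst p) = \<sigma> (fst q) \<longleftrightarrow> fst p = fst q" using fp by (auto simp: inj_on_def)
  have 2: "\<phi> i t - \<phi> i u \<in> \<int> \<longleftrightarrow> t - u \<in> \<int>" if i: "i < ncomp K'" for i t u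
  proof
    assume "\<phi> i t - \<phi> i u \<in> \<int>"
    then obtain k where "\<phi> i t - \<phi> i u = of_int k" by (rule Ints_cases)
    then have "\<phi> i t = \<phi> i (u + of_int k)" using shift_of_int[of "\<phi> i" u k] reparam_props(4)[OF i] by simp
    then have "t = u + of_int k" using reparam_props(2)[OF i] by (simp add: strict_mono_eq)
    then show "t - u \<in> \<int>" by simp
  next
    assume "t - u \<in> \<int>"
    then obtain k where "t - u = of_int k" by (rule Ints_cases)
    then have "t = u + of_int k" by simp
    then show "\<phi> i t - \<phi> i u \<in> \<int>" using shift_of_int[of "\<phi> i" u k] reparam_props(4)[OF i] by simp
  qed
  show ?thesis unfolding same_param_def \<Phi>_def using 1 2 fp by auto
qed

lemma reparam_meet:
  assumes p: "p \<in> params K'" and q: "q \<in> params K'"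
  shows "meet K (\<Phi> p) (\<Phi> q) \<longleftrightarrow> meet K' p q"
proof -
  have "inj H" using R unfolding reparametrized_def bij_def by blast
  then have "pt K' p = pt K' q \<longleftrightarrow> pt K (\<Phi> p) = pt K (\<Phi> q)"
    using reparam_pt p q by (simp add: inj_eq)
  then show ?thesis using reparam_same_param p q reparam_params unfolding meet_def by simp
qed

lemma reparam_dpts: "dpts K' = H ` dpts K"
proof
  show "dpts K' \<subseteq> H ` dpts K"
  proof
    fix c assume "c \<in> dpts K'"
    then obtain p q where m: "meet K' p q" "c = pt K' p" unfolding dpts_def by blast
    then have "p \<in> params K'" "q \<in> params K'" unfolding meet_def by auto
    then show "c \<in> H ` dpts K" using m reparam_meet reparam_pt meet_dpts[of K "\<Phi> p" "\<Phi> q"] by blast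
  qed
  show "H ` dpts K \<subseteq> dpts K'"
  proof
    fix c assume "c \<in> H ` dpts K"
    then obtain p q where m: "meet K p q" "c = H (pt K p)" unfolding dpts_def by blast
    then have "p \<in> params K" "q \<in> params K" unfolding meet_def by auto
    then obtain p' q' where p': "p' \<in> params K'" "\<Phi> p' = p" and q': "q' \<in> params K'" "\<Phi> q' = q"
      by (metis reparam_onto)
    then have "meet K' p' q'" using m reparam_meet[OF p'(1) q'(1)] by simp
    then show "c \<in> dpts K'" using m p' reparam_pt[OF p'(1)] meet_dpts[of K' p' q'] by simp
  qed
qed

lemma reparam_regular: "p \<in> params K' \<Longrightarrow> \<Phi> p \<in> regular_params K \<longleftrightarrow> p \<in> regular_params K'"
proof -
  assume p: "p \<in> params K'"
  have "inj H" using R unfolding reparametrized_def bij_def by blast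
  then have "pt K' p \<in> dpts K' \<longleftrightarrow> pt K (\<Phi> p) \<in> dpts K"
    unfolding reparam_dpts reparam_pt[OF p] by (rule inj_image_mem_iff)
  then show ?thesis using p reparam_params unfolding regular_params_def by blast
qed

lemma reparam_germs:
  assumes p: "p \<in> params K'"
  shows "germ_left g (\<Phi> p) u \<Longrightarrow> germ_left (g \<circ> \<Phi>) p u" "germ_right g (\<Phi> p) u \<Longrightarrow> germ_right (g \<circ> \<Phi>) p u"
proof -
  obtain i t where it: "p = (i, t)" "i < ncomp K'" using p unfolding params_def by auto
  have sm: "strict_mono (\<phi> i)" "surj (\<phi> i)" using reparam_props[OF it(2)] by auto
  have e: "\<phi> i a < \<phi> i b \<longleftrightarrow> a < b" for a b using sm(1) by (simp add: strict_mono_less)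
  show "germ_left (g \<circ> \<Phi>) p u" if g: "germ_left g (\<Phi> p) u"
  proof -
    obtain b where b: "b < \<phi> i t" "\<And>x. b < x \<Longrightarrow> x < \<phi> i t \<Longrightarrow> g (\<sigma> i, x) = u"
      using g unfolding germ_left_def \<Phi>_def it by (auto simp: eventually_at_left_field)
    obtain b' where b': "\<phi> i b' = b" using sm(2) by (metis surjD)
    show ?thesis unfolding germ_left_def it eventually_at_left_field
      by (rule exI[of _ b']) (use b e b' in \<open>auto simp: \<Phi>_def\<close>)
  qed
  show "germ_right (g \<circ> \<Phi>) p u" if g: "germ_right g (\<Phi> p) u"
  proof -
    obtain b where b: "b > \<phi> i t" "\<And>x. b > x \<Longrightarrow> x > \<phi> i t \<Longrightarrow> g (\<sigma> i, x) = u"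
      using g unfolding germ_right_def \<Phi>_def it by (auto simp: eventually_at_right_field)
    obtain b' where b': "\<phi> i b' = b" using sm(2) by (metis surjD)
    show ?thesis unfolding germ_right_def it eventually_at_right_field
      by (rule exI[of _ b']) (use b e b' in \<open>auto simp: \<Phi>_def\<close>)
  qed
qed

lemma reparam_labelling:
  assumes L: "labelling K s g" and s: "\<And>c. s' (H c) = s c"
  shows "labelling K' s' (g \<circ> \<Phi>)"
  unfolding labelling_def
proof (intro conjI ballI)
  show "periodic K' (g \<circ> \<Phi>)" unfolding periodic_def
  proof (intro allI impI)
    fix p q assume a: "p \<in> params K' \<and> same_param p q"
    then have "q \<in> params K'" using params_same_param by blast
    then have "same_param (\<Phi> p) (\<Phi> q)" "\<Phi> p \<in> params K" using a reparam_same_param reparam_params by blast+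
    then have "g (\<Phi> p) = g (\<Phi> q)" using L unfolding labelling_def periodic_def by blast
    then show "(g \<circ> \<Phi>) p = (g \<circ> \<Phi>) q" by simp
  qed
  fix p assume p: "p \<in> params K'"
  then have c: "compatible_at K s g (\<Phi> p)" using L reparam_params unfolding labelling_def by blast
  have sp: "s' (pt K' p) = s (pt K (\<Phi> p))" using reparam_pt[OF p] s by simp
  note germs = reparam_germs[of _ g]
  show "compatible_at K' s' (g \<circ> \<Phi>) p" unfolding compatible_at_def sp
  proof (intro conjI allI impI)
    assume "p \<in> regular_params K'"
    then have "\<Phi> p \<in> regular_params K" using reparam_regular p by blast
    then have "germ_left g (\<Phi> p) (g (\<Phi> p))" "germ_right g (\<Phi> p) (g (\<Phi> p))" using c unfolding compatible_at_def by blast+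
    then show "germ_left (g \<circ> \<Phi>) p ((g \<circ> \<Phi>) p)" "germ_right (g \<circ> \<Phi>) p ((g \<circ> \<Phi>) p)"
      using germs[OF p] by auto
  next
    fix q assume m: "meet K' p q" and o': "s (pt K (\<Phi> p)) = Some Oriented"
    then have q: "q \<in> params K'" unfolding meet_def by blast
    then have "meet K (\<Phi> p) (\<Phi> q)" using m p reparam_meet by blast
    then show "\<exists>u. germ_left (g \<circ> \<Phi>) p u \<and> germ_right (g \<circ> \<Phi>) q u"
      using c o' germs[OF p] germs[OF q] unfolding compatible_at_def by blast
  next
    fix q assume m: "meet K' p q" and o': "s (pt K (\<Phi> p)) = Some Unoriented"
    then have q: "q \<in> params K'" unfolding meet_def by blast
    then have m: "meet K (\<Phi> p) (\<Phi> q)" using m p reparam_meet by blast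
    then show "\<exists>u. germ_left (g \<circ> \<Phi>) p u \<and> germ_left (g \<circ> \<Phi>) q u"
      using c o' germs[OF p] germs[OF q] unfolding compatible_at_def by blast
    show "\<exists>u. germ_right (g \<circ> \<Phi>) p u \<and> germ_right (g \<circ> \<Phi>) q u"
      using m c o' germs[OF p] germs[OF q] unfolding compatible_at_def by blast
  qed
qed

end

lemma reparametrized_sym:
  assumes R: "reparametrized K K' H \<sigma> \<phi>"
  obtains \<sigma>' \<phi>' where "reparametrized K' K (inv H) \<sigma>' \<phi>'"
    "\<And>i t. i < ncomp K' \<Longrightarrow> \<sigma>' (\<sigma> i) = i \<and> \<phi>' (\<sigma> i) (\<phi> i t) = t"
proof
  let ?\<sigma>' = "inv_into {..<ncomp K'} \<sigma>"
  let ?\<phi>' = "\<lambda>i. inv (\<phi> (?\<sigma>' i))"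
  note props = reparam_props[OF R]
  have bH: "bij H" and b\<sigma>: "bij_betw \<sigma> {..<ncomp K'} {..<ncomp K}"
    using R unfolding reparametrized_def by blast+
  have inj: "inj (\<phi> i)" if "i < ncomp K'" for i using props(2)[OF that] strict_mono_imp_inj_on by blast
  show l: "?\<sigma>' (\<sigma> i) = i \<and> ?\<phi>' (\<sigma> i) (\<phi> i t) = t" if "i < ncomp K'" for i t
  proof -
    have "?\<sigma>' (\<sigma> i) = i" using b\<sigma> that by (simp add: bij_betw_inv_into_left)
    then show ?thesis using inj[OF that] by simp
  qed
  have r: "?\<sigma>' i < ncomp K' \<and> \<sigma> (?\<sigma>' i) = i" if "i < ncomp K" for i
    using b\<sigma> that bij_betw_inv_into_right[OF b\<sigma>] bij_betw_apply[OF bij_betw_inv_into[OF b\<sigma>]] by auto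
  show "reparametrized K' K (inv H) ?\<sigma>' ?\<phi>'"
    unfolding reparametrized_def
  proof (intro conjI allI impI)
    show "bij (inv H)" using bH bij_imp_bij_inv by blast
    show "bij_betw ?\<sigma>' {..<ncomp K} {..<ncomp K'}" using b\<sigma> bij_betw_inv_into by blast
    fix i assume i: "i < ncomp K"
    then have i': "?\<sigma>' i < ncomp K'" using r by blast
    let ?f = "\<phi> (?\<sigma>' i)"
    have f: "?f (inv ?f t) = t" for t using props(3)[OF i'] by (simp add: surj_f_inv_f)
    have sm: "strict_mono ?f" using props(2)[OF i'] .
    show "strict_mono (inv ?f)"
    proof (rule strict_monoI)
      fix a b :: real assume "a < b"
      then have "?f (inv ?f a) < ?f (inv ?f b)" using f by simp
      then show "inv ?f a < inv ?f b" using sm by (simp add: strict_mono_less)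
    qed
    show "surj (inv ?f)" using inj[OF i'] by (rule inj_imp_surj_inv)
    show "inv ?f (t + 1) = inv ?f t + 1" for t
    proof -
      have "?f (inv ?f t + 1) = t + 1" using props(4)[OF i'] f by simp
      then show ?thesis using inj[OF i'] by (metis inv_f_f)
    qed
    show "curve K i t = inv H (curve K' (?\<sigma>' i) (inv ?f t))" for t
      unfolding props(5)[OF i'] f using r[OF i] bH by (simp add: bij_is_inj)
  qed
qed

text \<open>
  Labellings are carried over in both directions, so the circles correspond.
\<close>

lemma reparametrized_circles:
  assumes D: "diagram K" "diagram K'" and R: "reparametrized K K' H \<sigma> \<phi>" and s: "\<And>c. s' (H c) = s c"
  shows "card (circles K' s') = card (circles K s)"
proof -
  let ?P = "\<lambda>p::param. (\<sigma> (fst p), \<phi> (fst p) (snd p))"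
  obtain \<sigma>' \<phi>' where R': "reparametrized K' K (inv H) \<sigma>' \<phi>'"
    and inv: "\<And>i t. i < ncomp K' \<Longrightarrow> \<sigma>' (\<sigma> i) = i \<and> \<phi>' (\<sigma> i) (\<phi> i t) = t"
    using reparametrized_sym[OF R] by metis
  let ?Q = "\<lambda>p::param. (\<sigma>' (fst p), \<phi>' (fst p) (snd p))"
  have QP: "?Q (?P p) = p" if "p \<in> params K'" for p
    using inv that unfolding params_def by (cases p) auto
  have bH: "bij H" using R unfolding reparametrized_def by blast
  have s'': "s (inv H c) = s' c" for c using s[of "inv H c"] bH by (simp add: bij_is_surj surj_f_inv_f)
  have L: "labelling K' s' (circle_of K s \<circ> ?P)"
    by (rule reparam_labelling[where s = s, OF R labelling_circle_of[OF D(1)]]) (rule s)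
  have L': "labelling K s (circle_of K' s' \<circ> ?Q)"
    by (rule reparam_labelling[where s = s', OF R' labelling_circle_of[OF D(2)]]) (rule s'')
  have reg: "?P p \<in> regular_params K \<longleftrightarrow> p \<in> regular_params K'" if "p \<in> params K'" for p
    using reparam_regular[OF R that] .
  have par: "p \<in> params K'" if "p \<in> regular_params K'" for p using that unfolding regular_params_def by blast
  have "card (circle_of K' s' ` regular_params K') = card ((circle_of K s \<circ> ?P) ` regular_params K')"
  proof (rule card_image_eqI)
    fix x y assume x: "x \<in> regular_params K'" and y: "y \<in> regular_params K'"
    show "circle_of K' s' x = circle_of K' s' y \<longleftrightarrow> (circle_of K s \<circ> ?P) x = (circle_of K s \<circ> ?P) y"
    proof
      assume "circle_of K' s' x = circle_of K' s' y"
      then show "(circle_of K s \<circ> ?P) x = (circle_of K s \<circ> ?P) y" by (rule labelling_factors[OF L _ x y])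
    next
      assume e: "(circle_of K s \<circ> ?P) x = (circle_of K s \<circ> ?P) y"
      have r: "?P x \<in> regular_params K" "?P y \<in> regular_params K" using reg par x y by blast+
      have "circle_of K s (?P x) = circle_of K s (?P y)" using e by (simp only: o_apply)
      then have "(circle_of K' s' \<circ> ?Q) (?P x) = (circle_of K' s' \<circ> ?Q) (?P y)"
        using r by (rule labelling_factors[OF L'])
      then have "circle_of K' s' (?Q (?P x)) = circle_of K' s' (?Q (?P y))" by (simp only: o_apply)
      then show "circle_of K' s' x = circle_of K' s' y" using QP[OF par[OF x]] QP[OF par[OF y]] by (simp only:)
    qed
  qed
  moreover have "?P ` regular_params K' = regular_params K"
  proof (intro equalityI subsetI)
    fix p assume p: "p \<in> regular_params K"
    then have "p \<in> params K" unfolding regular_params_def by blast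
    then obtain p' where "p' \<in> params K'" "?P p' = p" by (rule reparam_onto[OF R])
    then show "p \<in> ?P ` regular_params K'" using reg p by blast
  qed (use reg par in blast)
  ultimately show ?thesis unfolding circles_eq by (simp only: image_comp[symmetric])
qed

lemma cross_linear:
  assumes "linear D"
  shows "cross (D u) (D v) = cross (D 1) (D \<i>) * cross u v"
proof -
  have e: "D w = Re w *\<^sub>R D 1 + Im w *\<^sub>R D \<i>" for w
  proof -
    have "w = Re w *\<^sub>R 1 + Im w *\<^sub>R \<i>" by (simp add: complex_eq_iff)
    then show ?thesis by (metis assms linear_add linear_scale)
  qed
  show ?thesis unfolding e[of u] e[of v] cross_def by (simp add: algebra_simps)
qed

lemma cross_inj_linear:
  assumes L: "linear D" and I: "inj D"
  shows "cross (D 1) (D \<i>) \<noteq> 0"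
proof
  assume z: "cross (D 1) (D \<i>) = 0"
  have e: "D w = Re w *\<^sub>R D 1 + Im w *\<^sub>R D \<i>" for w
  proof -
    have "w = Re w *\<^sub>R 1 + Im w *\<^sub>R \<i>" by (simp add: complex_eq_iff)
    then show ?thesis by (metis L linear_add linear_scale)
  qed
  have k: "w = 0" if "D w = 0" for w using that I L linear_0 by (metis injD)
  have "D (Complex (Re (D \<i>)) (- Re (D 1))) = 0" "D (Complex (Im (D \<i>)) (- Im (D 1))) = 0"
    using z unfolding e[of "Complex _ _"] cross_def by (auto simp: complex_eq_iff algebra_simps)
  then have "Complex (Re (D \<i>)) (- Re (D 1)) = 0" "Complex (Im (D \<i>)) (- Im (D 1)) = 0"
    using k by blast+
  then have "D 1 = 0" by (simp add: complex_eq_iff)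
  then show False using k by fastforce
qed

text \<open>
  An ambient isotopy preserves orientation: the determinant of its derivative is continuous in time, never
  vanishes, and starts at 1.
\<close>

lemma ambient_isotopy_det:
  assumes A: "ambient_isotopy h"
  obtains D where "\<And>z. (h 1 has_derivative D z) (at z)" "\<And>z u v. cross u v > 0 \<Longrightarrow> cross (D z u) (D z v) > 0"
    "\<And>z u v. cross u v < 0 \<Longrightarrow> cross (D z u) (D z v) < 0"
proof -
  obtain D where D: "\<And>t z. t \<in> {0..1} \<Longrightarrow> (h t has_derivative D t z) (at z) \<and> inj (D t z)"
    and C: "\<And>v. continuous_on ({0..1} \<times> UNIV) (\<lambda>(t, z). D t z v)"
    using A unfolding ambient_isotopy_def by metis
  have lin: "linear (D t z)" if "t \<in> {0..1}" for t z
    using D[OF that] has_derivative_linear by blast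
  have pos: "cross (D 1 z 1) (D 1 z \<i>) > 0" for z
  proof -
    define f where "f t = cross (D t z 1) (D t z \<i>)" for t
    have cD: "continuous_on {0..1} (\<lambda>t. D t z v)" for v
    proof -
      have "continuous_on {0..1} (\<lambda>t. (t, z))" by (intro continuous_intros)
      then show ?thesis using continuous_on_compose2[OF C[of v], of "{0..1}" "\<lambda>t. (t, z)"] by auto
    qed
    have cf: "continuous_on {0..1} f"
      unfolding f_def cross_def by (intro continuous_intros cD)
    have "h 0 = (\<lambda>z. z)" using A unfolding ambient_isotopy_def by blast
    then have "((\<lambda>z. z) has_derivative D 0 z) (at z)" using D[of 0 z] by simp
    then have "D 0 z = (\<lambda>v. v)" using has_derivative_unique has_derivative_ident by blast
    then have f0: "f 0 = 1" unfolding f_def cross_def by simp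
    have ne: "f t \<noteq> 0" if "t \<in> {0..1}" for t unfolding f_def using cross_inj_linear lin D that by blast
    show ?thesis
    proof (rule ccontr)
      assume "\<not> ?thesis"
      then have "f 1 \<le> 0" unfolding f_def by simp
      then obtain t where "0 \<le> t" "t \<le> 1" "f t = 0"
        using IVT2'[of f 1 0 0] f0 cf by auto
      then show False using ne by simp
    qed
  qed
  show thesis
  proof (rule that[of "D 1"])
    show "(h 1 has_derivative D 1 z) (at z)" for z using D[of 1 z] by simp
    show "cross (D 1 z u) (D 1 z v) > 0" if "cross u v > 0" for z u v
      using cross_linear[OF lin, of 1 z u v] pos[of z] that by simp
    show "cross (D 1 z u) (D 1 z v) < 0" if "cross u v < 0" for z u v
      using cross_linear[OF lin, of 1 z u v] pos[of z] that by (simp add: mult_pos_neg)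
  qed
qed

lemma cross_scale: "cross (a *\<^sub>R u) (b *\<^sub>R v) = a * b * cross u v"
  unfolding cross_def by (simp add: algebra_simps)

text \<open>
  By the chain rule a velocity is multiplied by a positive number and the derivative of the
  isotopy, so that the signs of crossings survive.  Hence each evaluation of one diagram can be repeated step by
  step in the other one.
\<close>

lemma R0_bracket:
  assumes D: "diagram K" "diagram K'" and R0: "R0 K K'"
  shows "bracket K = bracket K'"
proof -
  obtain h \<sigma> \<phi> where A: "ambient_isotopy h" and b: "bij_betw \<sigma> {..<ncomp K'} {..<ncomp K}"
    and c: "\<And>i. i < ncomp K' \<Longrightarrow> circle_diffeo (\<phi> i)"
    and cv: "\<And>i t. i < ncomp K' \<Longrightarrow> curve K' i t = h 1 (curve K (\<sigma> i) (\<phi> i t))"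
    and ov: "\<And>i t. i < ncomp K' \<Longrightarrow> (i, t) \<in> over K' \<longleftrightarrow> (\<sigma> i, \<phi> i t) \<in> over K"
    using R0 unfolding R0_def by metis
  define H where "H = h 1"
  have bH: "bij H" using A unfolding ambient_isotopy_def H_def by simp
  have diffeo: "strict_mono (\<phi> i)" "surj (\<phi> i)" "\<phi> i (t + 1) = \<phi> i t + 1"
    "\<exists>d>0. (\<phi> i has_real_derivative d) (at t)" if i: "i < ncomp K'" for i t
  proof -
    obtain d where d: "\<And>t. (\<phi> i has_real_derivative d t) (at t) \<and> d t > 0" and p: "\<And>t. \<phi> i (t + 1) = \<phi> i t + 1"
      using c[OF i] unfolding circle_diffeo_def by metis
    show "\<phi> i (t + 1) = \<phi> i t + 1" "\<exists>d>0. (\<phi> i has_real_derivative d) (at t)" using p d by blast+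
    show "strict_mono (\<phi> i)" using DERIV_pos_imp_increasing d by (metis strict_monoI)
    have cont: "isCont (\<phi> i) x" for x using d DERIV_isCont by blast
    have "\<exists>x. \<phi> i x = y" for y
    proof -
      define k where "k = \<lfloor>y - \<phi> i 0\<rfloor>"
      have "\<phi> i (of_int k) \<le> y" "y \<le> \<phi> i (of_int (k + 1))"
        using shift_of_int[of "\<phi> i" 0 k] shift_of_int[of "\<phi> i" 0 "k + 1"] p unfolding k_def by (simp_all add: algebra_simps; linarith)+
      then show ?thesis using IVT[of "\<phi> i" "of_int k" y "of_int (k + 1)"] cont by auto
    qed
    then show "surj (\<phi> i)" by (metis surjI)
  qed
  have R: "reparametrized K K' H \<sigma> \<phi>"
    unfolding reparametrized_def H_def[symmetric] using bH b diffeo cv H_def by blast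
  let ?P = "\<lambda>p::param. (\<sigma> (fst p), \<phi> (fst p) (snd p))"
  obtain DH where DH: "\<And>z. (H has_derivative DH z) (at z)" "\<And>z u v. cross u v > 0 \<Longrightarrow> cross (DH z u) (DH z v) > 0"
    "\<And>z u v. cross u v < 0 \<Longrightarrow> cross (DH z u) (DH z v) < 0"
    using ambient_isotopy_det[OF A] unfolding H_def by metis
  have vel: "\<exists>d>0. velocity K' p = d *\<^sub>R DH (pt K (?P p)) (velocity K (?P p))" if p: "p \<in> params K'" for p
  proof -
    obtain i t where it: "p = (i, t)" "i < ncomp K'" using p unfolding params_def by auto
    obtain d where d: "d > 0" "(\<phi> i has_real_derivative d) (at t)" using diffeo(4)[OF it(2)] by blast
    have "\<sigma> i < ncomp K" using reparam_props(1)[OF R it(2)] .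
    then have "(curve K (\<sigma> i) has_vector_derivative velocity K (\<sigma> i, \<phi> i t)) (at (\<phi> i t))"
      using curve_props(1)[OF D(1)] by blast
    then have "((curve K (\<sigma> i) \<circ> \<phi> i) has_vector_derivative d *\<^sub>R velocity K (\<sigma> i, \<phi> i t)) (at t)"
      by (intro vector_diff_chain_at) (use d in \<open>auto simp: has_real_derivative_iff_has_vector_derivative\<close>)
    then have "((H \<circ> (curve K (\<sigma> i) \<circ> \<phi> i)) has_vector_derivative
        DH (curve K (\<sigma> i) (\<phi> i t)) (d *\<^sub>R velocity K (\<sigma> i, \<phi> i t))) (at t)"
      using DH(1) vector_derivative_diff_chain_within[of "curve K (\<sigma> i) \<circ> \<phi> i" _ t UNIV H]
      by (auto simp: has_derivative_at_withinI)
    moreover have "H \<circ> (curve K (\<sigma> i) \<circ> \<phi> i) = curve K' i" using cv[OF it(2)] unfolding H_def by auto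
    ultimately have "velocity K' p = DH (curve K (\<sigma> i) (\<phi> i t)) (d *\<^sub>R velocity K (\<sigma> i, \<phi> i t))"
      unfolding velocity_def it by (simp add: vector_derivative_at)
    moreover have "linear (DH z)" for z using DH(1) has_derivative_linear by blast
    ultimately have "velocity K' p = d *\<^sub>R DH (pt K (?P p)) (velocity K (?P p))"
      unfolding it pt_def by (simp add: linear_scale)
    then show ?thesis using d by blast
  qed
  have sgn: "cross (velocity K (?P p)) (velocity K (?P q)) > 0 \<Longrightarrow> cross (velocity K' p) (velocity K' q) > 0"
    "cross (velocity K (?P p)) (velocity K (?P q)) < 0 \<Longrightarrow> cross (velocity K' p) (velocity K' q) < 0"
    if m: "meet K' p q" for p q
  proof -
    have p: "p \<in> params K'" "q \<in> params K'" using m unfolding meet_def by auto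
    then have "meet K (?P p) (?P q)" using m reparam_meet[OF R] by blast
    then have e: "pt K (?P p) = pt K (?P q)" unfolding meet_def by blast
    obtain d d' where "d > 0" "d' > 0" and v: "velocity K' p = d *\<^sub>R DH (pt K (?P q)) (velocity K (?P p))"
      "velocity K' q = d' *\<^sub>R DH (pt K (?P q)) (velocity K (?P q))"
      using vel[OF p(1)] vel[OF p(2)] e by metis
    then have dd: "d * d' > 0" by simp
    show "cross (velocity K' p) (velocity K' q) > 0" if "cross (velocity K (?P p)) (velocity K (?P q)) > 0"
      unfolding v cross_scale using DH(2)[OF that] dd by simp
    show "cross (velocity K' p) (velocity K' q) < 0" if "cross (velocity K (?P p)) (velocity K (?P q)) < 0"
      unfolding v cross_scale using DH(3)[OF that] dd by (simp add: mult_pos_neg)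
  qed
  have over: "p \<in> over K' \<longleftrightarrow> ?P p \<in> over K" if "p \<in> params K'" for p
    using ov that unfolding params_def by (cases p) auto
  have lift: "\<exists>p' q'. meet K' p' q' \<and> ?P p' = p \<and> ?P q' = q \<and> pt K' p' = H (pt K p) \<and> p' \<in> params K'" if m: "meet K p q" for p q
  proof -
    have "p \<in> params K" "q \<in> params K" using m unfolding meet_def by auto
    then obtain p' q' where "p' \<in> params K'" "?P p' = p" "q' \<in> params K'" "?P q' = q"
      by (metis (no_types, lifting) reparam_onto[OF R])
    then show ?thesis using m reparam_meet[OF R] reparam_pt[OF R] by blast
  qed
  have w: "positive_crossing K c \<Longrightarrow> positive_crossing K' (H c)"
    "negative_crossing K c \<Longrightarrow> negative_crossing K' (H c)"
    "precrossing K c \<Longrightarrow> precrossing K' (H c)" for c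
  proof -
    assume "positive_crossing K c"
    then obtain p q where 1: "meet K p q" "pt K p = c" "p \<in> over K" "cross (velocity K p) (velocity K q) > 0"
      unfolding positive_crossing_def by blast
    obtain p' q' where "meet K' p' q'" "?P p' = p" "?P q' = q" "pt K' p' = H c" "p' \<in> params K'"
      using lift[OF 1(1)] 1 by auto
    then show "positive_crossing K' (H c)"
      unfolding positive_crossing_def using sgn(1)[of p' q'] over 1 by blast
  next
    assume "negative_crossing K c"
    then obtain p q where 1: "meet K p q" "pt K p = c" "p \<in> over K" "cross (velocity K p) (velocity K q) < 0"
      unfolding negative_crossing_def by blast
    obtain p' q' where "meet K' p' q'" "?P p' = p" "?P q' = q" "pt K' p' = H c" "p' \<in> params K'"
      using lift[OF 1(1)] 1 by auto
    then show "negative_crossing K' (H c)"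
      unfolding negative_crossing_def using sgn(2)[of p' q'] over 1 by blast
  next
    assume P: "precrossing K c"
    have "H c \<in> dpts K'" using P reparam_dpts[OF R] unfolding precrossing_def by blast
    moreover have "p \<notin> over K'" if "p \<in> params K'" "pt K' p = H c" for p
    proof -
      have "pt K (?P p) = c" using that reparam_pt[OF R, of p] bH by (simp add: bij_is_inj inj_eq)
      then show ?thesis using P over that reparam_params[OF R] unfolding precrossing_def by blast
    qed
    ultimately show "precrossing K' (H c)" unfolding precrossing_def by blast
  qed
  have upd: "(s(c \<mapsto> x)) \<circ> inv H = (s \<circ> inv H)(H c \<mapsto> x)" for s :: smoothings and c x
    using bH by (auto simp: fun_eq_iff bij_is_inj bij_inv_eq_iff)
  have dm: "H c \<in> dom (s \<circ> inv H) \<longleftrightarrow> c \<in> dom s" for c and s :: smoothings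
    using bH by (auto simp: dom_def bij_is_inj)
  have "bracket_eval K s p \<Longrightarrow> bracket_eval K' (s \<circ> inv H) p" for s p
  proof (induction rule: bracket_eval.induct)
    case (positive c s p q)
    then show ?case using bracket_eval.positive[of "H c" "s \<circ> inv H" K' p q] w dm unfolding upd by blast
  next
    case (negative c s p q)
    then show ?case using bracket_eval.negative[of "H c" "s \<circ> inv H" K' p q] w dm unfolding upd by blast
  next
    case (pre c s p q)
    then show ?case using bracket_eval.pre[of "H c" "s \<circ> inv H" K' p q] w dm unfolding upd by blast
  next
    case (unlink s)
    have "c \<in> dom (s \<circ> inv H) \<longleftrightarrow> c \<in> dpts K'" for c
    proof -
      obtain b where "c = H b" using bH by (metis bij_pointE)
      then show ?thesis using dm unlink reparam_dpts[OF R] bH by (simp add: bij_is_inj inj_image_mem_iff)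
    qed
    then have "bracket_eval K' (s \<circ> inv H) (unlink_value (card (circles K' (s \<circ> inv H))))"
      by (intro bracket_eval.unlink) blast
    moreover have "card (circles K' (s \<circ> inv H)) = card (circles K s)"
      by (rule reparametrized_circles[OF D R]) (use bH in \<open>simp add: bij_is_inj\<close>)
    ultimately show ?case by (simp only:)
  qed
  from this[of Map.empty "bracket K"] have "bracket_eval K' Map.empty (bracket K)"
    using bracket_eval_iff[OF D(1), of Map.empty "bracket K"] unfolding bracket_value_at by simp
  then show ?thesis using bracket_eval_iff[OF D(2), of Map.empty "bracket K"] unfolding bracket_value_at by simp
qed

section \<open>Strands as graphs over the horizontal axis\<close>

definition rightward :: "diagram_data \<Rightarrow> strand \<Rightarrow> bool" where
  "rightward K s \<longleftrightarrow> Re (pt K (fst s, fst (snd s))) = -1"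

text \<open>
  The parameter at which a strand crosses the vertical line through \<open>x\<close>.  With it, all strands are
  followed from left to right, whatever their orientations.
\<close>

definition at_abscissa :: "diagram_data \<Rightarrow> strand \<Rightarrow> real \<Rightarrow> param" where
  "at_abscissa K s x =
     (fst s, THE t. t \<in> {fst (snd s)..snd (snd s)} \<and> Re (curve K (fst s) t) = x)"

definition height :: "diagram_data \<Rightarrow> strand \<Rightarrow> real \<Rightarrow> real" where
  "height K s x = Im (pt K (at_abscissa K s x))"

definition slope :: "diagram_data \<Rightarrow> strand \<Rightarrow> real \<Rightarrow> real" where
  "slope K s x = Im (velocity K (at_abscissa K s x)) / Re (velocity K (at_abscissa K s x))"

text \<open>
  Germs of labels in terms of parameters and in terms of abscissas; \<open>\<tau>\<close> will be the parameter of a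
  strand as a function of the abscissa, increasing or decreasing with its orientation.
\<close>

lemma eventually_left_increasing:
  fixes \<tau> :: "real \<Rightarrow> real"
  assumes inc: "\<And>x y. x \<in> {-1..1} \<Longrightarrow> y \<in> {-1..1} \<Longrightarrow> x < y \<Longrightarrow> \<tau> x < \<tau> y"
    and im: "\<tau> ` {-1..1} = {a..b}" and x0: "-1 < x0" "x0 \<le> 1"
  shows "(\<forall>\<^sub>F t in at_left (\<tau> x0). P t) \<longleftrightarrow> (\<forall>\<^sub>F x in at_left x0. P (\<tau> x))"
proof
  assume "\<forall>\<^sub>F t in at_left (\<tau> x0). P t"
  then obtain c where c: "c < \<tau> x0" "\<And>t. c < t \<Longrightarrow> t < \<tau> x0 \<Longrightarrow> P t"
    by (auto simp: eventually_at_left_field)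
  have "\<tau> (-1) < \<tau> x0" using inc[of "-1" x0] x0 by simp
  have mem: "\<tau> x \<in> {a..b}" if "x \<in> {-1..1}" for x using im that by blast
  have "max c a \<in> {a..b}" "max c (\<tau> (-1)) < \<tau> x0" using c \<open>\<tau> (-1) < \<tau> x0\<close> mem[of x0] mem[of "-1"] x0 by auto
  then have "max c (\<tau> (-1)) \<in> {a..b}" using mem[of "-1"] mem[of x0] x0 by auto
  then obtain d where d: "d \<in> {-1..1}" "\<tau> d = max c (\<tau> (-1))" using im by (metis imageE)
  have "d < x0" using d inc[of x0 d] x0 \<open>max c (\<tau> (-1)) < \<tau> x0\<close> by (cases x0 d rule: linorder_cases) auto
  moreover have "P (\<tau> x)" if "d < x" "x < x0" for x
  proof (rule c(2))
    show "c < \<tau> x" using inc[of d x] d that x0 by auto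
    show "\<tau> x < \<tau> x0" using inc[of x x0] d that x0 by auto
  qed
  ultimately show "\<forall>\<^sub>F x in at_left x0. P (\<tau> x)" unfolding eventually_at_left_field by blast
next
  assume "\<forall>\<^sub>F x in at_left x0. P (\<tau> x)"
  then obtain c where c: "c < x0" "\<And>t. c < t \<Longrightarrow> t < x0 \<Longrightarrow> P (\<tau> t)"
    by (auto simp: eventually_at_left_field)
  define c' where "c' = max c (-1)"
  have c': "c' \<in> {-1..1}" "c' < x0" using c x0 unfolding c'_def by auto
  have mem: "\<tau> x \<in> {a..b}" if "x \<in> {-1..1}" for x using im that by blast
  have "P t" if t: "\<tau> c' < t" "t < \<tau> x0" for t
  proof -
    have "t \<in> {a..b}" using t mem[of c'] mem[of x0] c' x0 by auto
    then obtain y where y: "y \<in> {-1..1}" "\<tau> y = t" using im by (metis imageE)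
    have "c' < y" using inc[of y c'] y c' t by (cases c' y rule: linorder_cases) auto
    moreover have "y < x0" using inc[of x0 y] y x0 t by (cases x0 y rule: linorder_cases) auto
    ultimately show ?thesis using c(2)[of y] y unfolding c'_def by auto
  qed
  moreover have "\<tau> c' < \<tau> x0" using inc c' x0 by simp
  ultimately show "\<forall>\<^sub>F t in at_left (\<tau> x0). P t" unfolding eventually_at_left_field by blast
qed

lemma eventually_at_left_minus: "(\<forall>\<^sub>F t in at_left (- (x::real)). P t) \<longleftrightarrow> (\<forall>\<^sub>F t in at_right x. P (- t))"
  by (simp add: at_left_minus eventually_filtermap)

lemma eventually_at_right_minus: "(\<forall>\<^sub>F t in at_right (- (x::real)). P t) \<longleftrightarrow> (\<forall>\<^sub>F t in at_left x. P (- t))"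
  by (simp add: at_right_minus eventually_filtermap)

lemma eventually_right_increasing:
  fixes \<tau> :: "real \<Rightarrow> real"
  assumes inc: "\<And>x y. x \<in> {-1..1} \<Longrightarrow> y \<in> {-1..1} \<Longrightarrow> x < y \<Longrightarrow> \<tau> x < \<tau> y"
    and im: "\<tau> ` {-1..1} = {a..b}" and x0: "-1 \<le> x0" "x0 < 1"
  shows "(\<forall>\<^sub>F t in at_right (\<tau> x0). P t) \<longleftrightarrow> (\<forall>\<^sub>F x in at_right x0. P (\<tau> x))"
proof -
  define \<tau>' where "\<tau>' x = - \<tau> (- x)" for x
  have inc': "\<tau>' x < \<tau>' y" if "x \<in> {-1..1}" "y \<in> {-1..1}" "x < y" for x y
    using inc[of "-y" "-x"] that unfolding \<tau>'_def by auto
  have "\<tau>' ` {-1..1} = uminus ` \<tau> ` uminus ` {-1..1}" unfolding \<tau>'_def image_image ..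
  then have im': "\<tau>' ` {-1..1} = {-b..-a}" using im by simp
  have "(\<forall>\<^sub>F t in at_left (\<tau>' (-x0)). P (- t)) \<longleftrightarrow> (\<forall>\<^sub>F x in at_left (-x0). P (- \<tau>' x))"
    by (rule eventually_left_increasing[OF inc' im']) (use x0 in auto)
  then show ?thesis unfolding \<tau>'_def eventually_at_left_minus by simp
qed

lemma eventually_decreasing:
  fixes \<tau> :: "real \<Rightarrow> real"
  assumes dec: "\<And>x y. x \<in> {-1..1} \<Longrightarrow> y \<in> {-1..1} \<Longrightarrow> x < y \<Longrightarrow> \<tau> y < \<tau> x"
    and im: "\<tau> ` {-1..1} = {a..b}"
  shows "-1 < x0 \<Longrightarrow> x0 \<le> 1 \<Longrightarrow> (\<forall>\<^sub>F t in at_right (\<tau> x0). P t) \<longleftrightarrow> (\<forall>\<^sub>F x in at_left x0. P (\<tau> x))"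
    "-1 \<le> x0 \<Longrightarrow> x0 < 1 \<Longrightarrow> (\<forall>\<^sub>F t in at_left (\<tau> x0). P t) \<longleftrightarrow> (\<forall>\<^sub>F x in at_right x0. P (\<tau> x))"
proof -
  have inc: "- \<tau> x < - \<tau> y" if "x \<in> {-1..1}" "y \<in> {-1..1}" "x < y" for x y using dec that by simp
  have "(\<lambda>x. - \<tau> x) ` {-1..1} = uminus ` \<tau> ` {-1..1}" by (simp add: image_image)
  then have im': "(\<lambda>x. - \<tau> x) ` {-1..1} = {-b..-a}" using im by simp
  show "(\<forall>\<^sub>F t in at_right (\<tau> x0). P t) \<longleftrightarrow> (\<forall>\<^sub>F x in at_left x0. P (\<tau> x))" if "-1 < x0" "x0 \<le> 1"
    using eventually_left_increasing[OF inc im' that, of "\<lambda>t. P (- t)"] unfolding eventually_at_left_minus by simp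
  show "(\<forall>\<^sub>F t in at_left (\<tau> x0). P t) \<longleftrightarrow> (\<forall>\<^sub>F x in at_right x0. P (\<tau> x))" if "-1 \<le> x0" "x0 < 1"
    using eventually_right_increasing[OF inc im' that, of "\<lambda>t. P (- t)"] unfolding eventually_at_right_minus by simp
qed

context
  fixes K i a b
  assumes D: "diagram K" and H: "horizontal_strand K (i, a, b)"
begin

private lemma basic: "i < ncomp K" "a < b"
  using H by auto

private lemma Re_deriv: "((\<lambda>t. Re (curve K i t)) has_real_derivative Re (velocity K (i, t))) (at t)"
  and Im_deriv: "((\<lambda>t. Im (curve K i t)) has_real_derivative Im (velocity K (i, t))) (at t)"
proof -
  have d: "(curve K i has_derivative (\<lambda>h. h *\<^sub>R velocity K (i, t))) (at t)"
    using curve_props(1)[OF D basic(1)] unfolding has_vector_derivative_def .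
  have e: "(\<lambda>h. h * c) = (*) c" for c :: real by (simp add: fun_eq_iff)
  show "((\<lambda>t. Re (curve K i t)) has_real_derivative Re (velocity K (i, t))) (at t)"
    using bounded_linear.has_derivative[OF bounded_linear_Re d] unfolding has_field_derivative_def by (simp add: e)
  show "((\<lambda>t. Im (curve K i t)) has_real_derivative Im (velocity K (i, t))) (at t)"
    using bounded_linear.has_derivative[OF bounded_linear_Im d] unfolding has_field_derivative_def by (simp add: e)
qed

lemma strand_direction:
  "rightward K (i, a, b) \<Longrightarrow> Re (pt K (i, a)) = -1 \<and> Re (pt K (i, b)) = 1 \<and> (\<forall>t\<in>{a..b}. Re (velocity K (i, t)) > 0)"
  "\<not> rightward K (i, a, b) \<Longrightarrow> Re (pt K (i, a)) = 1 \<and> Re (pt K (i, b)) = -1 \<and> (\<forall>t\<in>{a..b}. Re (velocity K (i, t)) < 0)"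
  using H unfolding rightward_def by auto

private lemma mono_right: "Re (curve K i t) < Re (curve K i u)"
  if "rightward K (i, a, b)" "a \<le> t" "t < u" "u \<le> b"
  by (rule DERIV_pos_imp_increasing[OF that(3)]) (use Re_deriv strand_direction(1)[OF that(1)] that in force)

private lemma mono_left: "Re (curve K i u) < Re (curve K i t)"
  if "\<not> rightward K (i, a, b)" "a \<le> t" "t < u" "u \<le> b"
  by (rule DERIV_neg_imp_decreasing[OF that(3)]) (use Re_deriv strand_direction(2)[OF that(1)] that in force)

private lemma inj: "t = u" if "t \<in> {a..b}" "u \<in> {a..b}" "Re (curve K i t) = Re (curve K i u)"
proof (cases "rightward K (i, a, b)")
  case True
  then show ?thesis using mono_right[of t u] mono_right[of u t] that by (cases t u rule: linorder_cases) auto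
next
  case False
  then show ?thesis using mono_left[of t u] mono_left[of u t] that by (cases t u rule: linorder_cases) auto
qed

private lemma range_Re: "Re (curve K i t) \<in> {-1..1}" if t: "t \<in> {a..b}"
proof (cases "rightward K (i, a, b)")
  case True
  note d = strand_direction(1)[OF this]
  have "Re (curve K i a) \<le> Re (curve K i t)" "Re (curve K i t) \<le> Re (curve K i b)"
    using mono_right[OF True, of a t] mono_right[OF True, of t b] t by (cases "t = a"; cases "t = b"; auto)+
  then show ?thesis using d unfolding pt_def by simp
next
  case False
  note d = strand_direction(2)[OF this]
  have "Re (curve K i a) \<ge> Re (curve K i t)" "Re (curve K i t) \<ge> Re (curve K i b)"
    using mono_left[OF False, of a t] mono_left[OF False, of t b] t by (cases "t = a"; cases "t = b"; auto)+
  then show ?thesis using d unfolding pt_def by simp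
qed

private lemma isCont_Re: "isCont (\<lambda>t. Re (curve K i t)) t"
  using Re_deriv DERIV_isCont by blast

private lemma ex_abscissa: "\<exists>t\<in>{a..b}. Re (curve K i t) = x" if x: "x \<in> {-1..1}"
proof (cases "rightward K (i, a, b)")
  case True
  note d = strand_direction(1)[OF this]
  show ?thesis
    using IVT[of "\<lambda>t. Re (curve K i t)" a x b] d x basic isCont_Re unfolding pt_def by auto
next
  case False
  note d = strand_direction(2)[OF this]
  show ?thesis
    using IVT2[of "\<lambda>t. Re (curve K i t)" b x a] d x basic isCont_Re unfolding pt_def by auto
qed

definition abscissa_time :: "real \<Rightarrow> real" where "abscissa_time x = snd (at_abscissa K (i, a, b) x)"

private lemma at_abscissa_time: "at_abscissa K (i, a, b) x = (i, abscissa_time x)"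
  unfolding abscissa_time_def at_abscissa_def by simp

private lemma time_of: "abscissa_time x \<in> {a..b}" "Re (curve K i (abscissa_time x)) = x" if x: "x \<in> {-1..1}"
proof -
  have "\<exists>!t. t \<in> {a..b} \<and> Re (curve K i t) = x" using ex_abscissa[OF x] inj by blast
  from theI'[OF this] show "abscissa_time x \<in> {a..b}" "Re (curve K i (abscissa_time x)) = x"
    unfolding abscissa_time_def at_abscissa_def by auto
qed

private lemma time_inv: "abscissa_time (Re (curve K i t)) = t" if "t \<in> {a..b}"
  using time_of[OF range_Re[OF that]] inj that by blast

private lemma time_right: "abscissa_time x < abscissa_time y" if "rightward K (i, a, b)" "x \<in> {-1..1}" "y \<in> {-1..1}" "x < y"
  using mono_right[OF that(1), of "abscissa_time y" "abscissa_time x"] time_of[OF that(2)] time_of[OF that(3)] that(4)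
  by (cases "abscissa_time x" "abscissa_time y" rule: linorder_cases) auto

private lemma time_left: "abscissa_time y < abscissa_time x" if "\<not> rightward K (i, a, b)" "x \<in> {-1..1}" "y \<in> {-1..1}" "x < y"
  using mono_left[OF that(1), of "abscissa_time x" "abscissa_time y"] time_of[OF that(2)] time_of[OF that(3)] that(4)
  by (cases "abscissa_time x" "abscissa_time y" rule: linorder_cases) auto

private lemma time_image: "abscissa_time ` {-1..1} = {a..b}"
  using time_of(1) time_inv range_Re by (metis (no_types, lifting) image_eqI image_subsetI subsetI subset_antisym)

lemma at_abscissa_param: "x \<in> {-1..1} \<Longrightarrow> at_abscissa K (i, a, b) x \<in> params K"
  "x \<in> {-1..1} \<Longrightarrow> Re (pt K (at_abscissa K (i, a, b) x)) = x"
  "x \<in> {-1..1} \<Longrightarrow> \<bar>Im (pt K (at_abscissa K (i, a, b) x))\<bar> < 1"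
  unfolding at_abscissa_time params_def pt_def using basic time_of H by (auto simp: pt_def)

lemma at_abscissa_ends:
  "at_abscissa K (i, a, b) (-1) = (i, if rightward K (i, a, b) then a else b)"
  "at_abscissa K (i, a, b) 1 = (i, if rightward K (i, a, b) then b else a)"
  unfolding at_abscissa_time
  using time_inv[of a] time_inv[of b] basic strand_direction unfolding pt_def by (auto split: if_splits)

lemma strand_params_abscissa:
  "p \<in> strand_params (i, a, b) \<longleftrightarrow> (\<exists>x\<in>{-1..1}. same_param p (at_abscissa K (i, a, b) x))"
proof
  assume "p \<in> strand_params (i, a, b)"
  then obtain t k where p: "p = (i, t + of_int k)" "t \<in> {a..b}" by auto
  have "same_param p (at_abscissa K (i, a, b) (Re (curve K i t)))"
    unfolding at_abscissa_time same_param_def using time_inv[OF p(2)] p by simp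
  then show "\<exists>x\<in>{-1..1}. same_param p (at_abscissa K (i, a, b) x)" using range_Re[OF p(2)] by blast
next
  assume "\<exists>x\<in>{-1..1}. same_param p (at_abscissa K (i, a, b) x)"
  then obtain x where x: "x \<in> {-1..1}" "fst p = i" "snd p - abscissa_time x \<in> \<int>"
    unfolding at_abscissa_time same_param_def by auto
  then obtain k where "snd p - abscissa_time x = of_int k" by (auto elim: Ints_cases)
  then have "p = (i, abscissa_time x + of_int k)" using x(2) by (cases p) (simp add: algebra_simps)
  then show "p \<in> strand_params (i, a, b)" using time_of(1)[OF x(1)] by auto
qed

lemma strand_germs:
  fixes g :: "param \<Rightarrow> 'c"
  defines "l x0 u \<equiv> \<forall>\<^sub>F x in at_left x0. g (at_abscissa K (i, a, b) x) = u"
    and "r x0 u \<equiv> \<forall>\<^sub>F x in at_right x0. g (at_abscissa K (i, a, b) x) = u"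
  shows "rightward K (i, a, b) \<Longrightarrow> -1 < x0 \<Longrightarrow> x0 \<le> 1 \<Longrightarrow> germ_left g (at_abscissa K (i, a, b) x0) u \<longleftrightarrow> l x0 u"
    "rightward K (i, a, b) \<Longrightarrow> -1 \<le> x0 \<Longrightarrow> x0 < 1 \<Longrightarrow> germ_right g (at_abscissa K (i, a, b) x0) u \<longleftrightarrow> r x0 u"
    "\<not> rightward K (i, a, b) \<Longrightarrow> -1 < x0 \<Longrightarrow> x0 \<le> 1 \<Longrightarrow> germ_right g (at_abscissa K (i, a, b) x0) u \<longleftrightarrow> l x0 u"
    "\<not> rightward K (i, a, b) \<Longrightarrow> -1 \<le> x0 \<Longrightarrow> x0 < 1 \<Longrightarrow> germ_left g (at_abscissa K (i, a, b) x0) u \<longleftrightarrow> r x0 u"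
  unfolding l_def r_def germ_left_def germ_right_def at_abscissa_time fst_conv snd_conv
  using eventually_left_increasing[OF time_right time_image, of x0 "\<lambda>t. g (i, t) = u"]
    eventually_right_increasing[OF time_right time_image, of x0 "\<lambda>t. g (i, t) = u"]
    eventually_decreasing[OF time_left time_image, of x0 "\<lambda>t. g (i, t) = u"]
  by blast+

lemma at_abscissa_between:
  assumes x: "x \<in> {-1..1}" and y: "y \<in> {-1..1}" and xy: "x \<le> y"
    and t: "min (snd (at_abscissa K (i, a, b) x)) (snd (at_abscissa K (i, a, b) y)) \<le> t"
      "t \<le> max (snd (at_abscissa K (i, a, b) x)) (snd (at_abscissa K (i, a, b) y))"
  shows "\<exists>z\<in>{x..y}. (i, t) = at_abscissa K (i, a, b) z"
proof -
  have "t \<in> {a..b}" using t time_of(1)[OF x] time_of(1)[OF y] unfolding at_abscissa_time by auto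
  then obtain z where z: "z \<in> {-1..1}" "t = abscissa_time z" using time_image by (metis imageE)
  have "x \<le> z \<and> z \<le> y"
  proof (cases "rightward K (i, a, b)")
    case True
    note m = time_right[OF True]
    show ?thesis using m[OF z(1) x] m[OF y z(1)] m[OF x y] t z xy unfolding at_abscissa_time
      by (cases "x = y") (auto simp: not_le[symmetric])
  next
    case False
    note m = time_left[OF False]
    show ?thesis using m[OF z(1) x] m[OF y z(1)] m[OF x y] t z xy unfolding at_abscissa_time
      by (cases "x = y") (auto simp: not_le[symmetric])
  qed
  then show ?thesis using z unfolding at_abscissa_time by auto
qed

private lemma continuous_time: "continuous_on {-1..1} abscissa_time"
proof -
  have "continuous_on ((\<lambda>t. Re (curve K i t)) ` {a..b}) abscissa_time"
  proof (rule continuous_on_inv)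
    show "continuous_on {a..b} (\<lambda>t. Re (curve K i t))"
      by (rule continuous_at_imp_continuous_on) (use isCont_Re in blast)
  qed (use time_inv in auto)
  moreover have "(\<lambda>t. Re (curve K i t)) ` {a..b} = {-1..1}"
    using range_Re ex_abscissa by (auto simp: image_iff) metis
  ultimately show ?thesis by simp
qed

lemma height_continuous: "continuous_on {-1..1} (height K (i, a, b))"
proof -
  have "continuous_on {-1..1} (\<lambda>x. Im (curve K i (abscissa_time x)))"
    by (intro continuous_intros continuous_on_compose2[OF curve_props(3)[OF D basic(1)] continuous_time]) auto
  then show ?thesis unfolding height_def[abs_def] at_abscissa_time pt_def by simp
qed

lemma height_deriv:
  assumes x: "-1 < x" "x < 1"
  shows "(height K (i, a, b) has_real_derivative slope K (i, a, b) x) (at x)"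
proof -
  have t: "abscissa_time x \<in> {a..b}" using time_of x by simp
  have ne: "Re (velocity K (i, abscissa_time x)) \<noteq> 0" using strand_direction t by (cases "rightward K (i, a, b)") force+
  have "isCont abscissa_time x" using continuous_time x by (simp add: continuous_on_interior)
  then have "(abscissa_time has_real_derivative inverse (Re (velocity K (i, abscissa_time x)))) (at x)"
    by (intro DERIV_inverse_function[where f = "\<lambda>t. Re (curve K i t)" and a = "-1" and b = 1])
       (use Re_deriv ne x time_of in auto)
  then have "((\<lambda>x. Im (curve K i (abscissa_time x))) has_real_derivative Im (velocity K (i, abscissa_time x)) * inverse (Re (velocity K (i, abscissa_time x)))) (at x)"
    using DERIV_chain2[OF Im_deriv] by blast
  then show ?thesis unfolding height_def[abs_def] slope_def at_abscissa_time pt_def by (simp add: divide_inverse)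
qed

lemma velocity_abscissa:
  assumes "x \<in> {-1..1}"
  shows "rightward K (i, a, b) \<Longrightarrow> Re (velocity K (at_abscissa K (i, a, b) x)) > 0"
    "\<not> rightward K (i, a, b) \<Longrightarrow> Re (velocity K (at_abscissa K (i, a, b) x)) < 0"
  unfolding at_abscissa_time using strand_direction time_of(1)[OF assms] by auto

text \<open>A strand crosses the edges of the square transversally.\<close>

lemma strand_leaves: "\<forall>\<^sub>F t in at_left a. pt K (i, t) \<notin> square" "\<forall>\<^sub>F t in at_right b. pt K (i, t) \<notin> square"
proof -
  show "\<forall>\<^sub>F t in at_left a. pt K (i, t) \<notin> square"
  proof (cases "rightward K (i, a, b)")
    case True
    note d = strand_direction(1)[OF this]
    obtain e where e: "e > 0" "\<And>h. h > 0 \<Longrightarrow> h < e \<Longrightarrow> Re (curve K i (a - h)) < Re (curve K i a)"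
      using DERIV_pos_inc_left[OF Re_deriv, of a] d basic by auto
    have "Re (curve K i t) < -1" if "a - e < t" "t < a" for t
      using e(2)[of "a - t"] that d unfolding pt_def by simp
    then show ?thesis unfolding eventually_at_left_field using \<open>e > 0\<close>
      by (intro exI[of _ "a - e"]) (force simp: square_def pt_def)
  next
    case False
    note d = strand_direction(2)[OF this]
    obtain e where e: "e > 0" "\<And>h. h > 0 \<Longrightarrow> h < e \<Longrightarrow> Re (curve K i (a - h)) > Re (curve K i a)"
      using DERIV_neg_dec_left[OF Re_deriv, of a] d basic by auto
    have "Re (curve K i t) > 1" if "a - e < t" "t < a" for t
      using e(2)[of "a - t"] that d unfolding pt_def by simp
    then show ?thesis unfolding eventually_at_left_field using \<open>e > 0\<close>
      by (intro exI[of _ "a - e"]) (force simp: square_def pt_def)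
  qed
  show "\<forall>\<^sub>F t in at_right b. pt K (i, t) \<notin> square"
  proof (cases "rightward K (i, a, b)")
    case True
    note d = strand_direction(1)[OF this]
    obtain e where e: "e > 0" "\<And>h. h > 0 \<Longrightarrow> h < e \<Longrightarrow> Re (curve K i b) < Re (curve K i (b + h))"
      using DERIV_pos_inc_right[OF Re_deriv, of b] d basic by auto
    have "Re (curve K i t) > 1" if "t < b + e" "b < t" for t
      using e(2)[of "t - b"] that d unfolding pt_def by simp
    then show ?thesis unfolding eventually_at_right_field using \<open>e > 0\<close>
      by (intro exI[of _ "b + e"]) (force simp: square_def pt_def)
  next
    case False
    note d = strand_direction(2)[OF this]
    obtain e where e: "e > 0" "\<And>h. h > 0 \<Longrightarrow> h < e \<Longrightarrow> Re (curve K i b) > Re (curve K i (b + h))"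
      using DERIV_neg_dec_right[OF Re_deriv, of b] d basic by auto
    have "Re (curve K i t) < -1" if "t < b + e" "b < t" for t
      using e(2)[of "t - b"] that d unfolding pt_def by simp
    then show ?thesis unfolding eventually_at_right_field using \<open>e > 0\<close>
      by (intro exI[of _ "b + e"]) (force simp: square_def pt_def)
  qed
qed

end

section \<open>Tangles as relations between end labels\<close>

text \<open>
  The labels \<open>L\<close> just left of a double point and the labels \<open>R\<close> just right of it, for \<open>N\<close> strands of which
  \<open>u\<close> and \<open>v\<close> meet there.  Strands keep their numbers when they cross, which is why the passing smoothing
  exchanges labels.
\<close>

definition crossing_step :: "nat \<Rightarrow> nat \<times> nat \<times> bool \<Rightarrow> (nat \<Rightarrow> 'a) \<Rightarrow> (nat \<Rightarrow> 'a) \<Rightarrow> bool" where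
  "crossing_step N c L R \<longleftrightarrow> (case c of (u, v, through) \<Rightarrow>
     (\<forall>j<N. j \<noteq> u \<and> j \<noteq> v \<longrightarrow> R j = L j) \<and>
     (if through then R u = L v \<and> R v = L u else L u = L v \<and> R u = R v))"

definition chain :: "nat \<Rightarrow> (nat \<times> nat \<times> bool) list \<Rightarrow> (nat \<Rightarrow> nat \<Rightarrow> 'a) \<Rightarrow> bool" where
  "chain N W G \<longleftrightarrow> (\<forall>k<length W. crossing_step N (W ! k) (G k) (G (Suc k)))"

text \<open>
  The relation between the outermost labels, with the labels in between eliminated.  In this form a
  concrete word unfolds to equations between end labels by rewriting.
\<close>

fun tangle :: "nat \<Rightarrow> (nat \<times> nat \<times> bool) list \<Rightarrow> (nat \<Rightarrow> 'a) \<Rightarrow> (nat \<Rightarrow> 'a) \<Rightarrow> bool" where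
  "tangle N [] L R \<longleftrightarrow> (\<forall>j<N. L j = R j)"
| "tangle N ((u, v, through) # W) L R \<longleftrightarrow>
     (if through then tangle N W (L(u := L v, v := L u)) R
      else L u = L v \<and> (\<exists>y. tangle N W (L(u := y, v := y)) R))"

lemma chain_Cons: "chain N (c # W) G \<longleftrightarrow> crossing_step N c (G 0) (G 1) \<and> chain N W (\<lambda>k. G (Suc k))"
  unfolding chain_def by (auto simp: less_Suc_eq_0_disj)

lemma tangle_iff_chain:
  "(\<And>u v h. (u, v, h) \<in> set W \<Longrightarrow> u < N \<and> v < N \<and> u \<noteq> v) \<Longrightarrow>
    tangle N W L R \<longleftrightarrow> (\<exists>G. chain N W G \<and> (\<forall>j<N. G 0 j = L j \<and> G (length W) j = R j))"
proof (induction W arbitrary: L)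
  case Nil
  have "tangle N [] L R" if "\<forall>j<N. G 0 j = L j \<and> G 0 j = R j" for G :: "nat \<Rightarrow> nat \<Rightarrow> 'a" using that by auto
  moreover have "\<exists>G. chain N [] G \<and> (\<forall>j<N. G 0 j = L j \<and> G 0 j = R j)" if "tangle N [] L R"
    using that by (intro exI[of _ "\<lambda>k. L"]) (simp add: chain_def)
  ultimately show ?case by auto
next
  case (Cons c W)
  obtain u v h where c: "c = (u, v, h)" by (cases c)
  have uv: "u < N" "v < N" "u \<noteq> v" using Cons(2)[of u v h] c by auto
  have IH: "tangle N W M R \<longleftrightarrow> (\<exists>G. chain N W G \<and> (\<forall>j<N. G 0 j = M j \<and> G (length W) j = R j))" for M
    using Cons(1)[of M] Cons(2) by auto
  have glue: "\<exists>G. chain N (c # W) G \<and> (\<forall>j<N. G 0 j = L j \<and> G (length (c # W)) j = R j)"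
    if M: "crossing_step N c L M" "tangle N W M R" for M
  proof -
    obtain G where G: "chain N W G" "\<forall>j<N. G 0 j = M j \<and> G (length W) j = R j" using IH M by blast
    define G' where "G' k = (case k of 0 \<Rightarrow> L | Suc k \<Rightarrow> G k)" for k
    have "crossing_step N c (G' 0) (G' 1)"
      using M(1) G(2) uv unfolding crossing_step_def G'_def c by auto
    then have "chain N (c # W) G'" unfolding chain_Cons using G(1) by (simp add: G'_def)
    then show ?thesis using G(2) by (intro exI[of _ G']) (simp add: G'_def)
  qed
  have split: "\<exists>M. crossing_step N c L M \<and> tangle N W M R"
    if G: "chain N (c # W) G" "\<forall>j<N. G 0 j = L j \<and> G (length (c # W)) j = R j" for G
  proof (intro exI conjI)
    show "crossing_step N c L (G 1)" using G uv unfolding chain_Cons crossing_step_def c by auto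
    show "tangle N W (G 1) R" unfolding IH using G unfolding chain_Cons by (intro exI[of _ "\<lambda>k. G (Suc k)"]) simp
  qed
  have ext: "tangle N W M R \<longleftrightarrow> tangle N W M' R" if "\<forall>j<N. M j = M' j" for M M'
    unfolding IH using that by auto
  have "tangle N (c # W) L R \<longleftrightarrow> (\<exists>M. crossing_step N c L M \<and> tangle N W M R)"
  proof (cases h)
    case True
    define L' where "L' = L(u := L v, v := L u)"
    have "crossing_step N c L M \<longleftrightarrow> (\<forall>j<N. M j = L' j)" for M
      unfolding crossing_step_def c L'_def using True uv by auto
    moreover have "tangle N (c # W) L R \<longleftrightarrow> tangle N W L' R" unfolding c L'_def using True by simp
    ultimately show ?thesis using ext by blast
  next
    case False
    define L' where "L' y = L(u := y, v := y)" for y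
    have "crossing_step N c L M \<longleftrightarrow> L u = L v \<and> (\<exists>y. \<forall>j<N. M j = L' y j)" for M
    proof
      assume "crossing_step N c L M"
      then show "L u = L v \<and> (\<exists>y. \<forall>j<N. M j = L' y j)"
        unfolding crossing_step_def c L'_def using False by (auto intro!: exI[of _ "M u"])
    next
      assume "L u = L v \<and> (\<exists>y. \<forall>j<N. M j = L' y j)"
      then obtain y where "L u = L v" "\<And>j. j < N \<Longrightarrow> M j = L' y j" by blast
      then show "crossing_step N c L M"
        unfolding crossing_step_def c L'_def using False uv by auto
    qed
    moreover have "tangle N (c # W) L R \<longleftrightarrow> L u = L v \<and> (\<exists>y. tangle N W (L' y) R)" unfolding c L'_def using False by simp
    ultimately show ?thesis using ext by blast
  qed
  moreover have "(\<exists>M. crossing_step N c L M \<and> tangle N W M R) \<longleftrightarrow>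
      (\<exists>G. chain N (c # W) G \<and> (\<forall>j<N. G 0 j = L j \<and> G (length (c # W)) j = R j))"
    (is "?l \<longleftrightarrow> ?r")
  proof
    show ?r if ?l using that by (elim exE conjE) (rule glue)
    show ?l if ?r using that by (elim exE conjE) (rule split)
  qed
  ultimately show ?case by (rule trans)
qed

section \<open>Braids in the square\<close>

text \<open>
  Germs to the left and to the right of an abscissa, as opposed to before and after in the
  orientation of the strand.
\<close>

definition germ_before :: "diagram_data \<Rightarrow> strand \<Rightarrow> (param \<Rightarrow> 'a) \<Rightarrow> real \<Rightarrow> 'a \<Rightarrow> bool" where
  "germ_before K s g x0 u \<longleftrightarrow> (\<forall>\<^sub>F x in at_left x0. g (at_abscissa K s x) = u)"

definition germ_beyond :: "diagram_data \<Rightarrow> strand \<Rightarrow> (param \<Rightarrow> 'a) \<Rightarrow> real \<Rightarrow> 'a \<Rightarrow> bool" where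
  "germ_beyond K s g x0 u \<longleftrightarrow> (\<forall>\<^sub>F x in at_right x0. g (at_abscissa K s x) = u)"

lemma germ_before_unique: "germ_before K s g x u \<Longrightarrow> germ_before K s g x v \<Longrightarrow> u = v"
proof -
  assume "germ_before K s g x u" "germ_before K s g x v"
  then have "\<forall>\<^sub>F t in at_left x. u = v" unfolding germ_before_def by eventually_elim simp
  then show ?thesis by simp
qed

lemma germ_beyond_unique: "germ_beyond K s g x u \<Longrightarrow> germ_beyond K s g x v \<Longrightarrow> u = v"
proof -
  assume "germ_beyond K s g x u" "germ_beyond K s g x v"
  then have "\<forall>\<^sub>F t in at_right x. u = v" unfolding germ_beyond_def by eventually_elim simp
  then show ?thesis by simp
qed

lemma germ_same_param:
  assumes P: "periodic K g" and p: "p \<in> params K" and s: "same_param p q"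
  shows "germ_left g q u \<longleftrightarrow> germ_left g p u" "germ_right g q u \<longleftrightarrow> germ_right g p u"
proof -
  obtain k where "snd p - snd q = of_int k" using s unfolding same_param_def by (auto elim: Ints_cases)
  then have k: "snd p = snd q + of_int k" "fst q = fst p" using s unfolding same_param_def by auto
  have g: "g (fst p, t + of_int k) = g (fst p, t)" for t
  proof -
    have "(fst p, t + of_int k) \<in> params K" using p unfolding params_def by auto
    then show ?thesis using P unfolding periodic_def same_param_def by auto
  qed
  show "germ_left g q u \<longleftrightarrow> germ_left g p u"
  proof
    assume "germ_left g q u"
    then obtain b where b: "b < snd q" "\<And>t. b < t \<Longrightarrow> t < snd q \<Longrightarrow> g (fst p, t) = u"
      unfolding germ_left_def eventually_at_left_field k by auto
    have "g (fst p, t) = u" if "b + of_int k < t" "t < snd p" for t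
      using g[of "t - of_int k"] b(2)[of "t - of_int k"] that k by simp
    then show "germ_left g p u" unfolding germ_left_def eventually_at_left_field using b k by (intro exI[of _ "b + of_int k"]) simp
  next
    assume "germ_left g p u"
    then obtain b where b: "b < snd p" "\<And>t. b < t \<Longrightarrow> t < snd p \<Longrightarrow> g (fst p, t) = u"
      unfolding germ_left_def eventually_at_left_field by auto
    have "g (fst p, t) = u" if "b - of_int k < t" "t < snd q" for t
      using g[of t] b(2)[of "t + of_int k"] that k by simp
    then show "germ_left g q u" unfolding germ_left_def eventually_at_left_field using b k by (intro exI[of _ "b - of_int k"]) simp
  qed
  show "germ_right g q u \<longleftrightarrow> germ_right g p u"
  proof
    assume "germ_right g q u"
    then obtain b where b: "b > snd q" "\<And>t. b > t \<Longrightarrow> t > snd q \<Longrightarrow> g (fst p, t) = u"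
      unfolding germ_right_def eventually_at_right_field k by auto
    have "g (fst p, t) = u" if "b + of_int k > t" "t > snd p" for t
      using g[of "t - of_int k"] b(2)[of "t - of_int k"] that k by simp
    then show "germ_right g p u" unfolding germ_right_def eventually_at_right_field using b k by (intro exI[of _ "b + of_int k"]) simp
  next
    assume "germ_right g p u"
    then obtain b where b: "b > snd p" "\<And>t. b > t \<Longrightarrow> t > snd p \<Longrightarrow> g (fst p, t) = u"
      unfolding germ_right_def eventually_at_right_field by auto
    have "g (fst p, t) = u" if "b - of_int k > t" "t > snd q" for t
      using g[of t] b(2)[of "t + of_int k"] that k by simp
    then show "germ_right g q u" unfolding germ_right_def eventually_at_right_field using b k by (intro exI[of _ "b - of_int k"]) simp
  qed
qed

lemma compatible_at_regular:
  assumes "p \<in> regular_params K"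
  shows "compatible_at K s g p \<longleftrightarrow> germ_left g p (g p) \<and> germ_right g p (g p)"
proof -
  have "\<not> meet K p q" for q using assms meet_dpts unfolding regular_params_def by blast
  then show ?thesis using assms unfolding compatible_at_def by blast
qed

lemma compatible_at_meet:
  assumes D: "diagram K" and P: "periodic K g" and m: "meet K p q"
  shows "compatible_at K s g p \<longleftrightarrow>
     (s (pt K p) = Some Oriented \<longrightarrow> (\<exists>u. germ_left g p u \<and> germ_right g q u)) \<and>
     (s (pt K p) = Some Unoriented \<longrightarrow>
        (\<exists>u. germ_left g p u \<and> germ_left g q u) \<and> (\<exists>u. germ_right g p u \<and> germ_right g q u))"
    (is "_ \<longleftrightarrow> ?rhs q")
proof -
  have "p \<notin> regular_params K" using meet_dpts[OF m] unfolding regular_params_def by blast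
  moreover have "?rhs q' \<longleftrightarrow> ?rhs q" if "meet K p q'" for q'
  proof -
    have "same_param q q'" using D m that unfolding diagram_def by blast
    moreover have "q \<in> params K" using m unfolding meet_def by blast
    ultimately have "germ_left g q' u \<longleftrightarrow> germ_left g q u" "germ_right g q' u \<longleftrightarrow> germ_right g q u" for u
      using germ_same_param[OF P] by blast+
    then show ?thesis by simp
  qed
  ultimately show ?thesis using m unfolding compatible_at_def by blast
qed

lemma compatible_at_same_param:
  assumes D: "diagram K" and P: "periodic K g" and p: "p \<in> params K" and s: "same_param p q"
  shows "compatible_at K S g q \<longleftrightarrow> compatible_at K S g p"
proof (cases "p \<in> regular_params K")
  case True
  then have "q \<in> regular_params K" using regular_same_param[OF D s] by blast
  moreover have "g q = g p" using P p s unfolding periodic_def by metis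
  ultimately show ?thesis using compatible_at_regular True germ_same_param[OF P p s] by metis
next
  case False
  then obtain r where m: "meet K p r" using regular_or_meet[OF p _ D] by blast
  then have m': "meet K q r" using meet_same_param[OF D m s] by simp
  have "pt K q = pt K p" using pt_same_param[OF D p s] .
  then show ?thesis unfolding compatible_at_meet[OF D P m] compatible_at_meet[OF D P m'] germ_same_param[OF P p s] by simp
qed

locale square_braid =
  fixes K :: diagram_data and ss :: "strand list"
  assumes D: "diagram K" and B: "braid_in_square K ss"
begin

abbreviation \<rho> :: "nat \<Rightarrow> real \<Rightarrow> param" where "\<rho> j x \<equiv> at_abscissa K (ss ! j) x"

lemma strand_horizontal: "j < length ss \<Longrightarrow> horizontal_strand K (ss ! j)"
  using B unfolding braid_in_square_def by (metis nth_mem)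

lemma rho_facts:
  assumes "j < length ss" "x \<in> {-1..1}"
  shows "\<rho> j x \<in> params K" "Re (pt K (\<rho> j x)) = x" "\<bar>Im (pt K (\<rho> j x))\<bar> < 1" "pt K (\<rho> j x) \<in> square"
proof -
  obtain i a b where e: "ss ! j = (i, a, b)" by (cases "ss ! j")
  have h: "horizontal_strand K (i, a, b)" using strand_horizontal[OF assms(1)] e by simp
  show 1: "\<rho> j x \<in> params K" "Re (pt K (\<rho> j x)) = x" "\<bar>Im (pt K (\<rho> j x))\<bar> < 1"
    unfolding e using at_abscissa_param[OF D h assms(2)] by blast+
  show "pt K (\<rho> j x) \<in> square" using 1 assms unfolding square_def by auto
qed

lemma rho_strand: "j < length ss \<Longrightarrow> p \<in> strand_params (ss ! j) \<longleftrightarrow> (\<exists>x\<in>{-1..1}. same_param p (\<rho> j x))"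
  using strand_params_abscissa[OF D] strand_horizontal by (cases "ss ! j") metis

lemma rho_same:
  assumes j: "j < length ss" and k: "k < length ss" and x: "x \<in> {-1..1}" and y: "y \<in> {-1..1}"
    and s: "same_param (\<rho> j x) (\<rho> k y)"
  shows "j = k" "x = y"
proof -
  have in1: "\<rho> j x \<in> strand_params (ss ! j)" using rho_strand[OF j] x by (meson same_param_refl)
  have in2: "\<rho> j x \<in> strand_params (ss ! k)" using rho_strand[OF k] y s by blast
  have "strand_params (ss ! j) \<inter> strand_params (ss ! k) = {}" if "j \<noteq> k"
    using B that j k unfolding braid_in_square_def by (cases j k rule: linorder_cases) blast+
  then show "j = k" using in1 in2 by blast
  have "pt K (\<rho> k y) = pt K (\<rho> j x)" using pt_same_param[OF D rho_facts(1)[OF j x] s] .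
  then show "x = y" using rho_facts(2) j k x y by metis
qed

lemma square_params:
  assumes "p \<in> params K"
  shows "pt K p \<in> square \<longleftrightarrow> (\<exists>j<length ss. \<exists>x\<in>{-1..1}. same_param p (\<rho> j x))"
proof -
  have "pt K p \<in> square \<longleftrightarrow> (\<exists>s\<in>set ss. p \<in> strand_params s)"
    using B assms unfolding braid_in_square_def by blast
  then show ?thesis using rho_strand by (metis in_set_conv_nth)
qed

text \<open>
  A strand is a graph, so it meets only other strands, and only above the same abscissa.
\<close>

lemma rho_meet:
  assumes j: "j < length ss" and x: "x \<in> {-1..1}" and m: "meet K (\<rho> j x) q"
  obtains k where "k < length ss" "k \<noteq> j" "same_param q (\<rho> k x)" "meet K (\<rho> j x) (\<rho> k x)"
proof -
  have q: "q \<in> params K" "pt K q = pt K (\<rho> j x)" using m unfolding meet_def by auto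
  then obtain k y where ky: "k < length ss" "y \<in> {-1..1}" "same_param q (\<rho> k y)"
    using square_params[OF q(1)] rho_facts(4)[OF j x] by auto
  have "pt K (\<rho> k y) = pt K q" using pt_same_param[OF D q(1) ky(3)] .
  then have "y = x" using rho_facts(2) q ky j x by metis
  moreover have "k \<noteq> j" using m ky(3) same_param_sym calculation unfolding meet_def by blast
  ultimately show thesis using that ky meet_same_param[OF D m _ ky(3)] by simp
qed

lemma rho_dpts: "j < length ss \<Longrightarrow> x \<in> {-1..1} \<Longrightarrow> \<rho> j x \<notin> regular_params K \<Longrightarrow> pt K (\<rho> j x) \<in> dpts K \<inter> square"
  using rho_facts unfolding regular_params_def by blast

lemma rho_end_regular: "j < length ss \<Longrightarrow> x \<in> {-1..1} \<Longrightarrow> \<bar>x\<bar> = 1 \<Longrightarrow> \<rho> j x \<in> regular_params K"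
  using rho_dpts[of j x] rho_facts(2)[of j x] B unfolding braid_in_square_def by (metis less_irrefl)

lemma rho_germs:
  assumes "j < length ss"
  shows "rightward K (ss ! j) \<Longrightarrow> -1 < x \<Longrightarrow> x \<le> 1 \<Longrightarrow> germ_left g (\<rho> j x) u \<longleftrightarrow> germ_before K (ss ! j) g x u"
    "rightward K (ss ! j) \<Longrightarrow> -1 \<le> x \<Longrightarrow> x < 1 \<Longrightarrow> germ_right g (\<rho> j x) u \<longleftrightarrow> germ_beyond K (ss ! j) g x u"
    "\<not> rightward K (ss ! j) \<Longrightarrow> -1 < x \<Longrightarrow> x \<le> 1 \<Longrightarrow> germ_right g (\<rho> j x) u \<longleftrightarrow> germ_before K (ss ! j) g x u"
    "\<not> rightward K (ss ! j) \<Longrightarrow> -1 \<le> x \<Longrightarrow> x < 1 \<Longrightarrow> germ_left g (\<rho> j x) u \<longleftrightarrow> germ_beyond K (ss ! j) g x u"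
  using strand_germs[where g = g, OF D, of "fst (ss ! j)" "fst (snd (ss ! j))" "snd (snd (ss ! j))"] strand_horizontal[OF assms]
  unfolding germ_before_def germ_beyond_def by auto

lemma rho_compatible_regular:
  assumes j: "j < length ss" and x: "-1 < x" "x < 1" and r: "\<rho> j x \<in> regular_params K"
  shows "compatible_at K s g (\<rho> j x) \<longleftrightarrow>
    germ_before K (ss ! j) g x (g (\<rho> j x)) \<and> germ_beyond K (ss ! j) g x (g (\<rho> j x))"
  unfolding compatible_at_regular[OF r] using rho_germs[OF j, of x g] x
  by (cases "rightward K (ss ! j)") auto

text \<open>
  The four cases of orientations and the two smoothings reduce to one rule in terms of left and right.
\<close>

lemma rho_compatible_crossing:
  assumes P: "periodic K g" and j: "j < length ss" and k: "k < length ss" and x: "-1 < x" "x < 1"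
    and m: "meet K (\<rho> j x) (\<rho> k x)"
    and s: "s (pt K (\<rho> j x)) = Some (smoothing_of (rightward K (ss ! j) = rightward K (ss ! k)) h)"
  shows "compatible_at K s g (\<rho> j x) \<and> compatible_at K s g (\<rho> k x) \<longleftrightarrow>
    (if h then (\<exists>u. germ_before K (ss ! j) g x u \<and> germ_beyond K (ss ! k) g x u) \<and>
               (\<exists>u. germ_before K (ss ! k) g x u \<and> germ_beyond K (ss ! j) g x u)
     else (\<exists>u. germ_before K (ss ! j) g x u \<and> germ_before K (ss ! k) g x u) \<and>
          (\<exists>u. germ_beyond K (ss ! k) g x u \<and> germ_beyond K (ss ! j) g x u))"
proof -
  have m': "meet K (\<rho> k x) (\<rho> j x)" by (rule meet_sym[OF m])
  have e: "pt K (\<rho> k x) = pt K (\<rho> j x)" using m unfolding meet_def by simp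
  show ?thesis
    unfolding compatible_at_meet[OF D P m] compatible_at_meet[OF D P m'] e s smoothing_of_def
    using rho_germs[OF j, of x g] rho_germs[OF k, of x g] x
    by (cases "rightward K (ss ! j)"; cases "rightward K (ss ! k)"; cases h) auto
qed

lemma rho_segment:
  assumes L: "labelling K s g" and j: "j < length ss" and xy: "-1 \<le> x" "x \<le> y" "y \<le> 1"
    and r: "\<And>z. x \<le> z \<Longrightarrow> z \<le> y \<Longrightarrow> \<rho> j z \<in> regular_params K"
  shows "g (\<rho> j x) = g (\<rho> j y)"
proof -
  obtain i a b where e: "ss ! j = (i, a, b)" by (cases "ss ! j")
  have h: "horizontal_strand K (i, a, b)" using strand_horizontal[OF j] e by simp
  let ?t = "\<lambda>x. snd (at_abscissa K (i, a, b) x)"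
  have f: "\<rho> j z = (i, ?t z)" for z unfolding e at_abscissa_def by simp
  have "g (i, ?t x) = g (i, ?t y)"
  proof (rule labelling_const[OF L, of "min (?t x) (?t y)" "max (?t x) (?t y)"])
    fix t assume t: "t \<in> {min (?t x) (?t y)..max (?t x) (?t y)}"
    have "\<exists>z\<in>{x..y}. (i, t) = at_abscissa K (i, a, b) z"
      by (rule at_abscissa_between[OF D h]) (use t xy in auto)
    then show "(i, t) \<in> regular_params K" using r e by auto
  qed auto
  then show ?thesis using f by simp
qed

lemma outside_open:
  assumes "p \<in> params K" "pt K p \<notin> square"
  shows "\<forall>\<^sub>F t in at (snd p). pt K (fst p, t) \<notin> square"
proof -
  have i: "fst p < ncomp K" using assms(1) unfolding params_def by auto
  have "closed square"
    unfolding square_def by (intro closed_Collect_conj closed_Collect_le continuous_intros)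
  then have "open (- square)" by (rule open_Compl)
  moreover have "(curve K (fst p) \<longlongrightarrow> curve K (fst p) (snd p)) (at (snd p))"
    using curve_props(3)[OF D i] by (simp add: continuous_on_def)
  ultimately have "\<forall>\<^sub>F t in at (snd p). curve K (fst p) t \<in> - square"
    using topological_tendstoD assms(2) unfolding pt_def by (metis ComplI)
  then show ?thesis unfolding pt_def by simp
qed

lemma ends_leave:
  assumes "(i, a, b) \<in> set ss"
  shows "\<forall>\<^sub>F t in at_left a. pt K (i, t) \<notin> square" "\<forall>\<^sub>F t in at_right b. pt K (i, t) \<notin> square"
proof -
  have h: "horizontal_strand K (i, a, b)" using B assms unfolding braid_in_square_def by blast
  show "\<forall>\<^sub>F t in at_left a. pt K (i, t) \<notin> square" "\<forall>\<^sub>F t in at_right b. pt K (i, t) \<notin> square"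
    by (rule strand_leaves[OF D h])+
qed

text \<open>Labels inside and outside the square can be prescribed independently.\<close>

lemma glue_labels:
  obtains g where "\<And>p. p \<in> params K \<Longrightarrow> pt K p \<notin> square \<Longrightarrow> g p = g0 p"
    "\<And>p j x. j < length ss \<Longrightarrow> x \<in> {-1..1} \<Longrightarrow> same_param p (\<rho> j x) \<Longrightarrow> g p = v j x"
proof
  let ?P = "\<lambda>p jx. fst jx < length ss \<and> snd jx \<in> {-1..1::real} \<and> same_param p (\<rho> (fst jx) (snd jx))"
  let ?g = "\<lambda>p. if \<exists>jx. ?P p jx then (let jx = (SOME jx. ?P p jx) in v (fst jx) (snd jx)) else g0 p"
  show "?g p = g0 p" if "p \<in> params K" "pt K p \<notin> square" for p
  proof -
    have "\<not> (\<exists>jx. ?P p jx)" using square_params[OF that(1)] that(2) by blast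
    then show ?thesis by (rule if_not_P)
  qed
  show "?g p = v j x" if j: "j < length ss" "x \<in> {-1..1}" "same_param p (\<rho> j x)" for p j x
  proof -
    have ex: "\<exists>jx. ?P p jx" using j by (intro exI[of _ "(j, x)"]) simp
    define jx where "jx = (SOME jx. ?P p jx)"
    have P: "?P p jx" unfolding jx_def by (rule someI_ex[OF ex])
    then have "same_param (\<rho> (fst jx) (snd jx)) (\<rho> j x)" using j same_param_sym same_param_trans by blast
    then have "fst jx = j" "snd jx = x" using rho_same[of "fst jx" j "snd jx" x] P j by blast+
    moreover have "?g p = v (fst jx) (snd jx)" unfolding if_P[OF ex] jx_def Let_def ..
    ultimately show ?thesis by (simp only:)
  qed
qed

end

section \<open>Labels inside the square\<close>

text \<open>
  The conditions for a labelling that involve points outside the square only; at the ends of a strand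
  this is the side that lies outside.
\<close>

definition outer_labelling :: "diagram_data \<Rightarrow> strand list \<Rightarrow> smoothings \<Rightarrow> (param \<Rightarrow> 'a) \<Rightarrow> bool" where
  "outer_labelling K ss s g \<longleftrightarrow> periodic K g \<and>
     (\<forall>p\<in>params K. pt K p \<notin> square \<longrightarrow> compatible_at K s g p) \<and>
     (\<forall>(i, a, b)\<in>set ss. germ_left g (i, a) (g (i, a)) \<and> germ_right g (i, b) (g (i, b)))"

lemma compatible_at_const: "compatible_at K s (\<lambda>_. c) p"
  unfolding compatible_at_def germ_left_def germ_right_def by simp

lemma outer_labelling_const: "outer_labelling K ss s (\<lambda>_. c)"
  unfolding outer_labelling_def periodic_def germ_left_def germ_right_def by (simp add: compatible_at_const)

context square_braid
begin

lemma rho_ends: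
  assumes "j < length ss"
  shows "rightward K (ss ! j) \<Longrightarrow> \<rho> j (-1) = (fst (ss ! j), fst (snd (ss ! j))) \<and> \<rho> j 1 = (fst (ss ! j), snd (snd (ss ! j)))"
    "\<not> rightward K (ss ! j) \<Longrightarrow> \<rho> j (-1) = (fst (ss ! j), snd (snd (ss ! j))) \<and> \<rho> j 1 = (fst (ss ! j), fst (snd (ss ! j)))"
  using at_abscissa_ends[OF D, of "fst (ss ! j)" "fst (snd (ss ! j))" "snd (snd (ss ! j))"] strand_horizontal[OF assms]
  by auto

lemma germ_cong_outside:
  assumes p: "p \<in> params K" "pt K p \<notin> square"
    and e: "\<And>p. p \<in> params K \<Longrightarrow> pt K p \<notin> square \<Longrightarrow> g p = g0 p"
  shows "germ_left g p u \<longleftrightarrow> germ_left g0 p u" "germ_right g p u \<longleftrightarrow> germ_right g0 p u"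
proof -
  have "\<forall>\<^sub>F t in at (snd p). g (fst p, t) = g0 (fst p, t)"
    using outside_open[OF p]
  proof eventually_elim
    case (elim t)
    have "(fst p, t) \<in> params K" using p(1) unfolding params_def by auto
    then show ?case using e elim by blast
  qed
  then have l: "\<forall>\<^sub>F t in at_left (snd p). g (fst p, t) = g0 (fst p, t)"
    and r: "\<forall>\<^sub>F t in at_right (snd p). g (fst p, t) = g0 (fst p, t)"
    by (simp_all add: eventually_at_split)
  show "germ_left g p u \<longleftrightarrow> germ_left g0 p u"
    unfolding germ_left_def by (rule eventually_cong[OF l]) simp
  show "germ_right g p u \<longleftrightarrow> germ_right g0 p u"
    unfolding germ_right_def by (rule eventually_cong[OF r]) simp
qed

lemma compatible_cong_outside:
  assumes p: "p \<in> params K" "pt K p \<notin> square"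
    and e: "\<And>p. p \<in> params K \<Longrightarrow> pt K p \<notin> square \<Longrightarrow> g p = g0 p"
  shows "compatible_at K s g p \<longleftrightarrow> compatible_at K s g0 p"
proof -
  have "q \<in> params K \<and> pt K q \<notin> square" if "meet K p q" for q using that p unfolding meet_def by simp
  then have "germ_left g q u \<longleftrightarrow> germ_left g0 q u" "germ_right g q u \<longleftrightarrow> germ_right g0 q u" if "meet K p q" for q u
    using that germ_cong_outside[where g = g and ?g0.0 = g0, OF _ _ e] by blast+
  moreover have "g p = g0 p" using e p by blast
  moreover note germ_cong_outside[OF p e]
  ultimately show ?thesis unfolding compatible_at_def by (simp cong: conj_cong)
qed

lemma germ_cong_ends:
  assumes s: "(i, a, b) \<in> set ss"
    and e: "\<And>p. p \<in> params K \<Longrightarrow> pt K p \<notin> square \<Longrightarrow> g p = g0 p"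
  shows "germ_left g (i, a) u \<longleftrightarrow> germ_left g0 (i, a) u" "germ_right g (i, b) u \<longleftrightarrow> germ_right g0 (i, b) u"
proof -
  have "i < ncomp K" using B s unfolding braid_in_square_def by fastforce
  then have par: "(i, t) \<in> params K" for t unfolding params_def by simp
  have l: "\<forall>\<^sub>F t in at_left a. g (i, t) = g0 (i, t)"
    using ends_leave(1)[OF s] by eventually_elim (use e par in blast)
  have r: "\<forall>\<^sub>F t in at_right b. g (i, t) = g0 (i, t)"
    using ends_leave(2)[OF s] by eventually_elim (use e par in blast)
  show "germ_left g (i, a) u \<longleftrightarrow> germ_left g0 (i, a) u"
    unfolding germ_left_def fst_conv snd_conv by (rule eventually_cong[OF l]) simp
  show "germ_right g (i, b) u \<longleftrightarrow> germ_right g0 (i, b) u"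
    unfolding germ_right_def fst_conv snd_conv by (rule eventually_cong[OF r]) simp
qed

lemma strand_end_rho:
  assumes j: "j < length ss"
  shows "(fst (ss ! j), fst (snd (ss ! j))) \<in> {\<rho> j (-1), \<rho> j 1}" "(fst (ss ! j), snd (snd (ss ! j))) \<in> {\<rho> j (-1), \<rho> j 1}"
  using rho_ends[OF j] by (cases "rightward K (ss ! j)"; simp)+

lemma labelling_outer:
  assumes L: "labelling K s g"
  shows "outer_labelling K ss s g"
  unfolding outer_labelling_def
proof (intro conjI ballI)
  show "periodic K g" using L unfolding labelling_def by blast
  show "pt K p \<notin> square \<longrightarrow> compatible_at K s g p" if "p \<in> params K" for p using L that unfolding labelling_def by blast
  fix s' assume "s' \<in> set ss"
  then obtain j where j: "j < length ss" "s' = ss ! j" by (metis in_set_conv_nth)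
  have c: "germ_left g p (g p) \<and> germ_right g p (g p)" if "p \<in> {\<rho> j (-1), \<rho> j 1}" for p
  proof -
    have "p \<in> regular_params K" using that rho_end_regular[OF j(1)] by auto
    moreover have "p \<in> params K" using calculation unfolding regular_params_def by blast
    ultimately show ?thesis using L compatible_at_regular unfolding labelling_def by blast
  qed
  show "case s' of (i, a, b) \<Rightarrow> germ_left g (i, a) (g (i, a)) \<and> germ_right g (i, b) (g (i, b))"
    using c[OF strand_end_rho(1)[OF j(1)]] c[OF strand_end_rho(2)[OF j(1)]] j(2) by (simp add: case_prod_beta)
qed

lemma end_germs:
  assumes O: "outer_labelling K ss s g" and j: "j < length ss"
  shows "germ_beyond K (ss ! j) g (-1) (g (\<rho> j (-1))) \<Longrightarrow> compatible_at K s g (\<rho> j (-1))"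
    "germ_before K (ss ! j) g 1 (g (\<rho> j 1)) \<Longrightarrow> compatible_at K s g (\<rho> j 1)"
proof -
  have "(fst (ss ! j), fst (snd (ss ! j)), snd (snd (ss ! j))) \<in> set ss" using j by simp
  then have o: "germ_left g (fst (ss ! j), fst (snd (ss ! j))) (g (fst (ss ! j), fst (snd (ss ! j))))"
    "germ_right g (fst (ss ! j), snd (snd (ss ! j))) (g (fst (ss ! j), snd (snd (ss ! j))))"
    using O unfolding outer_labelling_def by blast+
  have r: "\<rho> j (-1) \<in> regular_params K" "\<rho> j 1 \<in> regular_params K" using rho_end_regular[OF j] by auto
  show "compatible_at K s g (\<rho> j (-1))" if "germ_beyond K (ss ! j) g (-1) (g (\<rho> j (-1)))"
    unfolding compatible_at_regular[OF r(1)]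
    using that o rho_ends[OF j] rho_germs(2,4)[OF j, of "-1" g] by (cases "rightward K (ss ! j)") auto
  show "compatible_at K s g (\<rho> j 1)" if "germ_before K (ss ! j) g 1 (g (\<rho> j 1))"
    unfolding compatible_at_regular[OF r(2)]
    using that o rho_ends[OF j] rho_germs(1,3)[OF j, of 1 g] by (cases "rightward K (ss ! j)") auto
qed

end

text \<open>
  The slabs are numbered from the left; a double point counts for the slab that ends there.
\<close>

definition slab :: "complex list \<Rightarrow> real \<Rightarrow> nat" where
  "slab cs x = card {k. k < length cs \<and> Re (cs ! k) < x}"

text \<open>
  A braid with double points \<open>cs\<close> from left to right that are smoothed by \<open>s\<close>.  The word \<open>W\<close> records
  which two strands meet in each of them, and whether the smoothing lets them pass.
\<close>

locale resolved_braid = square_braid +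
  fixes cs :: "complex list" and W :: "(nat \<times> nat \<times> bool) list" and s :: smoothings
  assumes len: "length W = length cs"
    and sorted: "sorted_wrt (<) (map Re cs)"
    and set_cs: "set cs = dpts K \<inter> square"
    and crossing: "\<And>k u v h. k < length cs \<Longrightarrow> W ! k = (u, v, h) \<Longrightarrow> u < length ss \<and> v < length ss \<and> u \<noteq> v \<and>
      strand_through K (ss ! u) (cs ! k) \<and> strand_through K (ss ! v) (cs ! k) \<and>
      s (cs ! k) = Some (smoothing_of (rightward K (ss ! u) = rightward K (ss ! v)) h)"
begin

abbreviation "n \<equiv> length cs"
abbreviation X :: "nat \<Rightarrow> real" where "X k \<equiv> Re (cs ! k)"

lemma X_bounds: "k < n \<Longrightarrow> -1 < X k \<and> X k < 1"
  using set_cs B unfolding braid_in_square_def by (metis abs_less_iff minus_less_iff nth_mem)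

lemma X_less_iff: "k < n \<Longrightarrow> m < n \<Longrightarrow> X k < X m \<longleftrightarrow> k < m"
proof -
  have lt: "X k < X m" if "k < m" "m < n" for k m
    using sorted_wrt_nth_less[OF sorted, of k m] that by simp
  show "X k < X m \<longleftrightarrow> k < m" if "k < n" "m < n"
    using lt[of k m] lt[of m k] that by (cases k m rule: linorder_cases) auto
qed

lemma X_eq_iff: "k < n \<Longrightarrow> m < n \<Longrightarrow> X k = X m \<longleftrightarrow> k = m"
  using X_less_iff by (metis less_irrefl linorder_cases)

lemma slab_X: "k < n \<Longrightarrow> slab cs (X k) = k"
proof -
  assume "k < n"
  then have "{m. m < n \<and> X m < X k} = {..<k}" using X_less_iff by auto
  then show ?thesis unfolding slab_def by simp
qed

lemma slab_mono: "x \<le> y \<Longrightarrow> slab cs x \<le> slab cs y"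
  unfolding slab_def by (rule card_mono) auto

lemma slab_le: "slab cs x \<le> n"
proof -
  have "card {k. k < n \<and> X k < x} \<le> card {..<n}" by (rule card_mono) auto
  then show ?thesis unfolding slab_def by simp
qed

lemma slab_ends: "slab cs (-1) = 0" "slab cs 1 = n"
proof -
  have "{k. k < n \<and> X k < -1} = {}" using X_bounds by force
  then show "slab cs (-1) = 0" unfolding slab_def by simp
  have "{k. k < n \<and> X k < 1} = {..<n}" using X_bounds by force
  then show "slab cs 1 = n" unfolding slab_def by simp
qed

lemma slab_left: "\<forall>\<^sub>F x in at_left x0. slab cs x = slab cs x0"
proof -
  have "\<forall>\<^sub>F x in at_left x0. \<forall>k\<in>{k. k < n \<and> X k < x0}. X k < x"
  proof (rule eventually_ball_finite)
    show "\<forall>k\<in>{k. k < n \<and> X k < x0}. \<forall>\<^sub>F x in at_left x0. X k < x"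
      unfolding eventually_at_left_field by blast
  qed simp
  moreover have "\<forall>\<^sub>F x in at_left x0. x < x0" unfolding eventually_at_left_field using lt_ex by blast
  ultimately show ?thesis
  proof eventually_elim
    case (elim x)
    then have "{k. k < n \<and> X k < x} = {k. k < n \<and> X k < x0}" by force
    then show ?case unfolding slab_def by simp
  qed
qed

lemma slab_right: "\<forall>\<^sub>F x in at_right x0. slab cs x = (if \<exists>k<n. X k = x0 then Suc (slab cs x0) else slab cs x0)"
proof -
  have "\<forall>\<^sub>F x in at_right x0. \<forall>k\<in>{k. k < n \<and> x0 < X k}. x < X k"
  proof (rule eventually_ball_finite)
    show "\<forall>k\<in>{k. k < n \<and> x0 < X k}. \<forall>\<^sub>F x in at_right x0. x < X k"
      unfolding eventually_at_right_field by blast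
  qed simp
  moreover have "\<forall>\<^sub>F x in at_right x0. x0 < x" unfolding eventually_at_right_field using gt_ex by blast
  ultimately show ?thesis
  proof eventually_elim
    case (elim x)
    then have e: "{k. k < n \<and> X k < x} = {k. k < n \<and> X k < x0} \<union> {k. k < n \<and> X k = x0}" by force
    have "{k. k < n \<and> X k = x0} = (if \<exists>k<n. X k = x0 then {THE k. k < n \<and> X k = x0} else {})"
    proof (cases "\<exists>k<n. X k = x0")
      case True
      then obtain k where k: "k < n" "X k = x0" by blast
      then have "(THE k. k < n \<and> X k = x0) = k" using X_eq_iff by blast
      then show ?thesis using k X_eq_iff by auto
    qed auto
    then have c: "card {k. k < n \<and> X k = x0} = (if \<exists>k<n. X k = x0 then 1 else 0)" by simp
    have "card {k. k < n \<and> X k < x} = card {k. k < n \<and> X k < x0} + card {k. k < n \<and> X k = x0}"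
      unfolding e by (rule card_Un_disjoint) auto
    then show ?case unfolding slab_def c by simp
  qed
qed

lemma slab_const: "slab cs x = slab cs y \<Longrightarrow> x \<le> X k \<Longrightarrow> X k < y \<Longrightarrow> k < n \<Longrightarrow> False"
proof -
  assume e: "slab cs x = slab cs y" and k: "x \<le> X k" "X k < y" "k < n"
  have "k \<in> {m. m < n \<and> X m < y}" "k \<notin> {m. m < n \<and> X m < x}" using k by auto
  moreover have "{m. m < n \<and> X m < x} \<subseteq> {m. m < n \<and> X m < y}" using k by auto
  ultimately have "{m. m < n \<and> X m < x} \<subset> {m. m < n \<and> X m < y}" by blast
  then have "slab cs x < slab cs y" unfolding slab_def by (intro psubset_card_mono) auto
  then show False using e by simp
qed

lemma crossing_point:
  assumes k: "k < n" and W: "W ! k = (u, v, h)"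
  shows "pt K (\<rho> u (X k)) = cs ! k" "pt K (\<rho> v (X k)) = cs ! k" "meet K (\<rho> u (X k)) (\<rho> v (X k))"
proof -
  note c = crossing[OF k W]
  have X: "X k \<in> {-1..1}" using X_bounds[OF k] by simp
  have p: "pt K (\<rho> j (X k)) = cs ! k" if j: "j < length ss" "strand_through K (ss ! j) (cs ! k)" for j
  proof -
    obtain p where p: "p \<in> strand_params (ss ! j)" "pt K p = cs ! k" using j(2) unfolding strand_through_def by blast
    then obtain x where x: "x \<in> {-1..1}" "same_param p (\<rho> j x)" using rho_strand[OF j(1)] by blast
    have "pt K p = pt K (\<rho> j x)"
      by (rule pt_same_param[OF D rho_facts(1)[OF j(1) x(1)] same_param_sym[OF x(2)]])
    then show ?thesis using rho_facts(2)[OF j(1) x(1)] p by simp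
  qed
  show 1: "pt K (\<rho> u (X k)) = cs ! k" "pt K (\<rho> v (X k)) = cs ! k" using p c by blast+
  have "\<not> same_param (\<rho> u (X k)) (\<rho> v (X k))" using rho_same(1)[OF _ _ X X] c by blast
  then show "meet K (\<rho> u (X k)) (\<rho> v (X k))" unfolding meet_def using 1 rho_facts(1)[OF _ X] c by simp
qed

lemma regular_iff:
  assumes j: "j < length ss" and x: "x \<in> {-1..1}"
  shows "\<rho> j x \<in> regular_params K \<longleftrightarrow> \<not> (\<exists>k<n. x = X k \<and> (j = fst (W ! k) \<or> j = fst (snd (W ! k))))"
proof -
  have "\<rho> j (X k) \<notin> regular_params K" if k: "k < n" "j = fst (W ! k) \<or> j = fst (snd (W ! k))" for k
  proof -
    have "pt K (\<rho> j (X k)) = cs ! k" using crossing_point(1,2)[OF k(1), of "fst (W ! k)" "fst (snd (W ! k))" "snd (snd (W ! k))"] k(2) by auto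
    then have "pt K (\<rho> j (X k)) \<in> dpts K" using set_cs k(1) nth_mem by (metis IntD1)
    then show ?thesis unfolding regular_params_def by blast
  qed
  moreover have "\<exists>k<n. x = X k \<and> (j = fst (W ! k) \<or> j = fst (snd (W ! k)))" if "\<rho> j x \<notin> regular_params K"
  proof -
    have "pt K (\<rho> j x) \<in> set cs" using rho_dpts[OF j x that] set_cs by blast
    then obtain k where k: "k < n" "pt K (\<rho> j x) = cs ! k" by (metis in_set_conv_nth)
    then have xk: "x = X k" using rho_facts(2)[OF j x] by simp
    obtain u v h where W: "W ! k = (u, v, h)" by (cases "W ! k")
    note c = crossing[OF k(1) W] and cp = crossing_point[OF k(1) W]
    have "j = v" if "j \<noteq> u"
    proof -
      have "\<not> same_param (\<rho> u x) (\<rho> j x)" using rho_same(1)[OF _ j x x] c that by metis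
      then have "meet K (\<rho> u x) (\<rho> j x)" unfolding meet_def using rho_facts(1)[OF _ x] c j k cp xk by simp
      then have "same_param (\<rho> v x) (\<rho> j x)" using cp(3) xk D unfolding diagram_def by blast
      then show ?thesis using rho_same(1)[OF _ j x x] c by metis
    qed
    then show ?thesis using W k(1) xk by (intro exI[of _ k]) auto
  qed
  ultimately show ?thesis by blast
qed

text \<open>
  The ends of the strands are included since they are what the inside and the outside share.
\<close>

definition outer_points :: "param set" where
  "outer_points = {p \<in> regular_params K. pt K p \<notin> square} \<union> (\<Union>j<length ss. {\<rho> j (-1), \<rho> j 1})"

lemma outer_points_regular: "outer_points \<subseteq> regular_params K"
  unfolding outer_points_def using rho_end_regular by auto

text \<open>
  Labels of the slabs and labels outside fit together to a labelling as soon as they agree at the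
  ends of the strands: a strand is regular inside a slab, and at the line between two slabs the
  conditions are those of the crossing there or, for the strands that do not take part in it, equality.
\<close>

lemma labelling_from_chain:
  assumes O: "outer_labelling K ss s g0" and C: "chain (length ss) W G"
    and E: "\<And>j. j < length ss \<Longrightarrow> G 0 j = g0 (\<rho> j (-1)) \<and> G n j = g0 (\<rho> j 1)"
  obtains g where "labelling K s g" "\<And>p. p \<in> outer_points \<Longrightarrow> g p = g0 p"
    "\<And>j x. j < length ss \<Longrightarrow> x \<in> {-1..1} \<Longrightarrow> g (\<rho> j x) = G (slab cs x) j"
proof -
  let ?v = "\<lambda>j x. G (slab cs x) j"
  obtain g where out: "\<And>p. p \<in> params K \<Longrightarrow> pt K p \<notin> square \<Longrightarrow> g p = g0 p"
    and ins: "\<And>p j x. j < length ss \<Longrightarrow> x \<in> {-1..1} \<Longrightarrow> same_param p (\<rho> j x) \<Longrightarrow> g p = G (slab cs x) j"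
    using glue_labels[of g0 ?v] by blast
  have rho: "g (\<rho> j x) = G (slab cs x) j" if "j < length ss" "x \<in> {-1..1}" for j x
    using ins[OF that] by simp
  have P0: "periodic K g0" using O unfolding outer_labelling_def by blast
  have P: "periodic K g" unfolding periodic_def
  proof (intro allI impI)
    fix p q assume a: "p \<in> params K \<and> same_param p q"
    then have q: "q \<in> params K" "pt K q = pt K p" using params_same_param pt_same_param[OF D] by blast+
    show "g p = g q"
    proof (cases "pt K p \<in> square")
      case True
      then obtain j x where jx: "j < length ss" "x \<in> {-1..1}" "same_param p (\<rho> j x)" using square_params a by blast
      then have "same_param q (\<rho> j x)" using a same_param_sym same_param_trans by blast
      then show ?thesis using ins[OF jx] ins[OF jx(1,2)] by metis
    next
      case False
      then show ?thesis using out a q P0 unfolding periodic_def by metis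
    qed
  qed
  have ends: "g (\<rho> j (-1)) = g0 (\<rho> j (-1))" "g (\<rho> j 1) = g0 (\<rho> j 1)" if "j < length ss" for j
    using rho[OF that] E[OF that] slab_ends by simp_all
  have O': "outer_labelling K ss s g"
    unfolding outer_labelling_def
  proof (intro conjI ballI impI)
    show "periodic K g" by (rule P)
    show "compatible_at K s g p" if "p \<in> params K" "pt K p \<notin> square" for p
    proof -
      have "compatible_at K s g0 p" using O that unfolding outer_labelling_def by blast
      moreover have "compatible_at K s g p = compatible_at K s g0 p"
        by (rule compatible_cong_outside[OF that]) (rule out)
      ultimately show ?thesis by simp
    qed
    fix s' assume s': "s' \<in> set ss"
    then obtain j where j: "j < length ss" "s' = ss ! j" by (metis in_set_conv_nth)
    obtain i a b where e: "s' = (i, a, b)" by (cases s')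
    have eq: "g p = g0 p" if "p \<in> {\<rho> j (-1), \<rho> j 1}" for p using that ends[OF j(1)] by auto
    have "fst (ss ! j) = i" "fst (snd (ss ! j)) = a" "snd (snd (ss ! j)) = b" using j(2)[symmetric] e by simp_all
    then have "g (i, a) = g0 (i, a)" "g (i, b) = g0 (i, b)"
      using eq[OF strand_end_rho(1)[OF j(1)]] eq[OF strand_end_rho(2)[OF j(1)]] by simp_all
    moreover have "germ_left g0 (i, a) (g0 (i, a))" "germ_right g0 (i, b) (g0 (i, b))"
      using O s' e unfolding outer_labelling_def by blast+
    ultimately show "case s' of (i, a, b) \<Rightarrow> germ_left g (i, a) (g (i, a)) \<and> germ_right g (i, b) (g (i, b))"
      using germ_cong_ends[OF s'[unfolded e], of g g0] out unfolding e by simp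
  qed
  have before: "germ_before K (ss ! j) g x (G (slab cs x) j)" if j: "j < length ss" and x: "-1 < x" "x \<le> 1" for j x
    unfolding germ_before_def
  proof -
    have "\<forall>\<^sub>F y in at_left x. -1 < y \<and> y < x" using x unfolding eventually_at_left_field by blast
    then show "\<forall>\<^sub>F y in at_left x. g (\<rho> j y) = G (slab cs x) j"
      using slab_left[of x] by eventually_elim (use rho[OF j] x in auto)
  qed
  have beyond: "germ_beyond K (ss ! j) g x (G (if \<exists>k<n. X k = x then Suc (slab cs x) else slab cs x) j)"
    if j: "j < length ss" and x: "-1 \<le> x" "x < 1" for j x
    unfolding germ_beyond_def
  proof -
    have "\<forall>\<^sub>F y in at_right x. x < y \<and> y < 1" using x unfolding eventually_at_right_field by blast
    then show "\<forall>\<^sub>F y in at_right x. g (\<rho> j y) = G (if \<exists>k<n. X k = x then Suc (slab cs x) else slab cs x) j"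
      using slab_right[of x] by eventually_elim (use rho[OF j] x in auto)
  qed
  have step: "crossing_step (length ss) (W ! k) (G k) (G (Suc k))" if "k < n" for k
    using C len that unfolding chain_def by simp
  have comp: "compatible_at K s g (\<rho> j x)" if j: "j < length ss" and x: "x \<in> {-1..1}" for j x
  proof -
    consider "x = -1" | "x = 1" | "-1 < x" "x < 1" using x by fastforce
    then show ?thesis
    proof cases
      case 1
      have nx: "\<not> (\<exists>k<n. X k = -1)" using X_bounds by force
      have "germ_beyond K (ss ! j) g (-1) (G (slab cs (-1)) j)"
        using beyond[OF j, of "-1"] unfolding if_not_P[OF nx] by simp
      then have "germ_beyond K (ss ! j) g (-1) (g (\<rho> j (-1)))" using rho[OF j, of "-1"] by simp
      then show ?thesis using end_germs(1)[OF O' j] 1 by simp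
    next
      case 2
      have "germ_before K (ss ! j) g 1 (g (\<rho> j 1))" using before[OF j, of 1] rho[OF j, of 1] by simp
      then show ?thesis using end_germs(2)[OF O' j] 2 by simp
    next
      case 3
      show ?thesis
      proof (cases "\<rho> j x \<in> regular_params K")
        case True
        have "G (if \<exists>k<n. X k = x then Suc (slab cs x) else slab cs x) j = G (slab cs x) j"
        proof (cases "\<exists>k<n. X k = x")
          case T: True
          then obtain k where k: "k < n" "X k = x" by blast
          obtain u v h where W: "W ! k = (u, v, h)" by (cases "W ! k")
          have "j \<noteq> u" "j \<noteq> v" using regular_iff[OF j x] True k W by auto
          then have "G (Suc k) j = G k j" using step[OF k(1)] j unfolding crossing_step_def W by simp
          then show ?thesis unfolding if_P[OF T] using slab_X[OF k(1)] k(2) by auto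
        next
          case F: False
          show ?thesis unfolding if_not_P[OF F] ..
        qed
        then show ?thesis
          unfolding rho_compatible_regular[OF j 3 True] using before[OF j 3(1)] beyond[OF j _ 3(2)] rho[OF j x] 3 by simp
      next
        case False
        then obtain k where k: "k < n" "x = X k" "j = fst (W ! k) \<or> j = fst (snd (W ! k))" using regular_iff[OF j x] by blast
        obtain u v h where W: "W ! k = (u, v, h)" by (cases "W ! k")
        note c = crossing[OF k(1) W] and cp = crossing_point[OF k(1) W]
        have sl: "slab cs x = k" "\<exists>k<n. X k = x" using slab_X[OF k(1)] k by auto
        have bf: "germ_before K (ss ! i) g x (G k i)" "germ_beyond K (ss ! i) g x (G (Suc k) i)" if "i < length ss" for i
          using before[OF that 3(1)] beyond[OF that _ 3(2)] 3 unfolding if_P[OF sl(2)] sl(1) by auto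
        have "compatible_at K s g (\<rho> u x) \<and> compatible_at K s g (\<rho> v x)"
        proof (subst rho_compatible_crossing[OF P])
          show "s (pt K (\<rho> u x)) = Some (smoothing_of (rightward K (ss ! u) = rightward K (ss ! v)) h)"
            using c cp(1) k(2) by simp
          show "meet K (\<rho> u x) (\<rho> v x)" using cp(3) k(2) by simp
          show "if h then (\<exists>a. germ_before K (ss ! u) g x a \<and> germ_beyond K (ss ! v) g x a) \<and>
                    (\<exists>a. germ_before K (ss ! v) g x a \<and> germ_beyond K (ss ! u) g x a)
               else (\<exists>a. germ_before K (ss ! u) g x a \<and> germ_before K (ss ! v) g x a) \<and>
                    (\<exists>a. germ_beyond K (ss ! v) g x a \<and> germ_beyond K (ss ! u) g x a)"
            using bf[of u] bf[of v] c step[OF k(1)] unfolding W crossing_step_def by (cases h) auto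
        qed (use c 3 in auto)
        then show ?thesis using k(3) W by auto
      qed
    qed
  qed
  have "labelling K s g" unfolding labelling_def
  proof (intro conjI ballI)
    show "periodic K g" by (rule P)
    fix p assume p: "p \<in> params K"
    show "compatible_at K s g p"
    proof (cases "pt K p \<in> square")
      case True
      then obtain j x where jx: "j < length ss" "x \<in> {-1..1}" "same_param p (\<rho> j x)" using square_params[OF p] by blast
      then show ?thesis using comp compatible_at_same_param[OF D P p] by blast
    next
      case False
      then show ?thesis using O' p unfolding outer_labelling_def by blast
    qed
  qed
  moreover have "g p = g0 p" if "p \<in> outer_points" for p
    using that out[of p] ends unfolding outer_points_def regular_params_def by auto
  ultimately show thesis using that rho by blast
qed

text \<open>
  A sample point in each slab.
\<close>

definition mid :: "nat \<Rightarrow> real" where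
  "mid k = ((if k = 0 then -1 else X (k - 1)) + (if k = n then 1 else X k)) / 2"

lemma mid_facts:
  assumes "k \<le> n"
  shows "-1 < mid k" "mid k < 1" "slab cs (mid k) = k" "\<And>m. m < n \<Longrightarrow> mid k \<noteq> X m"
proof -
  define l where "l = (if k = 0 then -1 else X (k - 1))"
  define r where "r = (if k = n then 1 else X k)"
  have lr: "l < r" "-1 \<le> l" "r \<le> 1"
    using assms X_bounds[of k] X_bounds[of "k - 1"] X_less_iff[of "k - 1" k]
    unfolding l_def r_def by (cases k; force)+
  have "mid k = (l + r) / 2" unfolding mid_def l_def r_def ..
  then have m: "l < mid k" "mid k < r" using lr by simp_all
  show "-1 < mid k" "mid k < 1" using m lr by linarith+
  have 1: "X i < mid k" if "i < k" for i
  proof (cases "i = k - 1")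
    case False
    then have "k - 1 < n" "i < k - 1" "i < n" using that assms by linarith+
    then have "X i < X (k - 1)" using X_less_iff by blast
    then show ?thesis using m(1)[unfolded l_def] that by simp
  qed (use m(1)[unfolded l_def] that in simp)
  have 2: "mid k < X i" if "k \<le> i" "i < n" for i
  proof (cases "i = k")
    case False
    then have "X k < X i" using X_less_iff[of k i] that by simp
    then show ?thesis using m(2)[unfolded r_def] that by simp
  qed (use m(2)[unfolded r_def] that in simp)
  have "i < n \<and> X i < mid k \<longleftrightarrow> i < k" for i using 1[of i] 2[of i] assms by (cases "i < k") auto
  then show "slab cs (mid k) = k" unfolding slab_def by simp
  show "mid k \<noteq> X i" if "i < n" for i using 1[of i] 2[of i] that by (cases "i < k") auto
qed

lemma slab_value:
  assumes L: "labelling K s g" and j: "j < length ss" and x: "x \<in> {-1..1}" and y: "y \<in> {-1..1}"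
    and e: "slab cs x = slab cs y" and r: "\<rho> j x \<in> regular_params K" "\<rho> j y \<in> regular_params K"
  shows "g (\<rho> j x) = g (\<rho> j y)"
proof -
  have w: "g (\<rho> j x) = g (\<rho> j y)" if xy: "x \<le> y" "-1 \<le> x" "y \<le> 1" "slab cs x = slab cs y" "\<rho> j y \<in> regular_params K" for x y
  proof (rule rho_segment[OF L j xy(2,1,3)])
    fix z assume z: "x \<le> z" "z \<le> y"
    show "\<rho> j z \<in> regular_params K"
    proof (cases "z = y")
      case False
      then have "\<not> (\<exists>k<n. z = X k)" using slab_const[OF xy(4)] z by force
      then show ?thesis using regular_iff[OF j] z xy by auto
    qed (use xy in simp)
  qed
  show ?thesis
  proof (cases "x \<le> y")
    case True
    show ?thesis by (rule w[OF True _ _ e r(2)]) (use x y in simp_all)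
  next
    case False
    have "g (\<rho> j y) = g (\<rho> j x)" by (rule w[OF _ _ _ e[symmetric] r(1)]) (use False x y in simp_all)
    then show ?thesis by (rule sym)
  qed
qed

lemma mid_regular: "j < length ss \<Longrightarrow> k \<le> n \<Longrightarrow> \<rho> j (mid k) \<in> regular_params K"
  using regular_iff[of j "mid k"] mid_facts[of k] by auto

text \<open>
  Conversely a labelling is constant on every strand within a slab, and its values there form a chain.
\<close>

lemma chain_from_labelling:
  assumes L: "labelling K s g"
  defines "G k j \<equiv> g (\<rho> j (mid k))"
  shows "chain (length ss) W G"
    and "\<And>j. j < length ss \<Longrightarrow> G 0 j = g (\<rho> j (-1)) \<and> G n j = g (\<rho> j 1)"
    and "\<And>j x. j < length ss \<Longrightarrow> x \<in> {-1..1} \<Longrightarrow> \<rho> j x \<in> regular_params K \<Longrightarrow> g (\<rho> j x) = G (slab cs x) j"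
proof -
  show val: "g (\<rho> j x) = G (slab cs x) j" if "j < length ss" "x \<in> {-1..1}" "\<rho> j x \<in> regular_params K" for j x
    unfolding G_def
  proof (rule slab_value[OF L that(1,2)])
    show "mid (slab cs x) \<in> {-1..1}" "slab cs x = slab cs (mid (slab cs x))"
      using mid_facts(1-3)[OF slab_le[of x]] by simp_all
    show "\<rho> j (mid (slab cs x)) \<in> regular_params K" by (rule mid_regular[OF that(1) slab_le])
  qed (rule that(3))
  show "G 0 j = g (\<rho> j (-1)) \<and> G n j = g (\<rho> j 1)" if "j < length ss" for j
    using val[OF that _ rho_end_regular[OF that], of "-1"] val[OF that _ rho_end_regular[OF that], of 1]
    by (simp add: slab_ends)
  have P: "periodic K g" using L unfolding labelling_def by blast
  have before: "germ_before K (ss ! j) g (X k) (G k j)" if j: "j < length ss" and k: "k < n" for j k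
    unfolding germ_before_def
  proof -
    have "\<forall>\<^sub>F y in at_left (X k). -1 < y \<and> y < X k" using X_bounds[OF k] unfolding eventually_at_left_field by blast
    then show "\<forall>\<^sub>F y in at_left (X k). g (\<rho> j y) = G k j"
      using slab_left[of "X k"]
    proof eventually_elim
      case (elim y)
      have "y \<noteq> X m" if "m < n" for m using elim slab_X[OF that] slab_X[OF k] by auto
      then have "\<rho> j y \<in> regular_params K" using regular_iff[OF j] elim X_bounds[OF k] by auto
      then show ?case using val[OF j] elim slab_X[OF k] X_bounds[OF k] by auto
    qed
  qed
  have beyond: "germ_beyond K (ss ! j) g (X k) (G (Suc k) j)" if j: "j < length ss" and k: "k < n" for j k
    unfolding germ_beyond_def
  proof -
    have "\<forall>\<^sub>F y in at_right (X k). X k < y \<and> y < mid (Suc k)"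
    proof -
      have "X k < mid (Suc k)"
        using slab_mono[of "mid (Suc k)" "X k"] mid_facts(3)[of "Suc k"] slab_X[OF k] k by fastforce
      then show ?thesis unfolding eventually_at_right_field by blast
    qed
    then show "\<forall>\<^sub>F y in at_right (X k). g (\<rho> j y) = G (Suc k) j"
      using slab_right[of "X k"]
    proof eventually_elim
      case (elim y)
      have sl: "slab cs y = Suc k" using elim k slab_X[OF k] by auto
      have m: "-1 < X k" "mid (Suc k) < 1" "slab cs (mid (Suc k)) = Suc k"
        using X_bounds[OF k] mid_facts[of "Suc k"] k by auto
      have "y \<noteq> X m" if "m < n" for m
        using slab_const[of y "mid (Suc k)" m] sl m elim that by auto
      then have "\<rho> j y \<in> regular_params K" using regular_iff[OF j] elim m by auto
      then show ?case using val[OF j, of y] elim sl m by auto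
    qed
  qed
  show "chain (length ss) W G" unfolding chain_def
  proof (intro allI impI)
    fix k assume "k < length W"
    then have k: "k < n" using len by simp
    obtain u v h where W: "W ! k = (u, v, h)" by (cases "W ! k")
    note c = crossing[OF k W] and cp = crossing_point[OF k W]
    have Xk: "-1 < X k" "X k < 1" using X_bounds[OF k] by auto
    have other: "G (Suc k) j = G k j" if j: "j < length ss" "j \<noteq> u" "j \<noteq> v" for j
    proof -
      have x: "X k \<in> {-1..1}" using Xk by simp
      have r: "\<rho> j (X k) \<in> regular_params K"
        unfolding regular_iff[OF j(1) x]
      proof
        assume "\<exists>m<n. X k = X m \<and> (j = fst (W ! m) \<or> j = fst (snd (W ! m)))"
        then obtain m where m: "m < n" "X k = X m" "j = fst (W ! m) \<or> j = fst (snd (W ! m))" by blast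
        have "m = k" using X_eq_iff[OF k m(1)] m(2) by simp
        then show False using m(3) j W by simp
      qed
      have "compatible_at K s g (\<rho> j (X k))" using L rho_facts(1)[OF j(1) x] unfolding labelling_def by blast
      then have b: "germ_before K (ss ! j) g (X k) (g (\<rho> j (X k)))" "germ_beyond K (ss ! j) g (X k) (g (\<rho> j (X k)))"
        unfolding rho_compatible_regular[OF j(1) Xk r] by auto
      have "G k j = g (\<rho> j (X k))" "G (Suc k) j = g (\<rho> j (X k))"
        using germ_before_unique[OF before[OF j(1) k] b(1)] germ_beyond_unique[OF beyond[OF j(1) k] b(2)] .
      then show ?thesis by (simp only:)
    qed
    have "compatible_at K s g (\<rho> u (X k)) \<and> compatible_at K s g (\<rho> v (X k))"
      using L cp(3) unfolding labelling_def meet_def by blast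
    moreover have "s (pt K (\<rho> u (X k))) = Some (smoothing_of (rightward K (ss ! u) = rightward K (ss ! v)) h)"
      using c cp(1) by simp
    ultimately have e: "if h then (\<exists>a. germ_before K (ss ! u) g (X k) a \<and> germ_beyond K (ss ! v) g (X k) a) \<and>
               (\<exists>a. germ_before K (ss ! v) g (X k) a \<and> germ_beyond K (ss ! u) g (X k) a)
     else (\<exists>a. germ_before K (ss ! u) g (X k) a \<and> germ_before K (ss ! v) g (X k) a) \<and>
          (\<exists>a. germ_beyond K (ss ! v) g (X k) a \<and> germ_beyond K (ss ! u) g (X k) a)"
      using rho_compatible_crossing[OF P _ _ Xk cp(3)] c by blast
    have uv: "u < length ss" "v < length ss" using c by auto
    note bu = germ_before_unique[OF before[OF uv(1) k]] germ_before_unique[OF before[OF uv(2) k]]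
      germ_beyond_unique[OF beyond[OF uv(1) k]] germ_beyond_unique[OF beyond[OF uv(2) k]]
    show "crossing_step (length ss) (W ! k) (G k) (G (Suc k))"
      unfolding W crossing_step_def prod.case
    proof (intro conjI allI impI)
      fix j assume "j < length ss" "j \<noteq> u \<and> j \<noteq> v"
      then show "G (Suc k) j = G k j" using other by blast
    next
      show "if h then G (Suc k) u = G k v \<and> G (Suc k) v = G k u else G k u = G k v \<and> G (Suc k) u = G (Suc k) v"
      proof (cases h)
        case True
        then obtain a b where ab: "germ_before K (ss ! u) g (X k) a" "germ_beyond K (ss ! v) g (X k) a"
          "germ_before K (ss ! v) g (X k) b" "germ_beyond K (ss ! u) g (X k) b" using e by auto
        have "G k u = a" "G (Suc k) v = a" "G k v = b" "G (Suc k) u = b"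
          using bu(1)[OF ab(1)] bu(4)[OF ab(2)] bu(2)[OF ab(3)] bu(3)[OF ab(4)] .
        then show ?thesis using True by simp
      next
        case False
        then obtain a b where ab: "germ_before K (ss ! u) g (X k) a" "germ_before K (ss ! v) g (X k) a"
          "germ_beyond K (ss ! v) g (X k) b" "germ_beyond K (ss ! u) g (X k) b" using e by auto
        have "G k u = a" "G k v = a" "G (Suc k) v = b" "G (Suc k) u = b"
          using bu(1)[OF ab(1)] bu(2)[OF ab(2)] bu(4)[OF ab(3)] bu(3)[OF ab(4)] .
        then show ?thesis using False by simp
      qed
    qed
  qed
qed

end

section \<open>Tangles with two or three crossings\<close>

definition boundary_labels :: "nat \<Rightarrow> (nat \<times> nat \<times> bool) list \<Rightarrow> (nat \<Rightarrow> nat \<Rightarrow> 'a) \<Rightarrow> 'a set" where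
  "boundary_labels N W G = (\<Union>i<N. {G 0 i, G (length W) i})"

text \<open>
  No component of the smoothed braid is closed: every label occurs at an end.
\<close>

definition loopless :: "nat \<Rightarrow> (nat \<times> nat \<times> bool) list \<Rightarrow> 'a itself \<Rightarrow> bool" where
  "loopless N W T \<longleftrightarrow> (\<forall>G :: nat \<Rightarrow> nat \<Rightarrow> 'a. chain N W G \<longrightarrow>
     (\<forall>k\<le>length W. \<forall>j<N. G k j \<in> boundary_labels N W G))"

text \<open>
  Exactly one component is closed.  The chain of truth values singles it out, which shows that its label is
  not forced to occur at an end.
\<close>

definition one_loop :: "nat \<Rightarrow> (nat \<times> nat \<times> bool) list \<Rightarrow> 'a itself \<Rightarrow> bool" where
  "one_loop N W T \<longleftrightarrow> (\<exists>k0\<le>length W. \<exists>j0<N.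
     (\<forall>G :: nat \<Rightarrow> nat \<Rightarrow> 'a. chain N W G \<longrightarrow>
       (\<forall>k\<le>length W. \<forall>j<N. G k j = G k0 j0 \<or> G k j \<in> boundary_labels N W G)) \<and>
     (\<exists>G :: nat \<Rightarrow> nat \<Rightarrow> bool. chain N W G \<and> G k0 j0 \<and> True \<notin> boundary_labels N W G))"

lemma All_le_Suc: "(\<forall>k\<le>Suc n. P k) \<longleftrightarrow> P (Suc n) \<and> (\<forall>k\<le>n. P k)"
  by (auto simp: le_Suc_eq)

lemmas expand = numeral_2_eq_2 numeral_3_eq_3 All_less_Suc All_le_Suc lessThan_Suc

lemma chain_Nil: "chain N [] G"
  by (simp add: chain_def)

lemmas chain_expand = chain_Cons chain_Nil crossing_step_def boundary_labels_def expand

lemma loopless_2: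
  "loopless 2 [] TYPE('a)"
  "a \<or> b \<Longrightarrow> loopless 2 [(0, 1, a), (0, 1, b)] TYPE('a)"
proof -
  show "loopless 2 [] TYPE('a)" by (simp add: loopless_def chain_expand)
  show "loopless 2 [(0, 1, a), (0, 1, b)] TYPE('a)" if "a \<or> b"
    using that by (cases a; cases b; simp add: loopless_def chain_expand)
qed

lemma one_loopI:
  assumes "k0 \<le> length W" "j0 < N"
    and "\<forall>G :: nat \<Rightarrow> nat \<Rightarrow> 'a. chain N W G \<longrightarrow>
       (\<forall>k\<le>length W. \<forall>j<N. G k j = G k0 j0 \<or> G k j \<in> boundary_labels N W G)"
    and "chain N W G1 \<and> G1 k0 j0 \<and> True \<notin> boundary_labels N W G1"
  shows "one_loop N W TYPE('a)"
  unfolding one_loop_def using assms by (intro exI[of _ k0] exI[of _ j0] conjI exI[of _ G1]) simp_all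

lemma one_loop_2: "one_loop 2 [(0, 1, False), (0, 1, False)] TYPE('a)"
  by (rule one_loopI[of 1 _ 0 _ "\<lambda>k j. k = 1"]) (simp_all add: chain_expand)

lemma loopless_3:
  "loopless 3 [(0, 1, True), (0, 2, True), (1, 2, True)] TYPE('a)"
  "loopless 3 [(0, 1, True), (0, 2, True), (1, 2, False)] TYPE('a)"
  "loopless 3 [(0, 1, True), (0, 2, False), (1, 2, True)] TYPE('a)"
  "loopless 3 [(0, 1, True), (0, 2, False), (1, 2, False)] TYPE('a)"
  "loopless 3 [(0, 1, False), (0, 2, True), (1, 2, True)] TYPE('a)"
  "loopless 3 [(0, 1, False), (0, 2, False), (1, 2, True)] TYPE('a)"
  "loopless 3 [(0, 1, False), (0, 2, False), (1, 2, False)] TYPE('a)"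
  "loopless 3 [(1, 2, True), (0, 2, True), (0, 1, True)] TYPE('a)"
  "loopless 3 [(1, 2, True), (0, 2, True), (0, 1, False)] TYPE('a)"
  "loopless 3 [(1, 2, True), (0, 2, False), (0, 1, True)] TYPE('a)"
  "loopless 3 [(1, 2, True), (0, 2, False), (0, 1, False)] TYPE('a)"
  "loopless 3 [(1, 2, False), (0, 2, True), (0, 1, True)] TYPE('a)"
  "loopless 3 [(1, 2, False), (0, 2, False), (0, 1, True)] TYPE('a)"
  "loopless 3 [(1, 2, False), (0, 2, False), (0, 1, False)] TYPE('a)"
  unfolding loopless_def
  by (intro allI impI, simp (no_asm_use) add: chain_expand, elim conjE less_SucE le_SucE; simp)+

lemma one_loop_3:
  "one_loop 3 [(0, 1, False), (0, 2, True), (1, 2, False)] TYPE('a)"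
  "one_loop 3 [(1, 2, False), (0, 2, True), (0, 1, False)] TYPE('a)"
  by (rule one_loopI[of 1 _ 1 _ "\<lambda>k j. (k, j) \<in> {(1, 0), (1, 1), (2, 2), (2, 1)}"]; simp add: chain_expand)
     (rule one_loopI[of 1 _ 1 _ "\<lambda>k j. (k, j) \<in> {(1, 2), (1, 1), (2, 0), (2, 1)}"]; simp add: chain_expand)

text \<open>
  Two words with the same Temperley-Lieb diagram up to closed components.
\<close>

definition same_tangle :: "nat \<Rightarrow> (nat \<times> nat \<times> bool) list \<Rightarrow> (nat \<times> nat \<times> bool) list \<Rightarrow> 'a itself \<Rightarrow> bool" where
  "same_tangle N W W' T \<longleftrightarrow> (\<forall>L R :: nat \<Rightarrow> 'a. tangle N W L R \<longleftrightarrow> tangle N W' L R)"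

lemma same_tangle_2:
  "same_tangle 2 [(0, 1, True), (0, 1, True)] [] TYPE('a)"
  "same_tangle 2 [(0, 1, True), (0, 1, False)] [(0, 1, False), (0, 1, False)] TYPE('a)"
  "same_tangle 2 [(0, 1, False), (0, 1, True)] [(0, 1, False), (0, 1, False)] TYPE('a)"
  by (auto simp: same_tangle_def expand)

text \<open>
  The eleven coincidences behind the moves on three strands.  Both words have the same identity
  diagram; each of the two turns that occur once on one side arises in four ways on the other side; the two products of
  turns correspond to each other.
\<close>

lemma same_tangle_3:
  "same_tangle 3 [(1, 2, True), (0, 2, True), (0, 1, True)] [(0, 1, True), (0, 2, True), (1, 2, True)] TYPE('a)"
  "same_tangle 3 [(0, 1, False), (0, 2, True), (1, 2, True)] [(1, 2, True), (0, 2, False), (0, 1, True)] TYPE('a)"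
  "same_tangle 3 [(0, 1, True), (0, 2, True), (1, 2, False)] [(1, 2, True), (0, 2, False), (0, 1, True)] TYPE('a)"
  "same_tangle 3 [(0, 1, False), (0, 2, True), (1, 2, False)] [(1, 2, True), (0, 2, False), (0, 1, True)] TYPE('a)"
  "same_tangle 3 [(0, 1, False), (0, 2, False), (1, 2, False)] [(1, 2, True), (0, 2, False), (0, 1, True)] TYPE('a)"
  "same_tangle 3 [(1, 2, False), (0, 2, True), (0, 1, True)] [(0, 1, True), (0, 2, False), (1, 2, True)] TYPE('a)"
  "same_tangle 3 [(1, 2, True), (0, 2, True), (0, 1, False)] [(0, 1, True), (0, 2, False), (1, 2, True)] TYPE('a)"
  "same_tangle 3 [(1, 2, False), (0, 2, True), (0, 1, False)] [(0, 1, True), (0, 2, False), (1, 2, True)] TYPE('a)"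
  "same_tangle 3 [(1, 2, False), (0, 2, False), (0, 1, False)] [(0, 1, True), (0, 2, False), (1, 2, True)] TYPE('a)"
  "same_tangle 3 [(0, 1, False), (0, 2, False), (1, 2, True)] [(1, 2, True), (0, 2, False), (0, 1, False)] TYPE('a)"
  "same_tangle 3 [(0, 1, True), (0, 2, False), (1, 2, False)] [(1, 2, False), (0, 2, False), (0, 1, True)] TYPE('a)"
  by (simp_all add: same_tangle_def expand)

section \<open>Counting the circles\<close>

lemma unlink_value_Suc: "m \<ge> 1 \<Longrightarrow> unlink_value (Suc m) = d_val * unlink_value m"
  by (cases m) auto

context resolved_braid
begin

lemma outer_points_ends: "j < length ss \<Longrightarrow> \<rho> j (-1) \<in> outer_points \<and> \<rho> j 1 \<in> outer_points"
  unfolding outer_points_def by blast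

lemma circles_decompose:
  fixes q G
  defines "q \<equiv> circle_of K s" and "G \<equiv> \<lambda>k j. circle_of K s (\<rho> j (mid k))"
  shows "circles K s = q ` outer_points \<union> {G k j | k j. k \<le> n \<and> j < length ss}"
    and "chain (length ss) W G"
    and "boundary_labels (length ss) W G \<subseteq> q ` outer_points"
proof -
  have L: "labelling K s q" unfolding q_def by (rule labelling_circle_of[OF D])
  note ch = chain_from_labelling[OF L]
  show "chain (length ss) W G" using ch(1) unfolding G_def q_def .
  show "boundary_labels (length ss) W G \<subseteq> q ` outer_points"
    using ch(2) outer_points_ends unfolding boundary_labels_def G_def q_def len by auto
  show "circles K s = q ` outer_points \<union> {G k j | k j. k \<le> n \<and> j < length ss}"
  proof (intro equalityI subsetI)
    fix c assume "c \<in> circles K s"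
    then obtain p where p: "p \<in> regular_params K" "c = q p" unfolding circles_eq q_def by blast
    then have par: "p \<in> params K" unfolding regular_params_def by blast
    show "c \<in> q ` outer_points \<union> {G k j | k j. k \<le> n \<and> j < length ss}"
    proof (cases "pt K p \<in> square")
      case True
      then obtain j x where jx: "j < length ss" "x \<in> {-1..1}" "same_param p (\<rho> j x)" using square_params[OF par] by blast
      then have r: "\<rho> j x \<in> regular_params K" using regular_same_param[OF D] p by blast
      have "c = q (\<rho> j x)" using L par jx p unfolding labelling_def periodic_def by blast
      also have "\<dots> = G (slab cs x) j" using ch(3)[OF jx(1,2) r] unfolding G_def q_def .
      finally show ?thesis using slab_le jx(1) by blast
    next
      case False
      then show ?thesis using p unfolding outer_points_def by blast
    qed
  next
    fix c assume "c \<in> q ` outer_points \<union> {G k j | k j. k \<le> n \<and> j < length ss}"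
    then show "c \<in> circles K s"
      using outer_points_regular mid_regular unfolding circles_eq q_def G_def by blast
  qed
qed

lemma circles_loopless:
  assumes "loopless (length ss) W TYPE(param set)"
  shows "circles K s = circle_of K s ` outer_points"
  using circles_decompose assms unfolding loopless_def len by blast

text \<open>
  The circle inside differs from the outer ones because some labelling separates it from them: the one
  that is true on it and false elsewhere.
\<close>

lemma circles_one_loop:
  assumes A: "one_loop (length ss) W TYPE(param set)"
  shows "\<exists>l. l \<notin> circle_of K s ` outer_points \<and> circles K s = insert l (circle_of K s ` outer_points)"
proof -
  define G where "G k j = circle_of K s (\<rho> j (mid k))" for k j
  note dec = circles_decompose[folded G_def]
  obtain k0 j0 G1 where k0: "k0 \<le> n" "j0 < length ss"
    and all: "\<forall>G :: nat \<Rightarrow> nat \<Rightarrow> param set. chain (length ss) W G \<longrightarrow>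
       (\<forall>k\<le>n. \<forall>j<length ss. G k j = G k0 j0 \<or> G k j \<in> boundary_labels (length ss) W G)"
    and G1: "chain (length ss) W G1" "G1 k0 j0" "True \<notin> boundary_labels (length ss) W G1"
    using A unfolding one_loop_def len by (elim exE conjE) (rule that; assumption)
  let ?Q = "circle_of K s ` outer_points"
  have eq: "circles K s = insert (G k0 j0) ?Q"
  proof -
    have "G k j \<in> insert (G k0 j0) ?Q" if "k \<le> n" "j < length ss" for k j
    proof -
      have "G k j = G k0 j0 \<or> G k j \<in> boundary_labels (length ss) W G" using all[rule_format, OF dec(2)] that by simp
      then show ?thesis using dec(3) by (elim disjE) auto
    qed
    then have "{G k j | k j. k \<le> n \<and> j < length ss} \<subseteq> insert (G k0 j0) ?Q" by auto
    moreover have "G k0 j0 \<in> {G k j | k j. k \<le> n \<and> j < length ss}" using k0 by (intro CollectI exI conjI) (rule refl)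
    moreover have "A \<union> S = insert l A" if "S \<subseteq> insert l A" "l \<in> S" for A S and l :: "param set" using that by blast
    ultimately show ?thesis unfolding dec(1) by simp
  qed
  have "G k0 j0 \<notin> ?Q"
  proof
    assume "G k0 j0 \<in> ?Q"
    then obtain p where p: "p \<in> outer_points" "circle_of K s (\<rho> j0 (mid k0)) = circle_of K s p"
      unfolding G_def by blast
    have "G1 0 j = False \<and> G1 n j = False" if "j < length ss" for j
      using G1(3) that unfolding boundary_labels_def len by auto
    then obtain g where g: "labelling K s g" "\<And>p. p \<in> outer_points \<Longrightarrow> g p = False"
      "\<And>j x. j < length ss \<Longrightarrow> x \<in> {-1..1} \<Longrightarrow> g (\<rho> j x) = G1 (slab cs x) j"
      using labelling_from_chain[OF outer_labelling_const[where c = False] G1(1)] by blast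
    have "g (\<rho> j0 (mid k0)) = g p"
      by (rule labelling_factors[OF g(1) p(2) mid_regular[OF k0(2,1)]]) (use p outer_points_regular in blast)
    moreover have "g (\<rho> j0 (mid k0)) = G1 k0 j0" using g(3)[OF k0(2)] mid_facts(1-3)[OF k0(1)] by simp
    ultimately show False using g(2)[OF p(1)] G1(2) by simp
  qed
  then show ?thesis using eq by blast
qed

text \<open>The value that the end labels alone would give.\<close>

definition outer_value :: bracket_poly where
  "outer_value = unlink_value (card (circle_of K s ` outer_points))"

lemma value_loopless:
  assumes "dom s = dpts K" "loopless (length ss) W TYPE(param set)"
  shows "value_at K s = outer_value"
  using value_at_total[OF D assms(1)] circles_loopless[OF assms(2)] unfolding outer_value_def by simp

lemma value_one_loop:
  assumes s: "dom s = dpts K" and W: "one_loop (length ss) W TYPE(param set)"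
  shows "value_at K s = d_val * outer_value"
proof -
  let ?Q = "circle_of K s ` outer_points"
  obtain l where l: "l \<notin> ?Q" "circles K s = insert l ?Q" using circles_one_loop[OF W] by blast
  have fin: "finite ?Q" using finite_circles[OF D, of s] l(2) s by simp
  have "length ss \<noteq> 0" using W unfolding one_loop_def by auto
  then have "?Q \<noteq> {}" using outer_points_ends[of 0] by blast
  then have "card ?Q \<ge> 1" using fin by (simp add: Suc_leI card_gt_0_iff)
  then show ?thesis
    using value_at_total[OF D s] l fin unlink_value_Suc unfolding outer_value_def by simp
qed

end

section \<open>Two diagrams that differ in the square only\<close>

lemma local_change_sym: "local_change K K' ss \<Longrightarrow> local_change K' K ss"
  unfolding local_change_def params_def by auto

locale local_move = square_braid K ss for K ss +
  fixes K' :: diagram_data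
  assumes D': "diagram K'" and LC: "local_change K K' ss"
begin

lemma square_braid': "square_braid K' ss"
  using D' LC unfolding square_braid_def local_change_def by blast

lemma local_move_sym: "local_move K' ss K"
  using D LC local_change_sym square_braid' unfolding local_move_def local_move_axioms_def by blast

lemma same_params: "params K' = params K"
  using LC unfolding local_change_def params_def by simp

lemma not_square_iff: "p \<in> params K \<Longrightarrow> pt K p \<notin> square \<longleftrightarrow> p \<notin> (\<Union>s\<in>set ss. strand_params s)"
  using B unfolding braid_in_square_def by blast

lemma not_square_same: "p \<in> params K \<Longrightarrow> pt K' p \<notin> square \<longleftrightarrow> pt K p \<notin> square"
proof -
  assume p: "p \<in> params K"
  interpret K': local_move K' ss K by (rule local_move_sym)
  show ?thesis using K'.not_square_iff[of p] not_square_iff[OF p] p same_params by simp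
qed

lemma same_pt: "p \<in> params K \<Longrightarrow> pt K p \<notin> square \<Longrightarrow> pt K' p = pt K p \<and> (p \<in> over K' \<longleftrightarrow> p \<in> over K)"
  using LC not_square_iff unfolding local_change_def by blast

lemma same_meet:
  assumes p: "p \<in> params K" "pt K p \<notin> square"
  shows "meet K' p q \<longleftrightarrow> meet K p q"
proof
  assume m: "meet K p q"
  then have q: "q \<in> params K" "pt K q \<notin> square" using p unfolding meet_def by auto
  then show "meet K' p q" using m same_pt[OF p] same_pt[OF q] unfolding meet_def same_params by simp
next
  assume m: "meet K' p q"
  then have q: "q \<in> params K" "pt K' q \<notin> square" using same_params not_square_same[OF p(1)] p unfolding meet_def by auto
  then have "pt K q \<notin> square" using not_square_same by blast
  then show "meet K p q" using m same_pt[OF p] same_pt[OF q(1)] unfolding meet_def same_params by simp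
qed

lemma dpts_subset: "dpts K - square \<subseteq> dpts K' - square"
proof
  fix c assume c: "c \<in> dpts K - square"
  then obtain p q where m: "meet K p q" "c = pt K p" unfolding dpts_def by blast
  then have p: "p \<in> params K" "pt K p \<notin> square" using c unfolding meet_def by auto
  then have "meet K' p q" "pt K' p = c" using m same_meet same_pt by auto
  then show "c \<in> dpts K' - square" using c meet_dpts by blast
qed

lemma same_dpts: "dpts K' - square = dpts K - square"
  using dpts_subset local_move.dpts_subset[OF local_move_sym] by blast

lemma same_regular:
  assumes p: "p \<in> params K" "pt K p \<notin> square"
  shows "p \<in> regular_params K' \<longleftrightarrow> p \<in> regular_params K"
  using same_pt[OF p] p same_dpts same_params unfolding regular_params_def by auto

lemma same_compatible:
  assumes p: "p \<in> params K" "pt K p \<notin> square" and s: "\<And>c. c \<notin> square \<Longrightarrow> s' c = s c"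
  shows "compatible_at K' s' g p \<longleftrightarrow> compatible_at K s g p"
proof -
  have "s' (pt K' p) = s (pt K p)" using same_pt[OF p] s p by simp
  then show ?thesis unfolding compatible_at_def using same_regular[OF p] same_meet[OF p] by simp
qed

lemma same_outer_labelling:
  assumes s: "\<And>c. c \<notin> square \<Longrightarrow> s' c = s c"
  shows "outer_labelling K' ss s' g \<longleftrightarrow> outer_labelling K ss s g"
proof -
  have "(\<forall>p\<in>params K. pt K' p \<notin> square \<longrightarrow> compatible_at K' s' g p) \<longleftrightarrow>
      (\<forall>p\<in>params K. pt K p \<notin> square \<longrightarrow> compatible_at K s g p)"
  proof (rule ball_cong[OF refl])
    fix p assume p: "p \<in> params K"
    show "(pt K' p \<notin> square \<longrightarrow> compatible_at K' s' g p) \<longleftrightarrow> (pt K p \<notin> square \<longrightarrow> compatible_at K s g p)"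
    proof (cases "pt K p \<in> square")
      case True
      then show ?thesis using not_square_same[OF p] by simp
    next
      case False
      have "compatible_at K' s' g p = compatible_at K s g p" by (rule same_compatible[OF p False]) (rule s)
      then show ?thesis using not_square_same[OF p] False by simp
    qed
  qed
  then show ?thesis unfolding outer_labelling_def periodic_def same_params by simp
qed

text \<open>
  Both curves are continuous and agree just outside the square.
\<close>

lemma same_ends:
  assumes s: "(i, a, b) \<in> set ss"
  shows "pt K' (i, a) = pt K (i, a)" "pt K' (i, b) = pt K (i, b)"
proof -
  have i: "i < ncomp K" "i < ncomp K'" using B s LC unfolding braid_in_square_def local_change_def by fastforce+
  have par: "(i, t) \<in> params K" for t using i unfolding params_def by simp
  have lim: "(curve K i \<longlongrightarrow> curve K i t) (at t within S)" "(curve K' i \<longlongrightarrow> curve K' i t) (at t within S)" for t S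
    using curve_props(3)[OF D i(1)] curve_props(3)[OF D' i(2)]
    by (auto simp: continuous_on_eq_continuous_at isCont_def intro: tendsto_within_subset[of _ _ t UNIV])
  have "\<forall>\<^sub>F t in at_left a. curve K i t = curve K' i t"
    using ends_leave(1)[OF s] by eventually_elim (use same_pt[OF par] in \<open>simp add: pt_def\<close>)
  then have ca: "(curve K' i \<longlongrightarrow> curve K i a) (at_left a)"
    using lim(1)[of a] Lim_transform_eventually by blast
  then show "pt K' (i, a) = pt K (i, a)"
    using tendsto_unique[OF trivial_limit_at_left_real lim(2)[of a "{..<a}"] ca] unfolding pt_def by simp
  have "\<forall>\<^sub>F t in at_right b. curve K i t = curve K' i t"
    using ends_leave(2)[OF s] by eventually_elim (use same_pt[OF par] in \<open>simp add: pt_def\<close>)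
  then have cb: "(curve K' i \<longlongrightarrow> curve K i b) (at_right b)"
    using lim(1)[of b] Lim_transform_eventually by blast
  then show "pt K' (i, b) = pt K (i, b)"
    using tendsto_unique[OF trivial_limit_at_right_real lim(2)[of b "{b<..}"] cb] unfolding pt_def by simp
qed

lemma same_rightward: "j < length ss \<Longrightarrow> rightward K' (ss ! j) = rightward K (ss ! j)"
  using same_ends(1)[of "fst (ss ! j)" "fst (snd (ss ! j))" "snd (snd (ss ! j))"] nth_mem[of j ss]
  unfolding rightward_def by simp

lemma same_rho_ends:
  assumes "j < length ss"
  shows "at_abscissa K' (ss ! j) (-1) = at_abscissa K (ss ! j) (-1)"
    "at_abscissa K' (ss ! j) 1 = at_abscissa K (ss ! j) 1"
  using rho_ends[OF assms] square_braid.rho_ends[OF square_braid' assms] same_rightward[OF assms]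
  by (cases "rightward K (ss ! j)"; simp)+

lemma same_velocity:
  assumes p: "p \<in> params K" "pt K p \<notin> square"
  shows "velocity K' p = velocity K p"
proof -
  obtain i t where it: "p = (i, t)" by (cases p)
  have i: "i < ncomp K" using p(1) it unfolding params_def by simp
  have par: "(i, u) \<in> params K" for u using i unfolding params_def by simp
  have "\<forall>\<^sub>F u in at t. pt K (i, u) \<notin> square" using outside_open[OF p] unfolding it by simp
  then have "\<forall>\<^sub>F u in at t. curve K' i u = curve K i u"
    by eventually_elim (use same_pt[OF par] in \<open>simp add: pt_def\<close>)
  moreover have "curve K' i t = curve K i t" using same_pt[OF p] unfolding it pt_def by simp
  ultimately have "\<forall>\<^sub>F u in nhds t. curve K' i u = curve K i u" by (simp add: eventually_nhds_conv_at)
  then show ?thesis unfolding velocity_def it by (intro vector_derivative_cong_eq) auto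
qed

lemma same_weights:
  assumes c: "c \<notin> square" and w: "weights K c x y"
  shows "weights K' c x y"
proof -
  have "positive_crossing K' c" if P: "positive_crossing K c"
  proof -
    obtain p q where m: "meet K p q" "pt K p = c" "p \<in> over K" "cross (velocity K p) (velocity K q) > 0"
      using P unfolding positive_crossing_def by blast
    have p: "p \<in> params K" "pt K p \<notin> square" and q: "q \<in> params K" "pt K q \<notin> square"
      using m c unfolding meet_def by auto
    show ?thesis unfolding positive_crossing_def
      using m same_meet[OF p] same_pt[OF p] same_velocity[OF p] same_velocity[OF q] by metis
  qed
  moreover have "negative_crossing K' c" if P: "negative_crossing K c"
  proof -
    obtain p q where m: "meet K p q" "pt K p = c" "p \<in> over K" "cross (velocity K p) (velocity K q) < 0"
      using P unfolding negative_crossing_def by blast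
    have p: "p \<in> params K" "pt K p \<notin> square" and q: "q \<in> params K" "pt K q \<notin> square"
      using m c unfolding meet_def by auto
    show ?thesis unfolding negative_crossing_def
      using m same_meet[OF p] same_pt[OF p] same_velocity[OF p] same_velocity[OF q] by metis
  qed
  moreover have "precrossing K' c" if P: "precrossing K c"
  proof -
    have "c \<in> dpts K'" using P c same_dpts unfolding precrossing_def by blast
    moreover have "p \<notin> over K'" if "p \<in> params K'" "pt K' p = c" for p
    proof -
      have p: "p \<in> params K" "pt K p \<notin> square" using that not_square_same[of p] c same_params by auto
      then show ?thesis using same_pt[OF p] that P unfolding precrossing_def by simp
    qed
    ultimately show ?thesis unfolding precrossing_def by blast
  qed
  ultimately show ?thesis using w by (auto elim!: weights.cases intro: weights.intros)
qed

lemma same_outer_points: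
  assumes "resolved_braid K ss cs W s" "resolved_braid K' ss cs' W' s'"
  shows "resolved_braid.outer_points K' ss = resolved_braid.outer_points K ss"
proof -
  have "p \<in> regular_params K' \<and> pt K' p \<notin> square \<longleftrightarrow> p \<in> regular_params K \<and> pt K p \<notin> square" for p
    using same_regular[of p] not_square_same[of p] same_params unfolding regular_params_def by blast
  then show ?thesis
    unfolding resolved_braid.outer_points_def[OF assms(1)] resolved_braid.outer_points_def[OF assms(2)]
    using same_rho_ends by simp
qed

text \<open>A labelling of one diagram gives one of the other that has the same labels outside.\<close>

lemma outer_circles_refine:
  assumes R: "resolved_braid K ss cs W s" and R': "resolved_braid K' ss cs' W' s'"
    and s: "\<And>c. c \<notin> square \<Longrightarrow> s' c = s c"
    and T: "same_tangle (length ss) W W' TYPE(param set)"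
    and x: "x \<in> resolved_braid.outer_points K ss" and y: "y \<in> resolved_braid.outer_points K ss"
    and e: "circle_of K' s' x = circle_of K' s' y"
  shows "circle_of K s x = circle_of K s y"
proof -
  interpret R: resolved_braid K ss cs W s by (rule R)
  interpret R': resolved_braid K' ss cs' W' s' by (rule R')
  let ?N = "length ss" and ?q = "circle_of K s"
  have L: "labelling K s ?q" by (rule labelling_circle_of[OF D])
  define G where "G k j = ?q (\<rho> j (R.mid k))" for k j
  note ch = R.chain_from_labelling[OF L, folded G_def]
  have W: "u < ?N \<and> v < ?N \<and> u \<noteq> v" if "(u, v, h) \<in> set W" for u v h
    using that R.crossing R.len by (metis in_set_conv_nth)
  have W': "u < ?N \<and> v < ?N \<and> u \<noteq> v" if "(u, v, h) \<in> set W'" for u v h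
    using that R'.crossing R'.len by (metis in_set_conv_nth)
  have "tangle ?N W (G 0) (G (length W))"
    using tangle_iff_chain[of W ?N "G 0" "G (length W)"] W ch(1) by blast
  then have "tangle ?N W' (G 0) (G (length W))" using T unfolding same_tangle_def by blast
  then obtain G' where G': "chain ?N W' G'" "\<And>j. j < ?N \<Longrightarrow> G' 0 j = G 0 j \<and> G' (length W') j = G (length W) j"
    using tangle_iff_chain[of W' ?N "G 0" "G (length W)"] W' by blast
  have O: "outer_labelling K' ss s' ?q"
  proof -
    have "outer_labelling K' ss s' ?q = outer_labelling K ss s ?q"
      by (rule same_outer_labelling) (rule s)
    then show ?thesis using labelling_outer[OF L] by simp
  qed
  have ends: "G' 0 j = ?q (R'.\<rho> j (-1)) \<and> G' R'.n j = ?q (R'.\<rho> j 1)" if "j < ?N" for j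
    using G'(2)[OF that] ch(2)[OF that] same_rho_ends[OF that] R.len R'.len by simp
  have "\<exists>g. labelling K' s' g \<and> (\<forall>p\<in>R'.outer_points. g p = ?q p)"
  proof (rule R'.labelling_from_chain[OF O G'(1)])
    show "G' 0 j = ?q (R'.\<rho> j (-1)) \<and> G' R'.n j = ?q (R'.\<rho> j 1)" if "j < ?N" for j
      by (rule ends[OF that])
    show "\<exists>g. labelling K' s' g \<and> (\<forall>p\<in>R'.outer_points. g p = ?q p)"
      if "labelling K' s' g" "\<And>p. p \<in> R'.outer_points \<Longrightarrow> g p = ?q p" for g
      using that by (intro exI[of _ g]) simp
  qed
  then obtain g where g: "labelling K' s' g" "\<And>p. p \<in> R'.outer_points \<Longrightarrow> g p = ?q p" by metis
  have o: "R'.outer_points = R.outer_points" by (rule same_outer_points[OF R R'])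
  show ?thesis
    by (rule circle_of_refines[OF g(1) _ R'.outer_points_regular _ _ e]) (use g(2) x y o in auto)
qed

text \<open>
  By the preceding lemma in both directions, the two diagrams identify the same points outside.
\<close>

lemma same_outer_value:
  assumes R: "resolved_braid K ss cs W s" and R': "resolved_braid K' ss cs' W' s'"
    and s: "\<And>c. c \<notin> square \<Longrightarrow> s' c = s c"
    and T: "same_tangle (length ss) W W' TYPE(param set)"
  shows "resolved_braid.outer_value K ss s = resolved_braid.outer_value K' ss s'"
proof -
  interpret K': local_move K' ss K by (rule local_move_sym)
  have T': "same_tangle (length ss) W' W TYPE(param set)" using T unfolding same_tangle_def by blast
  note o = same_outer_points[OF R R']
  have "card (circle_of K s ` resolved_braid.outer_points K ss) = card (circle_of K' s' ` resolved_braid.outer_points K ss)"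
  proof (rule card_image_eqI)
    fix x y assume xy: "x \<in> resolved_braid.outer_points K ss" "y \<in> resolved_braid.outer_points K ss"
    show "circle_of K s x = circle_of K s y \<longleftrightarrow> circle_of K' s' x = circle_of K' s' y"
    proof
      show "circle_of K s x = circle_of K s y" if "circle_of K' s' x = circle_of K' s' y"
        by (rule outer_circles_refine[OF R R' _ T xy that]) (rule s)
      show "circle_of K' s' x = circle_of K' s' y" if "circle_of K s x = circle_of K s y"
        by (rule K'.outer_circles_refine[OF R' R _ T' _ _ that]) (use s xy o in auto)
    qed
  qed
  then show ?thesis
    unfolding resolved_braid.outer_value_def[OF R] resolved_braid.outer_value_def[OF R'] o by simp
qed

end

section \<open>Signs of crossings\<close>

lemma same_sign_interval:
  fixes f :: "real \<Rightarrow> real"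
  assumes c: "continuous_on {min a b..max a b} f" and nz: "\<And>x. min a b \<le> x \<Longrightarrow> x \<le> max a b \<Longrightarrow> f x \<noteq> 0"
  shows "sgn (f a) = sgn (f b)"
proof (rule ccontr)
  assume ne: "sgn (f a) \<noteq> sgn (f b)"
  have "f a \<noteq> 0" "f b \<noteq> 0" using nz[of a] nz[of b] by auto
  then have "f a < 0 \<and> 0 < f b \<or> f b < 0 \<and> 0 < f a" using ne by (auto simp: sgn_if split: if_splits)
  moreover have im: "connected (f ` {min a b..max a b})" by (rule connected_continuous_image[OF c]) simp
  moreover have "f a \<in> f ` {min a b..max a b}" "f b \<in> f ` {min a b..max a b}" by auto
  ultimately have "0 \<in> f ` {min a b..max a b}"
    unfolding connected_iff_interval by (meson less_imp_le)
  then show False using nz by auto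
qed

lemma sign_after_zero:
  fixes f :: "real \<Rightarrow> real"
  assumes d: "(f has_real_derivative m) (at a)" "m \<noteq> 0" "f a = 0"
    and c: "continuous_on {a..b} f" and ab: "a < b" and nz: "\<And>x. a < x \<Longrightarrow> x \<le> b \<Longrightarrow> f x \<noteq> 0"
  shows "sgn (f b) = sgn m"
proof -
  obtain e where e: "e > 0" "\<And>h. 0 < h \<Longrightarrow> h < e \<Longrightarrow> sgn (f (a + h)) = sgn m"
  proof (cases "m > 0")
    case True
    then obtain e where "e > 0" "\<forall>h>0. h < e \<longrightarrow> f a < f (a + h)" using DERIV_pos_inc_right[OF d(1)] by blast
    then show thesis using that[of e] d(3) True by simp
  next
    case False
    then have "m < 0" using d(2) by simp
    then obtain e where "e > 0" "\<forall>h>0. h < e \<longrightarrow> f (a + h) < f a" using DERIV_neg_dec_right[OF d(1)] by blast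
    then show thesis using that[of e] d(3) \<open>m < 0\<close> by simp
  qed
  define h where "h = min (e / 2) ((b - a) / 2)"
  have h: "0 < h" "h < e" "a + h < b" using e(1) ab unfolding h_def by (auto simp: min_def field_simps)
  have "sgn (f (a + h)) = sgn (f b)"
    by (rule same_sign_interval) (use h nz in \<open>auto intro: continuous_on_subset[OF c]\<close>)
  then show ?thesis using e(2)[OF h(1,2)] by simp
qed

lemma sign_before_zero:
  fixes f :: "real \<Rightarrow> real"
  assumes d: "(f has_real_derivative m) (at b)" "m \<noteq> 0" "f b = 0"
    and c: "continuous_on {a..b} f" and ab: "a < b" and nz: "\<And>x. a \<le> x \<Longrightarrow> x < b \<Longrightarrow> f x \<noteq> 0"
  shows "sgn (f a) = - sgn m"
proof -
  have "((\<lambda>x. f (- x)) has_real_derivative - m) (at (- b))"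
    using d(1) by (subst DERIV_mirror[symmetric]) simp
  moreover have "continuous_on {- b..- a} (\<lambda>x. f (- x))"
    by (intro continuous_on_compose2[OF c] continuous_intros) auto
  ultimately have "sgn (f (- (- a))) = sgn (- m)"
    by (intro sign_after_zero[of "\<lambda>x. f (- x)" "- m" "- b" "- a"]) (use d ab nz in auto)
  then show ?thesis by (simp add: sgn_minus)
qed

lemma A_pair: "A_var * A_inv = 1" "A_var ^ 2 + A_inv ^ 2 + d_val = 0"
proof -
  show "A_var * A_inv = 1"
    unfolding A_var_def A_inv_def by (simp add: mult_single flip: zero_prod_def single_one)
  show "A_var ^ 2 + A_inv ^ 2 + d_val = 0" unfolding d_val_def by simp
qed

definition A_sign :: "bool \<Rightarrow> bracket_poly" where
  "A_sign e = (if e then A_var else A_inv)"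

text \<open>
  The weights of a classical crossing depend on its position only: the passing smoothing has weight
  \<open>A\<close> if the strand that runs over has the smaller slope.
\<close>

definition classical_weights :: "diagram_data \<Rightarrow> bool \<Rightarrow> complex \<Rightarrow> bool \<Rightarrow> bool" where
  "classical_weights K par c e \<longleftrightarrow> geo_weights K par c (A_sign e) (A_sign (\<not> e))"

context square_braid
begin

abbreviation "N \<equiv> length ss"
abbreviation "par j k \<equiv> rightward K (ss ! j) = rightward K (ss ! k)"
abbreviation "ht j \<equiv> height K (ss ! j)"
abbreviation "sl j \<equiv> slope K (ss ! j)"

lemma ht_continuous: "j < N \<Longrightarrow> continuous_on {-1..1} (ht j)"
  using height_continuous[OF D] strand_horizontal by (cases "ss ! j") metis

lemma ht_deriv: "j < N \<Longrightarrow> -1 < x \<Longrightarrow> x < 1 \<Longrightarrow> (ht j has_real_derivative sl j x) (at x)"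
  using height_deriv[OF D] strand_horizontal by (cases "ss ! j") metis

lemma rho_velocity:
  assumes "j < N" "x \<in> {-1..1}"
  shows "(if rightward K (ss ! j) then Re (velocity K (\<rho> j x)) > 0 else Re (velocity K (\<rho> j x)) < 0)"
  using velocity_abscissa[OF D _ assms(2)] strand_horizontal[OF assms(1)] by (cases "ss ! j") auto

lemma pt_rho: "j < N \<Longrightarrow> x \<in> {-1..1} \<Longrightarrow> pt K (\<rho> j x) = Complex x (ht j x)"
  using rho_facts(2) unfolding height_def by (simp add: complex_eq_iff)

lemma rho_meet_iff:
  assumes "j < N" "k < N" "j \<noteq> k" "x \<in> {-1..1}"
  shows "meet K (\<rho> j x) (\<rho> k x) \<longleftrightarrow> ht j x = ht k x"
proof -
  have "\<not> same_param (\<rho> j x) (\<rho> k x)" using rho_same(1) assms by blast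
  then show ?thesis unfolding meet_def using rho_facts(1) pt_rho assms by auto
qed

lemma cross_velocity:
  assumes "j < N" "k < N" "x \<in> {-1..1}"
  shows "cross (velocity K (\<rho> j x)) (velocity K (\<rho> k x)) =
    Re (velocity K (\<rho> j x)) * Re (velocity K (\<rho> k x)) * (sl k x - sl j x)"
proof -
  have "Re (velocity K (\<rho> j x)) \<noteq> 0" "Re (velocity K (\<rho> k x)) \<noteq> 0"
    using rho_velocity[OF assms(1,3)] rho_velocity[OF assms(2,3)] by (auto split: if_splits)
  then show ?thesis unfolding cross_def slope_def by (simp add: field_simps)
qed

text \<open>
  Transversality.
\<close>

lemma slopes_differ:
  assumes "j < N" "k < N" "x \<in> {-1..1}" "meet K (\<rho> j x) (\<rho> k x)"
  shows "sl j x \<noteq> sl k x"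
proof -
  have "cross (velocity K (\<rho> j x)) (velocity K (\<rho> k x)) \<noteq> 0" using D assms(4) unfolding diagram_def by blast
  then show ?thesis using cross_velocity[OF assms(1-3)] by auto
qed

text \<open>
  Whether the over strand runs up or down relative to the other one does not depend on orientations,
  and neither do the weights of the passing and the turning smoothing.
\<close>

lemma over_weights:
  assumes j: "j < N" and k: "k < N" and x: "x \<in> {-1..1}" and m: "meet K (\<rho> j x) (\<rho> k x)" and o: "\<rho> j x \<in> over K"
  shows "classical_weights K (par j k) (pt K (\<rho> j x)) (sl j x < sl k x)"
proof -
  let ?c = "pt K (\<rho> j x)" and ?a = "Re (velocity K (\<rho> j x))" and ?b = "Re (velocity K (\<rho> k x))"
  have ab: "(par j k \<longrightarrow> ?a * ?b > 0) \<and> (\<not> par j k \<longrightarrow> ?a * ?b < 0)"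
    using rho_velocity[OF j x] rho_velocity[OF k x]
    by (auto simp: mult_pos_pos mult_neg_neg mult_pos_neg mult_neg_pos split: if_splits)
  have ne: "sl j x \<noteq> sl k x" by (rule slopes_differ[OF j k x m])
  have cr: "cross (velocity K (\<rho> j x)) (velocity K (\<rho> k x)) = ?a * ?b * (sl k x - sl j x)"
    by (rule cross_velocity[OF j k x])
  have pos: "weights K ?c A_var A_inv" if "?a * ?b * (sl k x - sl j x) > 0"
  proof (rule weights.intros(1))
    have "cross (velocity K (\<rho> j x)) (velocity K (\<rho> k x)) > 0" using cr that by simp
    then show "positive_crossing K ?c" unfolding positive_crossing_def using m o by blast
  qed
  have neg: "weights K ?c A_inv A_var" if "?a * ?b * (sl k x - sl j x) < 0"
  proof (rule weights.intros(2))
    have "cross (velocity K (\<rho> j x)) (velocity K (\<rho> k x)) < 0" using cr that by simp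
    then show "negative_crossing K ?c" unfolding negative_crossing_def using m o by blast
  qed
  show ?thesis
  proof (cases "par j k")
    case True
    then have "?a * ?b > 0" using ab by blast
    then have "sl j x < sl k x \<Longrightarrow> weights K ?c A_var A_inv" "\<not> sl j x < sl k x \<Longrightarrow> weights K ?c A_inv A_var"
      using pos neg ne by (auto simp: zero_less_mult_iff mult_less_0_iff)
    then show ?thesis using True unfolding classical_weights_def geo_weights_def A_sign_def by auto
  next
    case False
    then have "?a * ?b < 0" using ab by blast
    then have "sl j x < sl k x \<Longrightarrow> weights K ?c A_inv A_var" "\<not> sl j x < sl k x \<Longrightarrow> weights K ?c A_var A_inv"
      using pos neg ne by (auto simp: zero_less_mult_iff mult_less_0_iff)
    then show ?thesis using False unfolding classical_weights_def geo_weights_def A_sign_def by auto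
  qed
qed

lemma through_rho:
  assumes j: "j < N" and t: "strand_through K (ss ! j) c"
  shows "Re c \<in> {-1..1}" "pt K (\<rho> j (Re c)) = c"
proof -
  obtain p where p: "p \<in> strand_params (ss ! j)" "pt K p = c" using t unfolding strand_through_def by blast
  then obtain x where x: "x \<in> {-1..1}" "same_param p (\<rho> j x)" using rho_strand[OF j] by blast
  have "pt K p = pt K (\<rho> j x)"
    by (rule pt_same_param[OF D rho_facts(1)[OF j x(1)] same_param_sym[OF x(2)]])
  then have "x = Re c" "pt K (\<rho> j x) = c" using rho_facts(2)[OF j x(1)] p by auto
  then show "Re c \<in> {-1..1}" "pt K (\<rho> j (Re c)) = c" using x by auto
qed

lemma over_rho:
  assumes j: "j < N" and t: "strand_over K (ss ! j) c"
  shows "\<rho> j (Re c) \<in> over K" "strand_through K (ss ! j) c"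
proof -
  obtain p where p: "p \<in> strand_params (ss ! j)" "pt K p = c" "p \<in> over K" using t unfolding strand_over_def by blast
  show th: "strand_through K (ss ! j) c" using p unfolding strand_through_def by blast
  obtain x where x: "x \<in> {-1..1}" "same_param p (\<rho> j x)" using rho_strand[OF j] p by blast
  have "\<rho> j x \<in> over K" using D p(3) x(2) unfolding diagram_def by blast
  moreover have "x = Re c"
    using pt_same_param[OF D rho_facts(1)[OF j x(1)] same_param_sym[OF x(2)]] rho_facts(2)[OF j x(1)] p by simp
  ultimately show "\<rho> j (Re c) \<in> over K" by simp
qed

text \<open>
  Every double point in the square lies on two of the strands, since the strands are all that is in
  the square.
\<close>

lemma square_dpt:
  assumes c: "c \<in> dpts K \<inter> square"
  obtains j k where "j < N" "k < N" "j \<noteq> k" "strand_through K (ss ! j) c" "strand_through K (ss ! k) c"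
proof -
  obtain p q where m: "meet K p q" "c = pt K p" using c unfolding dpts_def by blast
  then have p: "p \<in> params K" "pt K p \<in> square" using c unfolding meet_def by auto
  then obtain j x where j: "j < N" "x \<in> {-1..1}" "same_param p (\<rho> j x)" using square_params by blast
  have m': "meet K (\<rho> j x) q" using meet_same_param[OF D m(1) j(3)] by simp
  obtain k where k: "k < N" "k \<noteq> j" "meet K (\<rho> j x) (\<rho> k x)" using rho_meet[OF j(1,2) m'] by metis
  have e: "pt K (\<rho> j x) = c" using pt_same_param[OF D p(1) j(3)] m(2) by simp
  have "pt K (\<rho> k x) = c" using k(3) e unfolding meet_def by simp
  moreover have "\<rho> i x \<in> strand_params (ss ! i)" if "i < N" for i using rho_strand[OF that] j(2) by (meson same_param_refl)
  ultimately show thesis using that[of j k] j k e unfolding strand_through_def by metis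
qed

lemma through_meet:
  assumes "j < N" "k < N" "j \<noteq> k" "strand_through K (ss ! j) c" "strand_through K (ss ! k) c"
  shows "meet K (\<rho> j (Re c)) (\<rho> k (Re c))" "c \<in> dpts K \<inter> square" "-1 < Re c" "Re c < 1"
proof -
  note t = through_rho[OF assms(1,4)] through_rho[OF assms(2,5)]
  have "\<not> same_param (\<rho> j (Re c)) (\<rho> k (Re c))" using rho_same(1)[OF assms(1,2) t(1,1)] assms(3) by blast
  then show m: "meet K (\<rho> j (Re c)) (\<rho> k (Re c))" unfolding meet_def using rho_facts(1) t assms by auto
  show c: "c \<in> dpts K \<inter> square" using meet_dpts[OF m] rho_facts(4)[OF assms(1) t(1)] t by simp
  have "\<bar>Re c\<bar> < 1" using B c unfolding braid_in_square_def by blast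
  then show "-1 < Re c" "Re c < 1" by linarith+
qed

lemma ht_zero_dpt:
  assumes j: "j < N" "k < N" "j \<noteq> k" and x: "x \<in> {-1..1}" and e: "ht j x = ht k x"
  obtains c where "c \<in> dpts K \<inter> square" "x = Re c" "strand_through K (ss ! j) c" "strand_through K (ss ! k) c"
proof -
  have m: "meet K (\<rho> j x) (\<rho> k x)" using rho_meet_iff[OF j x] e by simp
  have i: "\<rho> i x \<in> strand_params (ss ! i)" if "i < N" for i using rho_strand[OF that] x by (meson same_param_refl)
  have "pt K (\<rho> k x) = pt K (\<rho> j x)" using m unfolding meet_def by simp
  then show thesis
    using that[of "pt K (\<rho> j x)"] meet_dpts[OF m] rho_facts(2,4)[OF j(1) x] i[OF j(1)] i[OF j(2)]
    unfolding strand_through_def by auto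
qed

lemma over_weights_at:
  assumes j: "j < N" "k < N" "j \<noteq> k" and o: "strand_over K (ss ! j) c" and t: "strand_through K (ss ! k) c"
  shows "classical_weights K (par j k) c (sl j (Re c) < sl k (Re c))"
  using over_weights[OF j(1,2)] through_rho[OF j(1) over_rho(2)[OF j(1) o]]
    through_meet(1)[OF j over_rho(2)[OF j(1) o] t] over_rho(1)[OF j(1) o] by metis

lemma pre_weights: "precrossing K c \<Longrightarrow> geo_weights K b c (if b then V_var else H_var) (if b then H_var else V_var)"
  unfolding geo_weights_def using weights.intros(3) by auto

lemma resolved_0:
  assumes "dpts K \<inter> square = {}"
  shows "resolved_braid K ss [] [] s"
  by unfold_locales (use assms in auto)

lemma resolved_2:
  assumes N: "N = 2" and d: "dpts K \<inter> square = {c1, c2}" and lt: "Re c1 < Re c2"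
  shows "resolved_braid K ss [c1, c2] [(0, 1, h1), (0, 1, h2)]
    (s(c1 \<mapsto> smoothing_of (par 0 1) h1, c2 \<mapsto> smoothing_of (par 0 1) h2))"
proof -
  have t: "strand_through K (ss ! 0) c \<and> strand_through K (ss ! 1) c" if c: "c \<in> {c1, c2}" for c
  proof -
    obtain j k where jk: "j < N" "k < N" "j \<noteq> k" "strand_through K (ss ! j) c" "strand_through K (ss ! k) c"
      using square_dpt[of c] c d by metis
    then have "j = 0 \<and> k = 1 \<or> j = 1 \<and> k = 0" using N by auto
    then show ?thesis using jk by auto
  qed
  have ne: "c1 \<noteq> c2" using lt by auto
  show ?thesis
  proof unfold_locales
    fix k u v :: nat and h :: bool assume "k < length [c1, c2]" "[(0, 1, h1), (0, 1, h2)] ! k = (u, v, h)"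
    then have "k = 0 \<and> u = 0 \<and> v = 1 \<and> h = h1 \<or> k = 1 \<and> u = 0 \<and> v = 1 \<and> h = h2" by (auto simp: less_Suc_eq)
    then show "u < N \<and> v < N \<and> u \<noteq> v \<and> strand_through K (ss ! u) ([c1, c2] ! k) \<and> strand_through K (ss ! v) ([c1, c2] ! k) \<and>
      (s(c1 \<mapsto> smoothing_of (par 0 1) h1, c2 \<mapsto> smoothing_of (par 0 1) h2)) ([c1, c2] ! k) = Some (smoothing_of (par u v) h)"
      using N t ne by auto
  qed (use d lt in auto)
qed

lemma resolved_3:
  assumes d: "dpts K \<inter> square = {c1, c2, c3}" and lt: "Re c1 < Re c2" "Re c2 < Re c3"
    and t1: "u1 < N" "v1 < N" "u1 \<noteq> v1" "strand_through K (ss ! u1) c1" "strand_through K (ss ! v1) c1"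
    and t2: "u2 < N" "v2 < N" "u2 \<noteq> v2" "strand_through K (ss ! u2) c2" "strand_through K (ss ! v2) c2"
    and t3: "u3 < N" "v3 < N" "u3 \<noteq> v3" "strand_through K (ss ! u3) c3" "strand_through K (ss ! v3) c3"
  shows "resolved_braid K ss [c1, c2, c3] [(u1, v1, h1), (u2, v2, h2), (u3, v3, h3)]
    (s(c1 \<mapsto> smoothing_of (par u1 v1) h1, c2 \<mapsto> smoothing_of (par u2 v2) h2, c3 \<mapsto> smoothing_of (par u3 v3) h3))"
proof -
  have ne: "c1 \<noteq> c2" "c1 \<noteq> c3" "c2 \<noteq> c3" using lt by auto
  show ?thesis
  proof unfold_locales
    fix k u v :: nat and h :: bool assume "k < length [c1, c2, c3]" "[(u1, v1, h1), (u2, v2, h2), (u3, v3, h3)] ! k = (u, v, h)"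
    then have "k = 0 \<and> u = u1 \<and> v = v1 \<and> h = h1 \<or> k = 1 \<and> u = u2 \<and> v = v2 \<and> h = h2 \<or> k = 2 \<and> u = u3 \<and> v = v3 \<and> h = h3"
      by (auto simp: less_Suc_eq numeral_2_eq_2)
    then show "u < N \<and> v < N \<and> u \<noteq> v \<and> strand_through K (ss ! u) ([c1, c2, c3] ! k) \<and> strand_through K (ss ! v) ([c1, c2, c3] ! k) \<and>
      (s(c1 \<mapsto> smoothing_of (par u1 v1) h1, c2 \<mapsto> smoothing_of (par u2 v2) h2, c3 \<mapsto> smoothing_of (par u3 v3) h3)) ([c1, c2, c3] ! k)
        = Some (smoothing_of (par u v) h)"
      using t1 t2 t3 ne by auto
  qed (use d lt in auto)
qed

end

section \<open>The moves on two strands\<close>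

lemma value_expand_2:
  assumes D: "diagram K" and s: "dom s \<subseteq> dpts K" and c: "c1 \<in> dpts K - dom s" "c2 \<in> dpts K - dom s" "c1 \<noteq> c2"
    and w: "geo_weights K p1 c1 a1 b1" "geo_weights K p2 c2 a2 b2"
  defines "v h1 h2 \<equiv> value_at K (s(c1 \<mapsto> smoothing_of p1 h1, c2 \<mapsto> smoothing_of p2 h2))"
  shows "value_at K s = a1 * (a2 * v True True + b2 * v True False) + b1 * (a2 * v False True + b2 * v False False)"
proof -
  have "value_at K (s(c1 \<mapsto> smoothing_of p1 h1)) = a2 * v h1 True + b2 * v h1 False" for h1
    unfolding v_def by (rule value_at_expand[OF D _ _ w(2)]) (use s c in auto)
  then show ?thesis using value_at_expand[OF D s _ w(1)] c by simp
qed

lemma value_expand_3: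
  assumes D: "diagram K" and s: "dom s \<subseteq> dpts K"
    and c: "c1 \<in> dpts K - dom s" "c2 \<in> dpts K - dom s" "c3 \<in> dpts K - dom s" "c1 \<noteq> c2" "c1 \<noteq> c3" "c2 \<noteq> c3"
    and w: "geo_weights K p1 c1 a1 b1" "geo_weights K p2 c2 a2 b2" "geo_weights K p3 c3 a3 b3"
  defines "v h1 h2 h3 \<equiv> value_at K (s(c1 \<mapsto> smoothing_of p1 h1, c2 \<mapsto> smoothing_of p2 h2, c3 \<mapsto> smoothing_of p3 h3))"
  shows "value_at K s =
    a1 * (a2 * (a3 * v True True True + b3 * v True True False) + b2 * (a3 * v True False True + b3 * v True False False)) +
    b1 * (a2 * (a3 * v False True True + b3 * v False True False) + b2 * (a3 * v False False True + b3 * v False False False))"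
proof -
  have "value_at K (s(c1 \<mapsto> smoothing_of p1 h)) =
      a2 * (a3 * v h True True + b3 * v h True False) + b2 * (a3 * v h False True + b3 * v h False False)" for h
    unfolding v_def by (rule value_expand_2[OF D _ _ _ _ w(2,3)]) (use s c in auto)
  then show ?thesis using value_at_expand[OF D s _ w(1)] c by simp
qed

text \<open>
  The two relations between the weights of a classical crossing that make R2 work.
\<close>

definition inverse_pair :: "bracket_poly \<Rightarrow> bracket_poly \<Rightarrow> bool" where
  "inverse_pair x y \<longleftrightarrow> x * y = 1 \<and> x ^ 2 + y ^ 2 + d_val = 0"

lemma inverse_pair_sign: "inverse_pair (A_sign e) (A_sign (\<not> e))"
  using A_pair unfolding inverse_pair_def A_sign_def by (auto simp: mult.commute add.commute)

context local_move
begin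

lemma bracket_eqI:
  assumes "\<And>s. dom s = dpts K - square \<Longrightarrow> value_at K s = value_at K' s"
  shows "bracket K = bracket K'"
  unfolding bracket_value_at
  by (rule value_at_eq_outside[OF D D', of "dpts K - square"]) (use assms same_dpts same_weights in auto)

lemma twoside_equal:
  assumes R: "resolved_braid K ss cs W s" and R': "resolved_braid K' ss cs' W' s'"
    and dm: "dom s = dpts K" "dom s' = dpts K'"
    and s: "\<And>c. c \<notin> square \<Longrightarrow> s' c = s c"
    and T: "same_tangle N W W' TYPE(param set)"
    and l: "loopless N W TYPE(param set)"
  shows "loopless N W' TYPE(param set) \<Longrightarrow> value_at K' s' = value_at K s"
    "one_loop N W' TYPE(param set) \<Longrightarrow> value_at K' s' = d_val * value_at K s"
proof -
  have "resolved_braid.outer_value K ss s = resolved_braid.outer_value K' ss s'"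
    by (rule same_outer_value[OF R R' _ T]) (rule s)
  then show "loopless N W' TYPE(param set) \<Longrightarrow> value_at K' s' = value_at K s"
    "one_loop N W' TYPE(param set) \<Longrightarrow> value_at K' s' = d_val * value_at K s"
    using resolved_braid.value_loopless[OF R dm(1) l] resolved_braid.value_loopless[OF R' dm(2)]
      resolved_braid.value_one_loop[OF R' dm(2)] by simp_all
qed

end

lemma (in square_braid) trivial_move: "local_move K ss K"
  unfolding local_move_def local_move_axioms_def local_change_def
  using D B square_braid_axioms by auto

text \<open>A diagram with two crossings in the square: only one value besides that of the trivial braid occurs.\<close>

lemma (in square_braid) two_crossings_value:
  assumes N: "N = 2" and d: "dpts K \<inter> square = {c1, c2}" and lt: "Re c1 < Re c2"
    and w: "geo_weights K (par 0 1) c1 a1 b1" "geo_weights K (par 0 1) c2 a2 b2" and s: "dom s = dpts K - square"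
  defines "st h1 h2 \<equiv> s(c1 \<mapsto> smoothing_of (par 0 1) h1, c2 \<mapsto> smoothing_of (par 0 1) h2)"
  shows "value_at K s = a1 * a2 * value_at K (st True True) +
    (a1 * b2 + b1 * a2 + d_val * (b1 * b2)) * value_at K (st True False)"
proof -
  have R: "resolved_braid K ss [c1, c2] [(0, 1, h1), (0, 1, h2)] (st h1 h2)" for h1 h2
    unfolding st_def by (rule resolved_2[OF N d lt])
  have c: "c1 \<in> dpts K \<inter> square" "c2 \<in> dpts K \<inter> square" using d by auto
  have dm: "dom (st h1 h2) = dpts K" for h1 h2 unfolding st_def using s c d by auto
  have out: "z \<notin> square \<Longrightarrow> st h1 h2 z = st h1' h2' z" for z h1 h2 h1' h2' unfolding st_def using c by auto
  interpret T: local_move K ss K by (rule trivial_move)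
  have l: "loopless N [(0, 1, True), (0, 1, False)] TYPE(param set)" unfolding N by (rule loopless_2(2)) simp
  have 1: "value_at K (st False True) = value_at K (st True False)"
  proof (rule T.twoside_equal(1)[OF R R dm dm _ _ l])
    show "same_tangle N [(0, 1, True), (0, 1, False)] [(0, 1, False), (0, 1, True)] TYPE(param set)"
      unfolding N using same_tangle_2(2,3)[where 'a = "param set"] unfolding same_tangle_def by simp
    show "loopless N [(0, 1, False), (0, 1, True)] TYPE(param set)" unfolding N by (rule loopless_2(2)) simp
  qed (rule out)
  have 2: "value_at K (st False False) = d_val * value_at K (st True False)"
  proof (rule T.twoside_equal(2)[OF R R dm dm _ _ l])
    show "same_tangle N [(0, 1, True), (0, 1, False)] [(0, 1, False), (0, 1, False)] TYPE(param set)"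
      unfolding N by (rule same_tangle_2(2))
    show "one_loop N [(0, 1, False), (0, 1, False)] TYPE(param set)" unfolding N by (rule one_loop_2)
  qed (rule out)
  have "value_at K s = a1 * (a2 * value_at K (st True True) + b2 * value_at K (st True False)) +
      b1 * (a2 * value_at K (st False True) + b2 * value_at K (st False False))"
    unfolding st_def by (rule value_expand_2[OF D _ _ _ _ w]) (use s c lt in auto)
  then show ?thesis unfolding 1 2 by (simp add: algebra_simps)
qed

context local_move
begin

lemma par': "j < N \<Longrightarrow> k < N \<Longrightarrow> (rightward K' (ss ! j) = rightward K' (ss ! k)) = par j k"
  using same_rightward by simp

text \<open>
  The sign of the difference of the two heights alternates, so the two crossings have opposite slope
  differences while the same strand runs over.  Their weights are therefore exchanged, and the
  coefficient of the turn vanishes.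
\<close>

lemma bracket_R2:
  assumes N: "N = 2" and d: "dpts K \<inter> square = {}" and d': "dpts K' \<inter> square = {c1, c2}" and lt: "Re c1 < Re c2"
    and o: "strand_over K' (ss ! 0) c1" "strand_over K' (ss ! 0) c2"
  shows "bracket K = bracket K'"
proof (rule bracket_eqI)
  interpret K': square_braid K' ss by (rule square_braid')
  fix s :: smoothings assume s: "dom s = dpts K - square"
  then have s': "dom s = dpts K' - square" using same_dpts by simp
  have par_eq: "K'.par 0 1 = par 0 1" using par' N by simp
  let ?x1 = "Re c1" and ?x2 = "Re c2" and ?f = "\<lambda>x. K'.ht 1 x - K'.ht 0 x"
  have t: "strand_through K' (ss ! 0) c \<and> strand_through K' (ss ! 1) c" if c: "c \<in> {c1, c2}" for c
  proof -
    obtain j k where jk: "j < N" "k < N" "j \<noteq> k" "strand_through K' (ss ! j) c" "strand_through K' (ss ! k) c"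
      using K'.square_dpt[of c] c d' by metis
    then have "j = 0 \<and> k = 1 \<or> j = 1 \<and> k = 0" using N by auto
    then show ?thesis using jk by auto
  qed
  have m: "meet K' (K'.\<rho> 0 (Re c)) (K'.\<rho> 1 (Re c))" "-1 < Re c" "Re c < 1" if "c \<in> {c1, c2}" for c
    using K'.through_meet[of 0 1 c] t[OF that] N by auto
  have nz: "?f x \<noteq> 0" if x: "x \<in> {-1..1}" "x \<noteq> ?x1" "x \<noteq> ?x2" for x
  proof
    assume "?f x = 0"
    then have "K'.ht 0 x = K'.ht 1 x" by simp
    then obtain c where "c \<in> dpts K' \<inter> square" "x = Re c" using K'.ht_zero_dpt[of 0 1 x] x N by auto
    then show False using d' x by auto
  qed
  have z: "?f (Re c) = 0" "K'.sl 1 (Re c) - K'.sl 0 (Re c) \<noteq> 0"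
    "(?f has_real_derivative (K'.sl 1 (Re c) - K'.sl 0 (Re c))) (at (Re c))" if "c \<in> {c1, c2}" for c
  proof -
    note mc = m[OF that]
    show "?f (Re c) = 0" using K'.rho_meet_iff[of 0 1 "Re c"] mc N by simp
    show "K'.sl 1 (Re c) - K'.sl 0 (Re c) \<noteq> 0" using K'.slopes_differ[of 0 1 "Re c"] mc N by simp
    show "(?f has_real_derivative (K'.sl 1 (Re c) - K'.sl 0 (Re c))) (at (Re c))"
      using K'.ht_deriv[of 0 "Re c"] K'.ht_deriv[of 1 "Re c"] mc N by (intro DERIV_diff) auto
  qed
  define y where "y = (?x1 + ?x2) / 2"
  have y: "?x1 < y" "y < ?x2" using lt unfolding y_def by auto
  have cont: "continuous_on {u..v} ?f" if "-1 \<le> u" "v \<le> 1" for u v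
    using K'.ht_continuous[of 0] K'.ht_continuous[of 1] N that
    by (intro continuous_intros) (auto intro: continuous_on_subset)
  have cy: "continuous_on {?x1..y} ?f" "continuous_on {y..?x2} ?f"
    by (rule cont; use m(2)[of c1] m(3)[of c2] y in simp)+
  have nzy: "?f x \<noteq> 0" if "?x1 < x" "x < ?x2" for x using nz[of x] that m(2)[of c1] m(3)[of c2] by simp
  have "sgn (?f y) = sgn (K'.sl 1 ?x1 - K'.sl 0 ?x1)"
    by (rule sign_after_zero[OF z(3,2,1) cy(1) y(1) nzy]) (use y in simp_all)
  moreover have "sgn (?f y) = - sgn (K'.sl 1 ?x2 - K'.sl 0 ?x2)"
    by (rule sign_before_zero[OF z(3,2,1) cy(2) y(2) nzy]) (use y in simp_all)
  ultimately have sg: "sgn (K'.sl 1 ?x1 - K'.sl 0 ?x1) = - sgn (K'.sl 1 ?x2 - K'.sl 0 ?x2)" by simp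
  define e where "e = (K'.sl 0 ?x1 < K'.sl 1 ?x1)"
  have e2: "(K'.sl 0 ?x2 < K'.sl 1 ?x2) = (\<not> e)"
    using sg z(2)[of c1] z(2)[of c2] unfolding e_def by (auto simp: sgn_if split: if_splits)
  define a b where "a = A_sign e" and "b = A_sign (\<not> e)"
  have ab: "a * b = 1" "a ^ 2 + b ^ 2 + d_val = 0" using inverse_pair_sign[of e] unfolding a_def b_def inverse_pair_def by auto
  have w: "geo_weights K' (K'.par 0 1) c1 a b" "geo_weights K' (K'.par 0 1) c2 b a"
    using K'.over_weights_at[of 0 1 c1] K'.over_weights_at[of 0 1 c2] o t N
    unfolding e_def[symmetric] e2 a_def b_def classical_weights_def by auto
  let ?st = "\<lambda>h1 h2. s(c1 \<mapsto> smoothing_of (K'.par 0 1) h1, c2 \<mapsto> smoothing_of (K'.par 0 1) h2)"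
  have v: "value_at K' s = a * b * value_at K' (?st True True) + (a * a + b * b + d_val * (b * a)) * value_at K' (?st True False)"
    by (rule K'.two_crossings_value[OF N d' lt w s'])
  have "value_at K' (?st True True) = value_at K s"
  proof (rule twoside_equal(1)[OF resolved_0[OF d] K'.resolved_2[OF N d' lt]])
    show "dom s = dpts K" using s d by blast
    show "dom (?st True True) = dpts K'" using s' d' by auto
    show "?st True True c = s c" if "c \<notin> square" for c using that d' by auto
    show "same_tangle N [] [(0, 1, True), (0, 1, True)] TYPE(param set)"
      unfolding N using same_tangle_2(1)[where 'a = "param set"] unfolding same_tangle_def by simp
    show "loopless N [] TYPE(param set)" unfolding N by (rule loopless_2(1))
    show "loopless N [(0, 1, True), (0, 1, True)] TYPE(param set)" unfolding N by (rule loopless_2(2)) simp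
  qed
  moreover have "a * a + b * b + d_val * (b * a) = 0"
    using ab by (simp add: power2_eq_square mult.commute)
  ultimately show "value_at K s = value_at K' s" using v ab by simp
qed

text \<open>
  The value depends symmetrically on the two pairs of weights, so the crossings may trade places.
\<close>

lemma bracket_PR2:
  assumes N: "N = 2" and d: "dpts K \<inter> square = {c1, c2}" and lt: "Re c1 < Re c2"
    and d': "dpts K' \<inter> square = {c1', c2'}" and lt': "Re c1' < Re c2'"
    and w: "geo_weights K (par 0 1) c1 v h" "geo_weights K (par 0 1) c2 a b"
    and w': "geo_weights K' (par 0 1) c1' a b" "geo_weights K' (par 0 1) c2' v h"
  shows "bracket K = bracket K'"
proof (rule bracket_eqI)
  interpret K': square_braid K' ss by (rule square_braid')
  fix s :: smoothings assume s: "dom s = dpts K - square"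
  then have s': "dom s = dpts K' - square" using same_dpts by simp
  have par_eq: "K'.par 0 1 = par 0 1" using par' N by simp
  let ?st = "\<lambda>h1 h2. s(c1 \<mapsto> smoothing_of (par 0 1) h1, c2 \<mapsto> smoothing_of (par 0 1) h2)"
  let ?st' = "\<lambda>h1 h2. s(c1' \<mapsto> smoothing_of (K'.par 0 1) h1, c2' \<mapsto> smoothing_of (K'.par 0 1) h2)"
  have eq: "value_at K' (?st' True h) = value_at K (?st True h)" for h
  proof (rule twoside_equal(1)[OF resolved_2[OF N d lt] K'.resolved_2[OF N d' lt']])
    show "dom (?st True h) = dpts K" using s d by auto
    show "dom (?st' True h) = dpts K'" using s' d' by auto
    show "?st' True h c = ?st True h c" if "c \<notin> square" for c using that d d' by auto
    show "same_tangle N [(0, 1, True), (0, 1, h)] [(0, 1, True), (0, 1, h)] TYPE(param set)"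
      unfolding same_tangle_def by simp
    show "loopless N [(0, 1, True), (0, 1, h)] TYPE(param set)" unfolding N by (rule loopless_2(2)) simp
    then show "loopless N [(0, 1, True), (0, 1, h)] TYPE(param set)" .
  qed
  show "value_at K s = value_at K' s"
    using two_crossings_value[OF N d lt w s] K'.two_crossings_value[OF N d' lt' w'[folded par_eq] s'] eq
    by (simp add: algebra_simps)
qed

end

section \<open>The moves on three strands\<close>

text \<open>
  Two of the crossings have exchanged or equal weights and cancel as in R2, so that only the weights of
  the third one survive, and they are the same on both sides.
\<close>

lemma triangle_identity:
  assumes "a12 = b01 \<and> b12 = a01 \<and> inverse_pair a01 b01 \<or>
    a02 = a12 \<and> b02 = b12 \<and> inverse_pair a02 b02 \<or> a01 = a02 \<and> b01 = b02 \<and> inverse_pair a01 b01"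
  shows "b01 * a02 * a12 + a01 * a02 * b12 + d_val * b01 * a02 * b12 + b01 * b02 * b12 = a01 * b02 * a12"
proof -
  have z: "x ^ 2 + y ^ 2 + d_val * (x * y) = 0" if "inverse_pair x y" for x y
    using that unfolding inverse_pair_def by simp
  consider "a12 = b01" "b12 = a01" "inverse_pair a01 b01" | "a02 = a12" "b02 = b12" "inverse_pair a12 b12"
    | "a02 = a01" "b02 = b01" "inverse_pair a01 b01" using assms by auto
  then show ?thesis
  proof cases
    case 1
    have "b01 * a02 * a12 + a01 * a02 * b12 + d_val * b01 * a02 * b12 + b01 * b02 * b12 =
        a02 * (a01 ^ 2 + b01 ^ 2 + d_val * (a01 * b01)) + a01 * b02 * a12"
      unfolding 1 by (simp add: algebra_simps power2_eq_square)
    then show ?thesis using z[OF 1(3)] by simp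
  next
    case 2
    have "b01 * a02 * a12 + a01 * a02 * b12 + d_val * b01 * a02 * b12 + b01 * b02 * b12 =
        b01 * (a12 ^ 2 + b12 ^ 2 + d_val * (a12 * b12)) + a01 * b02 * a12"
      unfolding 2 by (simp add: algebra_simps power2_eq_square)
    then show ?thesis using z[OF 2(3)] by simp
  next
    case 3
    have "b01 * a02 * a12 + a01 * a02 * b12 + d_val * b01 * a02 * b12 + b01 * b02 * b12 =
        b12 * (a01 ^ 2 + b01 ^ 2 + d_val * (a01 * b01)) + a01 * b02 * a12"
      unfolding 3 by (simp add: algebra_simps power2_eq_square)
    then show ?thesis using z[OF 3(3)] by simp
  qed
qed

lemma same_tangle_sym: "same_tangle N W W' T \<Longrightarrow> same_tangle N W' W T"
  unfolding same_tangle_def by simp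

lemma triangle_sym: "triangle K ss c \<Longrightarrow> c j k = c k j"
  unfolding triangle_def by blast

context square_braid
begin

lemma no_triple_point:
  assumes "j < N" "k < N" "l < N" "j \<noteq> k" "j \<noteq> l" "k \<noteq> l"
    and "strand_through K (ss ! j) c" "strand_through K (ss ! k) c" "strand_through K (ss ! l) c"
  shows False
proof -
  have m: "meet K (\<rho> j (Re c)) (\<rho> k (Re c))" "meet K (\<rho> j (Re c)) (\<rho> l (Re c))"
    using through_meet(1) assms by blast+
  then have "same_param (\<rho> k (Re c)) (\<rho> l (Re c))" using D unfolding diagram_def by blast
  moreover have x: "Re c \<in> {-1..1}" by (rule through_rho(1)[OF assms(1,7)])
  ultimately show False using rho_same(1)[OF assms(2,3) x x] assms(6) by blast
qed

context
  fixes c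
  assumes T: "triangle K ss c" and N3: "N = 3"
begin

lemma triangle_through:
  assumes "j < 3" "k < 3" "j \<noteq> k"
  shows "strand_through K (ss ! j) (c j k)" "strand_through K (ss ! k) (c j k)"
proof -
  have "strand_through K (ss ! j) (c j k)" "strand_through K (ss ! k) (c k j)" "c j k = c k j"
    using T assms unfolding triangle_def by blast+
  then show "strand_through K (ss ! j) (c j k)" "strand_through K (ss ! k) (c j k)" by simp_all
qed

lemma triangle_meet:
  assumes "j < 3" "k < 3" "j \<noteq> k"
  shows "-1 < Re (c j k)" "Re (c j k) < 1" "ht j (Re (c j k)) = ht k (Re (c j k))"
    "sl k (Re (c j k)) - sl j (Re (c j k)) \<noteq> 0"
proof -
  note m = through_meet[of j k "c j k"] triangle_through[OF assms]
  show x: "-1 < Re (c j k)" "Re (c j k) < 1" using m assms N3 by simp_all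
  have mt: "meet K (\<rho> j (Re (c j k))) (\<rho> k (Re (c j k)))" using m assms N3 by simp
  show "ht j (Re (c j k)) = ht k (Re (c j k))" using rho_meet_iff[of j k "Re (c j k)"] mt assms N3 x by simp
  show "sl k (Re (c j k)) - sl j (Re (c j k)) \<noteq> 0" using slopes_differ[of j k, OF _ _ _ mt] assms N3 x by simp
qed

lemma triangle_zero:
  assumes jk: "j < 3" "k < 3" "j \<noteq> k" and x: "x \<in> {-1..1}" and e: "ht j x = ht k x"
  shows "x = Re (c j k)"
proof -
  obtain p where p: "p \<in> dpts K \<inter> square" "x = Re p" "strand_through K (ss ! j) p" "strand_through K (ss ! k) p"
    using ht_zero_dpt[of j k x] jk x e N3 by auto
  have "p \<in> {c 0 1, c 0 2, c 1 2}" using p(1) T unfolding triangle_def by blast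
  then consider "p = c 0 1" | "p = c 0 2" | "p = c 1 2" by blast
  then have "\<exists>a b. a < 3 \<and> b < 3 \<and> a \<noteq> b \<and> p = c a b"
  proof cases
    case 1
    then show ?thesis by (intro exI[of _ 0] exI[of _ 1]) simp
  next
    case 2
    then show ?thesis by (intro exI[of _ 0] exI[of _ 2]) simp
  next
    case 3
    then show ?thesis by (intro exI[of _ 1] exI[of _ 2]) simp
  qed
  then obtain a b where ab: "a < 3" "b < 3" "a \<noteq> b" "p = c a b" by blast
  note th = triangle_through[OF ab(1-3), folded ab(4)]
  have "a \<in> {j, k}" using no_triple_point[of j k a p] p th jk ab N3 by auto
  moreover have "b \<in> {j, k}" using no_triple_point[of j k b p] p th jk ab N3 by auto
  ultimately have "a = j \<and> b = k \<or> a = k \<and> b = j" using ab by auto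
  moreover have "c j k = c k j" using T unfolding triangle_def by blast
  ultimately show ?thesis using ab(4) p(2) by auto
qed

lemma triangle_signs:
  assumes jk: "j < 3" "k < 3" "j \<noteq> k"
  shows "Re (c j k) < x \<Longrightarrow> x \<le> 1 \<Longrightarrow> sgn (ht k x - ht j x) = sgn (sl k (Re (c j k)) - sl j (Re (c j k)))"
    "-1 \<le> x \<Longrightarrow> x < Re (c j k) \<Longrightarrow> sgn (ht k x - ht j x) = - sgn (sl k (Re (c j k)) - sl j (Re (c j k)))"
proof -
  let ?f = "\<lambda>x. ht k x - ht j x" and ?x = "Re (c j k)"
  note m = triangle_meet[OF jk]
  have d: "(?f has_real_derivative (sl k ?x - sl j ?x)) (at ?x)"
    using ht_deriv[of j ?x] ht_deriv[of k ?x] m jk N3 by (intro DERIV_diff) auto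
  have z: "?f ?x = 0" using m by simp
  have cont: "continuous_on {u..v} ?f" if "-1 \<le> u" "v \<le> 1" for u v
    using ht_continuous[of j] ht_continuous[of k] jk N3 that
    by (intro continuous_intros) (auto intro: continuous_on_subset)
  have nz: "?f y \<noteq> 0" if "-1 \<le> y" "y \<le> 1" "y \<noteq> ?x" for y
    using triangle_zero[OF jk, of y] that by auto
  show "sgn (?f x) = sgn (sl k ?x - sl j ?x)" if "?x < x" "x \<le> 1"
    by (rule sign_after_zero[OF d m(4) z _ that(1)]) (use that m nz cont in auto)
  show "sgn (?f x) = - sgn (sl k ?x - sl j ?x)" if "-1 \<le> x" "x < ?x"
    by (rule sign_before_zero[OF d m(4) z _ that(2)]) (use that m nz cont in auto)
qed

text \<open>
  Where two of the strands cross, the third one is on the same side of both.  This forces the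
  slope differences at all three crossings to have the same sign, which can be read off at the right edge.
\<close>

lemma triangle_equal_signs:
  assumes "Re (c 0 1) < Re (c 0 2) \<and> Re (c 0 2) < Re (c 1 2) \<or> Re (c 1 2) < Re (c 0 2) \<and> Re (c 0 2) < Re (c 0 1)"
    and jk: "j < k" "k < 3"
  shows "(sl j (Re (c j k)) < sl k (Re (c j k))) = (ht 0 1 < ht 1 1)"
proof -
  let ?r = "\<lambda>j k. sgn (sl k (Re (c j k)) - sl j (Re (c j k)))"
  have lt: "(0::nat) < 3" "(1::nat) < 3" "(2::nat) < 3" "(0::nat) \<noteq> 1" "(0::nat) \<noteq> 2" "(1::nat) \<noteq> 2" by simp_all
  note m01 = triangle_meet[OF lt(1,2,4)] and m02 = triangle_meet[OF lt(1,3,5)] and m12 = triangle_meet[OF lt(2,3,6)]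
  note s01 = triangle_signs[OF lt(1,2,4)] and s02 = triangle_signs[OF lt(1,3,5)] and s12 = triangle_signs[OF lt(2,3,6)]
  have e: "?r 0 2 = ?r 0 1 \<and> ?r 1 2 = ?r 0 1"
    using assms(1)
  proof
    assume o: "Re (c 0 1) < Re (c 0 2) \<and> Re (c 0 2) < Re (c 1 2)"
    have q: "ht 2 (Re (c 0 2)) - ht 1 (Re (c 0 2)) = - (ht 1 (Re (c 0 2)) - ht 0 (Re (c 0 2)))" using m02 by simp
    have "sgn (ht 2 (Re (c 0 2)) - ht 1 (Re (c 0 2))) = - ?r 1 2" by (rule s12(2)) (use o m02 in simp_all)
    moreover have "sgn (ht 1 (Re (c 0 2)) - ht 0 (Re (c 0 2))) = ?r 0 1" by (rule s01(1)) (use o m02 in simp_all)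
    ultimately have "- ?r 1 2 = - ?r 0 1" unfolding q by (simp only: sgn_minus minus_minus)
    moreover have "ht 2 (Re (c 0 1)) - ht 1 (Re (c 0 1)) = ht 2 (Re (c 0 1)) - ht 0 (Re (c 0 1))" using m01 by simp
    moreover have "sgn (ht 2 (Re (c 0 1)) - ht 1 (Re (c 0 1))) = - ?r 1 2" by (rule s12(2)) (use o m01 in simp_all)
    moreover have "sgn (ht 2 (Re (c 0 1)) - ht 0 (Re (c 0 1))) = - ?r 0 2" by (rule s02(2)) (use o m01 in simp_all)
    ultimately show ?thesis by simp
  next
    assume o: "Re (c 1 2) < Re (c 0 2) \<and> Re (c 0 2) < Re (c 0 1)"
    have q: "ht 2 (Re (c 0 2)) - ht 1 (Re (c 0 2)) = - (ht 1 (Re (c 0 2)) - ht 0 (Re (c 0 2)))" using m02 by simp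
    have "sgn (ht 2 (Re (c 0 2)) - ht 1 (Re (c 0 2))) = ?r 1 2" by (rule s12(1)) (use o m02 in simp_all)
    moreover have "sgn (ht 1 (Re (c 0 2)) - ht 0 (Re (c 0 2))) = - ?r 0 1" by (rule s01(2)) (use o m02 in simp_all)
    ultimately have "?r 1 2 = ?r 0 1" unfolding q by (simp only: sgn_minus minus_minus)
    moreover have "ht 2 (Re (c 0 1)) - ht 1 (Re (c 0 1)) = ht 2 (Re (c 0 1)) - ht 0 (Re (c 0 1))" using m01 by simp
    moreover have "sgn (ht 2 (Re (c 0 1)) - ht 1 (Re (c 0 1))) = ?r 1 2" by (rule s12(1)) (use o m01 in simp_all)
    moreover have "sgn (ht 2 (Re (c 0 1)) - ht 0 (Re (c 0 1))) = ?r 0 2" by (rule s02(1)) (use o m01 in simp_all)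
    ultimately show ?thesis by simp
  qed
  have "sgn (ht 1 1 - ht 0 1) = ?r 0 1" using s01(1)[of 1] m01 by simp
  moreover have "j = 0 \<and> k = 1 \<or> j = 0 \<and> k = 2 \<or> j = 1 \<and> k = 2" using jk by auto
  ultimately have "sgn (ht 1 1 - ht 0 1) = ?r j k" using e by auto
  then show ?thesis by (auto simp: sgn_if split: if_splits)
qed

lemma triangle_weights:
  assumes o: "Re (c 0 1) < Re (c 0 2) \<and> Re (c 0 2) < Re (c 1 2) \<or> Re (c 1 2) < Re (c 0 2) \<and> Re (c 0 2) < Re (c 0 1)"
    and jk: "j < k" "k < 3"
  defines "\<sigma> \<equiv> ht 0 1 < ht 1 1"
  shows "strand_over K (ss ! j) (c j k) \<Longrightarrow> classical_weights K (par j k) (c j k) \<sigma>"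
    "strand_over K (ss ! k) (c j k) \<Longrightarrow> classical_weights K (par j k) (c j k) (\<not> \<sigma>)"
proof -
  have lt: "j < 3" "k < 3" "j \<noteq> k" "j < N" "k < N" using jk N3 by auto
  have s: "(sl j (Re (c j k)) < sl k (Re (c j k))) = \<sigma>" unfolding \<sigma>_def by (rule triangle_equal_signs[OF o jk])
  have s': "(sl k (Re (c j k)) < sl j (Re (c j k))) = (\<not> \<sigma>)" using s triangle_meet(4)[OF lt(1-3)] by auto
  note th = triangle_through[OF lt(1-3)]
  show "classical_weights K (par j k) (c j k) \<sigma>" if "strand_over K (ss ! j) (c j k)"
    using over_weights_at[OF lt(4,5,3) that th(2)] unfolding s .
  have "par k j = par j k" by blast
  then show "classical_weights K (par j k) (c j k) (\<not> \<sigma>)" if "strand_over K (ss ! k) (c j k)"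
    using over_weights_at[OF lt(5,4) lt(3)[symmetric] that th(1)] unfolding s' by simp
qed

end

end

context local_move
begin

lemma same_height_end: "j < N \<Longrightarrow> height K' (ss ! j) 1 = height K (ss ! j) 1"
proof -
  assume j: "j < N"
  have "(fst (ss ! j), fst (snd (ss ! j)), snd (snd (ss ! j))) \<in> set ss" using j by simp
  note e = same_ends[OF this]
  have "pt K' (\<rho> j 1) = pt K (\<rho> j 1)"
    using rho_ends[OF j] e by (cases "rightward K (ss ! j)") simp_all
  then show ?thesis unfolding height_def same_rho_ends(2)[OF j] by simp
qed

text \<open>
  Both sides expand to a combination of the five Temperley-Lieb diagrams on three strands.  The coefficients of the
  identity and of the two products of turns agree at once; those of the two turns agree by
  the identity in the hypothesis.
\<close>

lemma bracket_triangle: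
  assumes N3: "N = 3" and T: "triangle K ss c" and T': "triangle K' ss c'"
    and lt: "Re (c 0 1) < Re (c 0 2)" "Re (c 0 2) < Re (c 1 2)"
    and lt': "Re (c' 1 2) < Re (c' 0 2)" "Re (c' 0 2) < Re (c' 0 1)"
    and w: "geo_weights K (par 0 1) (c 0 1) a01 b01" "geo_weights K (par 0 2) (c 0 2) a02 b02"
      "geo_weights K (par 1 2) (c 1 2) a12 b12"
    and w': "geo_weights K' (par 0 1) (c' 0 1) a01 b01" "geo_weights K' (par 0 2) (c' 0 2) a02 b02"
      "geo_weights K' (par 1 2) (c' 1 2) a12 b12"
    and id: "b01 * a02 * a12 + a01 * a02 * b12 + d_val * b01 * a02 * b12 + b01 * b02 * b12 = a01 * b02 * a12"
  shows "bracket K = bracket K'"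
proof (rule bracket_eqI)
  interpret K': local_move K' ss K by (rule local_move_sym)
  fix s :: smoothings assume s: "dom s = dpts K - square"
  then have s': "dom s = dpts K' - square" using same_dpts by simp
  have pe: "K'.par 0 1 = par 0 1" "K'.par 0 2 = par 0 2" "K'.par 1 2 = par 1 2" using par' N3 by simp_all
  have d: "dpts K \<inter> square = {c 0 1, c 0 2, c 1 2}" using T unfolding triangle_def by blast
  have d': "dpts K' \<inter> square = {c' 1 2, c' 0 2, c' 0 1}" using T' unfolding triangle_def by blast
  define st where "st h1 h2 h3 = s(c 0 1 \<mapsto> smoothing_of (par 0 1) h1, c 0 2 \<mapsto> smoothing_of (par 0 2) h2,
    c 1 2 \<mapsto> smoothing_of (par 1 2) h3)" for h1 h2 h3
  define st' where "st' h1 h2 h3 = s(c' 1 2 \<mapsto> smoothing_of (par 1 2) h1, c' 0 2 \<mapsto> smoothing_of (par 0 2) h2,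
    c' 0 1 \<mapsto> smoothing_of (par 0 1) h3)" for h1 h2 h3
  have n: "0 < N" "1 < N" "2 < N" "(0::nat) \<noteq> 1" "(0::nat) \<noteq> 2" "(1::nat) \<noteq> 2" using N3 by simp_all
  note th = triangle_through[OF T N3, unfolded N3[symmetric]] and th' = K'.triangle_through[OF T' N3, unfolded N3[symmetric]]
  have R: "resolved_braid K ss [c 0 1, c 0 2, c 1 2] [(0, 1, h1), (0, 2, h2), (1, 2, h3)] (st h1 h2 h3)" for h1 h2 h3
    unfolding st_def
    by (rule resolved_3[OF d lt n(1,2,4) th(1)[OF n(1,2,4)] th(2)[OF n(1,2,4)] n(1,3,5) th(1)[OF n(1,3,5)] th(2)[OF n(1,3,5)]
      n(2,3,6) th(1)[OF n(2,3,6)] th(2)[OF n(2,3,6)]])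
  have R': "resolved_braid K' ss [c' 1 2, c' 0 2, c' 0 1] [(1, 2, h1), (0, 2, h2), (0, 1, h3)] (st' h1 h2 h3)" for h1 h2 h3
    unfolding st'_def pe[symmetric]
    by (rule K'.resolved_3[OF d' lt' n(2,3,6) th'(1)[OF n(2,3,6)] th'(2)[OF n(2,3,6)] n(1,3,5) th'(1)[OF n(1,3,5)] th'(2)[OF n(1,3,5)]
      n(1,2,4) th'(1)[OF n(1,2,4)] th'(2)[OF n(1,2,4)]])
  have cin: "c 0 1 \<in> dpts K \<inter> square" "c 0 2 \<in> dpts K \<inter> square" "c 1 2 \<in> dpts K \<inter> square" using d by auto
  have cin': "c' 0 1 \<in> dpts K' \<inter> square" "c' 0 2 \<in> dpts K' \<inter> square" "c' 1 2 \<in> dpts K' \<inter> square" using d' by auto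
  have dm: "dom (st h1 h2 h3) = dpts K" for h1 h2 h3 unfolding st_def using s d by auto
  have dm': "dom (st' h1 h2 h3) = dpts K'" for h1 h2 h3 unfolding st'_def using s' d' by auto
  have out: "st' g1 g2 g3 z = st h1 h2 h3 z" if "z \<notin> square" for z h1 h2 h3 g1 g2 g3
    using that cin cin' unfolding st_def st'_def by auto
  let ?W = "\<lambda>h1 h2 h3. [(0::nat, 1::nat, h1::bool), (0, 2, h2), (1, 2, h3)]"
  let ?W' = "\<lambda>h1 h2 h3. [(1::nat, 2::nat, h1::bool), (0, 2, h2), (0, 1, h3)]"
  let ?v = "\<lambda>h1 h2 h3. value_at K (st h1 h2 h3)" and ?v' = "\<lambda>h1 h2 h3. value_at K' (st' h1 h2 h3)"
  have eq: "?v' g1 g2 g3 = ?v h1 h2 h3"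
    if "same_tangle 3 (?W h1 h2 h3) (?W' g1 g2 g3) TYPE(param set)" "loopless 3 (?W h1 h2 h3) TYPE(param set)"
      "loopless 3 (?W' g1 g2 g3) TYPE(param set)" for h1 h2 h3 g1 g2 g3
    by (rule twoside_equal(1)[OF R R' dm dm' out]) (use that N3 in simp_all)
  have loop': "?v' g1 g2 g3 = d_val * ?v h1 h2 h3"
    if "same_tangle 3 (?W h1 h2 h3) (?W' g1 g2 g3) TYPE(param set)" "loopless 3 (?W h1 h2 h3) TYPE(param set)"
      "one_loop 3 (?W' g1 g2 g3) TYPE(param set)" for h1 h2 h3 g1 g2 g3
    by (rule twoside_equal(2)[OF R R' dm dm' out]) (use that N3 in simp_all)
  have loop: "?v h1 h2 h3 = d_val * ?v' g1 g2 g3"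
    if "same_tangle 3 (?W h1 h2 h3) (?W' g1 g2 g3) TYPE(param set)" "loopless 3 (?W' g1 g2 g3) TYPE(param set)"
      "one_loop 3 (?W h1 h2 h3) TYPE(param set)" for h1 h2 h3 g1 g2 g3
    by (rule K'.twoside_equal(2)[OF R' R dm' dm out[symmetric]]) (use that N3 same_tangle_sym in simp_all)
  note L = loopless_3[where 'a = "param set"] and S = same_tangle_3[where 'a = "param set"]
  have v0: "?v' True True True = ?v True True True" by (rule eq[OF same_tangle_sym[OF S(1)] L(1) L(8)])
  have v1: "?v False True True = ?v' True False True" "?v True True False = ?v' True False True"
    "?v False False False = ?v' True False True"
    using eq[OF S(2) L(5) L(10)] eq[OF S(3) L(2) L(10)] eq[OF S(5) L(7) L(10)] by simp_all
  have v1l: "?v False True False = d_val * ?v' True False True" by (rule loop[OF S(4) L(10) one_loop_3(1)])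
  have v2: "?v' False True True = ?v True False True" "?v' True True False = ?v True False True"
    "?v' False False False = ?v True False True"
    using eq[OF same_tangle_sym[OF S(6)] L(3) L(12)] eq[OF same_tangle_sym[OF S(7)] L(3) L(9)]
      eq[OF same_tangle_sym[OF S(9)] L(3) L(14)] by simp_all
  have v2l: "?v' False True False = d_val * ?v True False True"
    by (rule loop'[OF same_tangle_sym[OF S(8)] L(3) one_loop_3(2)])
  have v12: "?v' True False False = ?v False False True" by (rule eq[OF S(10) L(6) L(11)])
  have v21: "?v' False False True = ?v True False False" by (rule eq[OF S(11) L(4) L(13)])
  have V: "value_at K s =
    a01 * (a02 * (a12 * ?v True True True + b12 * ?v True True False) + b02 * (a12 * ?v True False True + b12 * ?v True False False)) +
    b01 * (a02 * (a12 * ?v False True True + b12 * ?v False True False) + b02 * (a12 * ?v False False True + b12 * ?v False False False))"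
    unfolding st_def by (rule value_expand_3[OF D _ _ _ _ _ _ _ w]) (use s cin lt in auto)
  have V': "value_at K' s =
    a12 * (a02 * (a01 * ?v' True True True + b01 * ?v' True True False) + b02 * (a01 * ?v' True False True + b01 * ?v' True False False)) +
    b12 * (a02 * (a01 * ?v' False True True + b01 * ?v' False True False) + b02 * (a01 * ?v' False False True + b01 * ?v' False False False))"
    unfolding st'_def by (rule value_expand_3[OF D' _ _ _ _ _ _ _ w'(3,2,1)]) (use s' cin' lt' in auto)
  (* The values of the two single turns; each of them arises from a single state on one of the sides. *)
  define E1 E2 where "E1 = ?v' True False True" and "E2 = ?v True False True"
  have "value_at K s - value_at K' s =
    (b01 * a02 * a12 + a01 * a02 * b12 + d_val * b01 * a02 * b12 + b01 * b02 * b12 - a01 * b02 * a12) * E1 -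
    (b01 * a02 * a12 + a01 * a02 * b12 + d_val * b01 * a02 * b12 + b01 * b02 * b12 - a01 * b02 * a12) * E2"
    unfolding V V' v0 v1 v1l v2 v2l v12 v21 E1_def[symmetric] E2_def[symmetric] by (simp add: algebra_simps)
  then show "value_at K s = value_at K' s" unfolding id by simp
qed

text \<open>
  The order of the strands at the right edge of the square is the same in both diagrams, so corresponding
  crossings with the same strand on top have the same weights.
\<close>

lemma classical_weights_both:
  assumes N3: "N = 3" and T: "triangle K ss c" and T': "triangle K' ss c'"
    and lt: "Re (c 0 1) < Re (c 0 2)" "Re (c 0 2) < Re (c 1 2)"
    and lt': "Re (c' 1 2) < Re (c' 0 2)" "Re (c' 0 2) < Re (c' 0 1)"
  defines "\<sigma> \<equiv> ht 0 1 < ht 1 1"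
  assumes jk: "j < k" "k < 3"
  shows "strand_over K (ss ! j) (c j k) \<and> strand_over K' (ss ! j) (c' j k) \<Longrightarrow>
       classical_weights K (par j k) (c j k) \<sigma> \<and> classical_weights K' (par j k) (c' j k) \<sigma>"
    "strand_over K (ss ! k) (c k j) \<and> strand_over K' (ss ! k) (c' k j) \<Longrightarrow>
       classical_weights K (par j k) (c j k) (\<not> \<sigma>) \<and> classical_weights K' (par j k) (c' j k) (\<not> \<sigma>)"
proof -
  interpret K': local_move K' ss K by (rule local_move_sym)
  have \<sigma>': "(K'.ht 0 1 < K'.ht 1 1) = \<sigma>" unfolding \<sigma>_def using same_height_end N3 by simp
  have pe: "K'.par j k = par j k" using par' jk N3 by simp
  note W = triangle_weights[OF T N3 disjI1[OF conjI[OF lt]] jk, folded \<sigma>_def]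
  note W' = K'.triangle_weights[OF T' N3 disjI2[OF conjI[OF lt']] jk, unfolded \<sigma>' pe]
  show "classical_weights K (par j k) (c j k) \<sigma> \<and> classical_weights K' (par j k) (c' j k) \<sigma>"
    if "strand_over K (ss ! j) (c j k) \<and> strand_over K' (ss ! j) (c' j k)"
    using W(1) W'(1) that by blast
  show "classical_weights K (par j k) (c j k) (\<not> \<sigma>) \<and> classical_weights K' (par j k) (c' j k) (\<not> \<sigma>)"
    if "strand_over K (ss ! k) (c k j) \<and> strand_over K' (ss ! k) (c' k j)"
    using W(2) W'(2) that unfolding triangle_sym[OF T, of k j] triangle_sym[OF T', of k j] by blast
qed

end

section \<open>Invariance\<close>

lemma local_moveI: "diagram K \<Longrightarrow> diagram K' \<Longrightarrow> local_change K K' ss \<Longrightarrow> local_move K ss K'"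
  unfolding local_move_def local_move_axioms_def square_braid_def local_change_def by blast

lemma R2_bracket:
  assumes D: "diagram K" "diagram K'" and "R2 K K'"
  shows "bracket K = bracket K'"
proof -
  obtain s0 s1 c1 c2 where LC: "local_change K K' [s0, s1]" and d: "dpts K \<inter> square = {}"
    and d': "dpts K' \<inter> square = {c1, c2}" and ne: "c1 \<noteq> c2" and o: "strand_over K' s0 c1" "strand_over K' s0 c2"
    using assms(3) unfolding R2_def by blast
  interpret local_move K "[s0, s1]" K' by (rule local_moveI[OF D LC])
  interpret K': square_braid K' "[s0, s1]" by (rule square_braid')
  (* The two double points are not ordered by the move; a strand is a graph, so they differ in abscissa. *)
  have "Re c1 \<noteq> Re c2"
  proof
    assume e: "Re c1 = Re c2"
    have "pt K' (K'.\<rho> 0 (Re c1)) = c1" "pt K' (K'.\<rho> 0 (Re c2)) = c2"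
      using K'.through_rho(2)[of 0] K'.over_rho(2)[of 0] o by simp_all
    then show False using ne e by simp
  qed
  then consider "Re c1 < Re c2" | "Re c2 < Re c1" by linarith
  then show ?thesis
  proof cases
    case 1
    show ?thesis by (rule bracket_R2[OF _ d d' 1]) (use o in simp_all)
  next
    case 2
    have d'': "dpts K' \<inter> square = {c2, c1}" using d' by blast
    show ?thesis by (rule bracket_R2[OF _ d d'' 2]) (use o in simp_all)
  qed
qed

lemma PR2_bracket:
  assumes D: "diagram K" "diagram K'" and "PR2 K K'"
  shows "bracket K = bracket K'"
proof -
  obtain s0 s1 c1 c2 c1' c2' where LC: "local_change K K' [s0, s1]"
    and d: "dpts K \<inter> square = {c1, c2}" and lt: "Re c1 < Re c2"
    and d': "dpts K' \<inter> square = {c1', c2'}" and lt': "Re c1' < Re c2'"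
    and p: "precrossing K c1" "precrossing K' c2'"
    and s: "positive_crossing K c2 \<and> positive_crossing K' c1' \<or> negative_crossing K c2 \<and> negative_crossing K' c1'"
    using assms(3) unfolding PR2_def by blast
  interpret local_move K "[s0, s1]" K' by (rule local_moveI[OF D LC])
  interpret K': square_braid K' "[s0, s1]" by (rule square_braid')
  obtain x y where "weights K c2 x y" "weights K' c1' x y" using s weights.intros(1,2) by blast
  then have "geo_weights K (par 0 1) c2 (if par 0 1 then x else y) (if par 0 1 then y else x)"
    "geo_weights K' (par 0 1) c1' (if par 0 1 then x else y) (if par 0 1 then y else x)"
    unfolding geo_weights_def by auto
  then show ?thesis
    using bracket_PR2[OF _ d lt d' lt' pre_weights[OF p(1)] _ _ K'.pre_weights[OF p(2)]] by simp
qed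

lemma R3_bracket:
  assumes D: "diagram K" "diagram K'" and "R3 K K'"
  shows "bracket K = bracket K'"
proof -
  obtain ss c c' and z :: "nat \<Rightarrow> nat" where TM: "triangle_move K K' ss c c'" and z: "inj_on z {..<3}"
    and o: "\<And>j k. j < 3 \<Longrightarrow> k < 3 \<Longrightarrow> z k < z j \<Longrightarrow> strand_over K (ss ! j) (c j k) \<and> strand_over K' (ss ! j) (c' j k)"
    using assms(3) unfolding R3_def by blast
  have N3: "length ss = 3" and LC: "local_change K K' ss" and T: "triangle K ss c" and T': "triangle K' ss c'"
    and lt: "Re (c 0 1) < Re (c 0 2)" "Re (c 0 2) < Re (c 1 2)" and lt': "Re (c' 1 2) < Re (c' 0 2)" "Re (c' 0 2) < Re (c' 0 1)"
    using TM unfolding triangle_move_def by blast+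
  interpret local_move K ss K' by (rule local_moveI[OF D LC])
  define \<sigma> where "\<sigma> = (ht 0 1 < ht 1 1)"
  note W = classical_weights_both[OF N3 T T' lt lt', folded \<sigma>_def]
  define e where "e j k = (\<sigma> = (z k < z j))" for j k
  have w: "classical_weights K (par j k) (c j k) (e j k) \<and> classical_weights K' (par j k) (c' j k) (e j k)"
    if jk: "j < k" "k < 3" for j k
  proof -
    have j3: "j < 3" using jk by simp
    have "z j \<noteq> z k" using inj_on_eq_iff[OF z, of j k] jk by simp
    then consider "z k < z j" | "z j < z k" by linarith
    then show ?thesis
    proof cases
      case 1
      then have "e j k = \<sigma>" unfolding e_def by simp
      then show ?thesis using W(1)[OF jk o[OF j3 jk(2) 1]] by simp
    next
      case 2
      then have "e j k = (\<not> \<sigma>)" unfolding e_def by simp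
      then show ?thesis using W(2)[OF jk o[OF jk(2) j3 2]] by simp
    qed
  qed
  have z3: "z 0 \<noteq> z 1" "z 0 \<noteq> z 2" "z 1 \<noteq> z 2"
    using inj_on_eq_iff[OF z, of 0 1] inj_on_eq_iff[OF z, of 0 2] inj_on_eq_iff[OF z, of 1 2] by simp_all
  have "z 2 < z 1 \<Longrightarrow> z 1 < z 0 \<Longrightarrow> z 2 < z 0" "\<not> z 2 < z 1 \<Longrightarrow> \<not> z 1 < z 0 \<Longrightarrow> \<not> z 2 < z 0"
    using z3 by linarith+
  (* Heights are linearly ordered: the first and the last sign cannot both differ from the middle one. *)
  then have "e 1 2 = (\<not> e 0 1) \<or> e 0 1 = e 0 2" unfolding e_def by blast
  then have id: "A_sign (\<not> e 0 1) * A_sign (e 0 2) * A_sign (e 1 2) + A_sign (e 0 1) * A_sign (e 0 2) * A_sign (\<not> e 1 2) +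
      d_val * A_sign (\<not> e 0 1) * A_sign (e 0 2) * A_sign (\<not> e 1 2) +
      A_sign (\<not> e 0 1) * A_sign (\<not> e 0 2) * A_sign (\<not> e 1 2) =
      A_sign (e 0 1) * A_sign (\<not> e 0 2) * A_sign (e 1 2)"
    by (intro triangle_identity) (use inverse_pair_sign in auto)
  have lt3: "(0::nat) < 1" "(0::nat) < 2" "(1::nat) < 2" "(1::nat) < 3" "(2::nat) < 3" by simp_all
  note w01 = w[OF lt3(1,4), unfolded classical_weights_def] and w02 = w[OF lt3(2,5), unfolded classical_weights_def]
    and w12 = w[OF lt3(3,5), unfolded classical_weights_def]
  show ?thesis
    by (rule bracket_triangle[OF N3 T T' lt lt' w01[THEN conjunct1] w02[THEN conjunct1] w12[THEN conjunct1]
        w01[THEN conjunct2] w02[THEN conjunct2] w12[THEN conjunct2] id])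
qed

lemma PR3_bracket:
  assumes D: "diagram K" "diagram K'" and "PR3 K K'"
  shows "bracket K = bracket K'"
proof -
  obtain ss c c' j k l where TM: "triangle_move K K' ss c c'" and jkl: "{j, k, l} = {..<3::nat}"
    and p: "precrossing K (c j k)" "precrossing K' (c' j k)"
    and o: "(\<forall>m \<in> {j, k}. strand_over K (ss ! l) (c l m) \<and> strand_over K' (ss ! l) (c' l m)) \<or>
      (\<forall>m \<in> {j, k}. strand_over K (ss ! m) (c l m) \<and> strand_over K' (ss ! m) (c' l m))"
    using assms(3) unfolding PR3_def by blast
  have N3: "length ss = 3" and LC: "local_change K K' ss" and T: "triangle K ss c" and T': "triangle K' ss c'"
    and lt: "Re (c 0 1) < Re (c 0 2)" "Re (c 0 2) < Re (c 1 2)" and lt': "Re (c' 1 2) < Re (c' 0 2)" "Re (c' 0 2) < Re (c' 0 1)"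
    using TM unfolding triangle_move_def by blast+
  interpret local_move K ss K' by (rule local_moveI[OF D LC])
  interpret K': square_braid K' ss by (rule square_braid')
  define \<sigma> where "\<sigma> = (ht 0 1 < ht 1 1)"
  note W = classical_weights_both[OF N3 T T' lt lt', folded \<sigma>_def]
  note sym = triangle_sym[OF T] triangle_sym[OF T']
  define B where "B \<longleftrightarrow> (\<forall>m \<in> {j, k}. strand_over K (ss ! l) (c l m) \<and> strand_over K' (ss ! l) (c' l m))"
  have oB: "B \<Longrightarrow> m \<in> {j, k} \<Longrightarrow> strand_over K (ss ! l) (c l m) \<and> strand_over K' (ss ! l) (c' l m)"
    "\<not> B \<Longrightarrow> m \<in> {j, k} \<Longrightarrow> strand_over K (ss ! m) (c l m) \<and> strand_over K' (ss ! m) (c' l m)" for m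
    using o unfolding B_def by blast+
  have mem: "j < 3" "k < 3" "l < 3" "0 \<in> {j, k, l}" "1 \<in> {j, k, l}" "2 \<in> {j, k, l}"
    using jkl by auto
  have right: "classical_weights K (par l m) (c l m) (\<sigma> = B) \<and> classical_weights K' (par l m) (c' l m) (\<sigma> = B)"
    if m: "m \<in> {j, k}" "l < m" for m
  proof -
    have m3: "m < 3" using m mem by auto
    show ?thesis
    proof (cases B)
      case True
      then show ?thesis using W(1)[OF m(2) m3 oB(1)[OF True m(1)]] by simp
    next
      case False
      then show ?thesis using W(2)[OF m(2) m3] oB(2)[OF False m(1)] unfolding sym(1)[of l m] sym(2)[of l m] by simp
    qed
  qed
  have left: "classical_weights K (par m l) (c m l) (\<sigma> \<noteq> B) \<and> classical_weights K' (par m l) (c' m l) (\<sigma> \<noteq> B)"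
    if m: "m \<in> {j, k}" "m < l" for m
  proof (cases B)
    case True
    then show ?thesis using W(2)[OF m(2) mem(3) oB(1)[OF True m(1)]] by simp
  next
    case False
    then show ?thesis using W(1)[OF m(2) mem(3)] oB(2)[OF False m(1)] unfolding sym(1)[of l m] sym(2)[of l m] by simp
  qed
  note pw = pre_weights[OF p(1)] and pw' = K'.pre_weights[OF p(2)]
  note inv = inverse_pair_sign[of "\<sigma> \<noteq> B"] inverse_pair_sign[of "\<sigma> = B"]
  have "l = 0 \<and> (j = 1 \<and> k = 2 \<or> j = 2 \<and> k = 1) \<or> l = 1 \<and> (j = 0 \<and> k = 2 \<or> j = 2 \<and> k = 0) \<or>
      l = 2 \<and> (j = 0 \<and> k = 1 \<or> j = 1 \<and> k = 0)"
    using mem unfolding insert_iff empty_iff by presburger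
  then consider "l = 0" "{j, k} = {1, 2}" "c j k = c 1 2" "c' j k = c' 1 2"
    | "l = 1" "{j, k} = {0, 2}" "c j k = c 0 2" "c' j k = c' 0 2"
    | "l = 2" "{j, k} = {0, 1}" "c j k = c 0 1" "c' j k = c' 0 1"
    using sym[of 2 1] sym[of 2 0] sym[of 1 0] by (elim disjE conjE) (simp_all add: insert_commute)
  then show ?thesis
  proof cases
    case 1
    have "1 \<in> {j, k}" "2 \<in> {j, k}" "l < 1" "l < 2" using 1(1,2) by auto
    note r = right[OF this(1,3), unfolded classical_weights_def 1(1)] right[OF this(2,4), unfolded classical_weights_def 1(1)]
    show ?thesis
      by (rule bracket_triangle[OF N3 T T' lt lt' conjunct1[OF r(1)] conjunct1[OF r(2)] pw[of "par 1 2", unfolded 1(3)]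
          conjunct2[OF r(1)] conjunct2[OF r(2)] pw'[of "par 1 2", unfolded 1(4)]], rule triangle_identity) (use inv in blast)
  next
    case 2
    have "0 \<in> {j, k}" "2 \<in> {j, k}" "0 < l" "l < 2" using 2(1,2) by auto
    note r = left[OF this(1,3), unfolded classical_weights_def 2(1)] right[OF this(2,4), unfolded classical_weights_def 2(1)]
    have "A_sign (\<not> (\<sigma> \<noteq> B)) = A_sign (\<sigma> = B)" by simp
    then show ?thesis
      by (intro bracket_triangle[OF N3 T T' lt lt' conjunct1[OF r(1)] pw[of "par 0 2", unfolded 2(3)] conjunct1[OF r(2)]
          conjunct2[OF r(1)] pw'[of "par 0 2", unfolded 2(4)] conjunct2[OF r(2)]] triangle_identity) (use inv in auto)
  next
    case 3
    have "0 \<in> {j, k}" "1 \<in> {j, k}" "0 < l" "1 < l" using 3(1,2) by auto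
    note r = left[OF this(1,3), unfolded classical_weights_def 3(1)] left[OF this(2,4), unfolded classical_weights_def 3(1)]
    show ?thesis
      by (rule bracket_triangle[OF N3 T T' lt lt' pw[of "par 0 1", unfolded 3(3)] conjunct1[OF r(1)] conjunct1[OF r(2)]
          pw'[of "par 0 1", unfolded 3(4)] conjunct2[OF r(1)] conjunct2[OF r(2)]], rule triangle_identity) (use inv in blast)
  qed
qed

theorem proposition1p6:
  fixes K K' :: diagram_data
  assumes "diagram K" and "diagram K'" and "regular_isotopic K K'"
  shows "bracket K = bracket K'"
  using assms(3) unfolding regular_isotopic_def
proof (induction rule: equivclp_induct)
  case (step y z)
  then show ?case
    using R0_bracket R2_bracket R3_bracket PR2_bracket PR3_bracket by metis
qed simp

end
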